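(* Let $M$ be a toric manifold endowed with a Kähler structure such that the $\mathbb{T}^n$-action is Hamiltonian. Consider the volume functional $\mathrm{Vol}$ restricted to the set of non-degenerate $\mathbb{T}^n$-orbits. Then: 1. $\mathrm{Ric}<0$ if and only if $\log\mathrm{Vol}$ is strictly convex. This implies $\mathrm{Vol}$ is strictly convex. Such manifolds cannot be compact. 2. $\mathrm{Ric}>0$ if and only if $-\log\mathrm{Vol}$ is strictly convex. This implies $1/\mathrm{Vol}$ is strictly convex. If $M$ is compact then $\mathrm{Vol}$ has a unique critical point, corresponding to a global maximum. It is a minimal Lagrangian $n$-torus.
   Context: Here $\mathbb{T}^n=\mathrm{U}(1)^n$, with complexification $(\mathbb{C}^* )^n$. A toric manifold is a complex $n$-dimensional manifold $M$, not necessarily compact, containing $(\mathbb{C}^* )^n$ as a dense open orbit of a holomorphic action of $(\mathbb{C}^* )^n$ on $M$. The non-degenerate $\mathbb{T}^n$-orbits are those of dimension $n$, contained in the dense open $(\mathbb{C}^* )^n$-orbit. The set of these orbits is identified with $(\mathbb{C}^* )^n/\mathbb{T}^n$ and, using the isomorphism $\exp:\mathbb{C}^n/2\pi i\,\mathbb{Z}^n\to(\mathbb{C}^* )^n$, with $\mathbb{R}^n$; convexity of functions on the set of orbits means convexity along the straight lines of $\mathbb{R}^n$. $\mathrm{Vol}$ assigns to each orbit its $n$-dimensional Riemannian volume with respect to the Kähler metric, and $\mathrm{Ric}$ is the Ricci curvature of the Kähler metric on $M$. A (right) action of a Lie group $G$ with Lie algebra $\mathfrak{g}$ on a symplectic manifold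 $(M,\omega)$ is Hamiltonian if there is a map $\mu:M\to\mathfrak{g}^*$ such that $d\mu\cdot X=\iota_{\tilde X}\omega$ for all $X\in\mathfrak{g}$, where $\tilde X$ is the fundamental vector field of $X$, and $\mu$ is $G$-equivariant with respect to the (right) coadjoint action. A submanifold is minimal if its mean curvature vanishes, and Lagrangian if it has real dimension $n$ and $\omega$ restricts to zero on it.
   Formalization: Ric<0 and Ric>0 are required only on the dense open orbit (on all of M, "log Vol strictly convex implies Ric<0" fails, e.g. for e^{2|z|^4}|dz|^2 on C, flat at 0); strictly convex means positive second derivative along every line. *)

theory Defs
  imports "HOL-Analysis.Analysis"
begin

section \<open>Smooth and holomorphic maps between open sets\<close>

abbreviation dir_deriv ::
  "('a::real_normed_vector \<Rightarrow> 'b::real_normed_vector) \<Rightarrow> 'a \<Rightarrow> 'a \<Rightarrow> 'b" where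
  "dir_deriv f x v \<equiv> frechet_derivative f (at x) v"

primrec Ck_on ::
  "nat \<Rightarrow> ('a::euclidean_space \<Rightarrow> 'b::real_normed_vector) \<Rightarrow> 'a set \<Rightarrow> bool" where
  "Ck_on 0 f S \<longleftrightarrow> continuous_on S f"
| "Ck_on (Suc k) f S \<longleftrightarrow>
     (\<forall>x\<in>S. f differentiable (at x)) \<and> (\<forall>v. Ck_on k (\<lambda>x. dir_deriv f x v) S)"

(* only used for open S *)
definition smooth_on ::
  "('a::euclidean_space \<Rightarrow> 'b::real_normed_vector) \<Rightarrow> 'a set \<Rightarrow> bool" where
  "smooth_on f S \<longleftrightarrow> (\<forall>k. Ck_on k f S)"

definition Jmul :: "complex ^ 'n \<Rightarrow> complex ^ 'n" where
  "Jmul v = \<i> *s v"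

(* Holomorphic in several variables: smooth with complex linear differential, i.e. the
   Cauchy-Riemann equations hold. J and J' are multiplication by the imaginary unit on the
   source and the target; passing them explicitly allows products as source. *)
definition holo_on ::
  "('a::euclidean_space \<Rightarrow> 'a) \<Rightarrow> ('b::euclidean_space \<Rightarrow> 'b) \<Rightarrow> ('a \<Rightarrow> 'b) \<Rightarrow> 'a set \<Rightarrow> bool" where
  "holo_on J J' f S \<longleftrightarrow>
     smooth_on f S \<and> (\<forall>x\<in>S. \<forall>v. dir_deriv f x (J v) = J' (dir_deriv f x v))"


section \<open>Local Riemannian geometry\<close>

text \<open>A metric on an open subset of a Euclidean space is a function of a point and two tangent
  vectors. The formulas below are the usual ones in linear coordinates, written without indices.\<close>

(* Christoffel symbols, contracted with v and w: the covariant derivative along v of the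
   constant vector field w, given by the Koszul formula. *)
definition christoffel ::
  "('e::euclidean_space \<Rightarrow> 'e \<Rightarrow> 'e \<Rightarrow> real) \<Rightarrow> 'e \<Rightarrow> 'e \<Rightarrow> 'e \<Rightarrow> 'e" where
  "christoffel h x v w = (THE u. \<forall>z. h x u z =
     (dir_deriv (\<lambda>y. h y w z) x v + dir_deriv (\<lambda>y. h y v z) x w
        - dir_deriv (\<lambda>y. h y v w) x z) / 2)"

(* R(u,v)w for constant fields u, v, w, with R(u,v) = [D_u, D_v] - D_[u,v] *)
definition riemann ::
  "('e::euclidean_space \<Rightarrow> 'e \<Rightarrow> 'e \<Rightarrow> real) \<Rightarrow> 'e \<Rightarrow> 'e \<Rightarrow> 'e \<Rightarrow> 'e \<Rightarrow> 'e" where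
  "riemann h x u v w =
     dir_deriv (\<lambda>y. christoffel h y v w) x u - dir_deriv (\<lambda>y. christoffel h y u w) x v
     + christoffel h x u (christoffel h x v w) - christoffel h x v (christoffel h x u w)"

(* the trace of u |-> R(u,v)w; the trace does not depend on the metric, so it may be computed
   in the standard orthonormal basis *)
definition ricci ::
  "('e::euclidean_space \<Rightarrow> 'e \<Rightarrow> 'e \<Rightarrow> real) \<Rightarrow> 'e \<Rightarrow> 'e \<Rightarrow> 'e \<Rightarrow> real" where
  "ricci h x v w = (\<Sum>b\<in>Basis. riemann h x b v w \<bullet> b)"

definition partial_d :: "(real ^ 'n \<Rightarrow> 'e::real_normed_vector) \<Rightarrow> 'n \<Rightarrow> real ^ 'n \<Rightarrow> 'e" where
  "partial_d u i \<theta> = dir_deriv u \<theta> (axis i 1)"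

definition gram ::
  "('e::euclidean_space \<Rightarrow> 'e \<Rightarrow> 'e \<Rightarrow> real) \<Rightarrow> (real ^ 'n \<Rightarrow> 'e) \<Rightarrow> real ^ 'n \<Rightarrow> real ^ 'n ^ 'n" where
  "gram h u \<theta> = (\<chi> i j. h (u \<theta>) (partial_d u i \<theta>) (partial_d u j \<theta>))"

definition normal_part ::
  "('e::euclidean_space \<Rightarrow> 'e \<Rightarrow> 'e \<Rightarrow> real) \<Rightarrow> (real ^ 'n \<Rightarrow> 'e) \<Rightarrow> real ^ 'n \<Rightarrow> 'e \<Rightarrow> 'e" where
  "normal_part h u \<theta> w = (THE N. (\<forall>k. h (u \<theta>) N (partial_d u k \<theta>) = 0) \<and>
     w - N \<in> span (range (\<lambda>k. partial_d u k \<theta>)))"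

definition second_ff ::
  "('e::euclidean_space \<Rightarrow> 'e \<Rightarrow> 'e \<Rightarrow> real) \<Rightarrow> (real ^ 'n \<Rightarrow> 'e) \<Rightarrow> real ^ 'n \<Rightarrow> 'n \<Rightarrow> 'n \<Rightarrow> 'e" where
  "second_ff h u \<theta> i j = normal_part h u \<theta>
     (partial_d (partial_d u j) i \<theta> + christoffel h (u \<theta>) (partial_d u i \<theta>) (partial_d u j \<theta>))"

definition mean_curvature ::
  "('e::euclidean_space \<Rightarrow> 'e \<Rightarrow> 'e \<Rightarrow> real) \<Rightarrow> (real ^ 'n \<Rightarrow> 'e) \<Rightarrow> real ^ 'n \<Rightarrow> 'e" where
  "mean_curvature h u \<theta> =
     (\<Sum>i\<in>UNIV. \<Sum>j\<in>UNIV. (matrix_inv (gram h u \<theta>) $ i $ j) *\<^sub>R second_ff h u \<theta> i j)"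


section \<open>Complex manifolds and Kaehler metrics\<close>

text \<open>The underlying set of the manifold is the whole type; a chart is its domain together with
  the coordinate map. The complex dimension is \<open>CARD('n)\<close>.\<close>

type_synonym ('a, 'n) chart = "'a set \<times> ('a \<Rightarrow> complex ^ 'n)"

abbreviation cdom :: "('a, 'n) chart \<Rightarrow> 'a set" where "cdom c \<equiv> fst c"
abbreviation cmap :: "('a, 'n) chart \<Rightarrow> 'a \<Rightarrow> complex ^ 'n" where "cmap c \<equiv> snd c"
abbreviation cinv :: "('a, 'n) chart \<Rightarrow> complex ^ 'n \<Rightarrow> 'a" where
  "cinv c \<equiv> inv_into (cdom c) (cmap c)"

definition complex_atlas ::
  "('a::{t2_space,second_countable_topology}, 'n::finite) chart set \<Rightarrow> bool" where
  "complex_atlas A \<longleftrightarrow>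
     (\<Union>c\<in>A. cdom c) = UNIV \<and>
     (\<forall>c\<in>A. open (cdom c) \<and> open (cmap c ` cdom c) \<and>
        homeomorphism (cdom c) (cmap c ` cdom c) (cmap c) (cinv c)) \<and>
     (\<forall>c\<in>A. \<forall>d\<in>A. holo_on Jmul Jmul (cmap d \<circ> cinv c) (cmap c ` (cdom c \<inter> cdom d)))"

text \<open>A metric on the manifold is given by its coordinate expression in every chart; its values
  outside the image of the chart are irrelevant.\<close>

type_synonym ('a, 'n) metric =
  "('a, 'n) chart \<Rightarrow> complex ^ 'n \<Rightarrow> complex ^ 'n \<Rightarrow> complex ^ 'n \<Rightarrow> real"

definition riemannian_metric :: "('a::topological_space, 'n::finite) chart set \<Rightarrow> ('a, 'n) metric \<Rightarrow> bool" where
  "riemannian_metric A g \<longleftrightarrow>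
     (\<forall>c\<in>A. \<forall>v w. smooth_on (\<lambda>x. g c x v w) (cmap c ` cdom c)) \<and>
     (\<forall>c\<in>A. \<forall>x\<in>cmap c ` cdom c. bilinear (g c x) \<and>
        (\<forall>v w. g c x v w = g c x w v) \<and> (\<forall>v. v \<noteq> 0 \<longrightarrow> g c x v v > 0)) \<and>
     (\<forall>c\<in>A. \<forall>d\<in>A. \<forall>x\<in>cmap c ` (cdom c \<inter> cdom d). \<forall>v w.
        g c x v w = g d ((cmap d \<circ> cinv c) x)
          (dir_deriv (cmap d \<circ> cinv c) x v) (dir_deriv (cmap d \<circ> cinv c) x w))"

definition kaehler_form :: "('a, 'n::finite) metric \<Rightarrow> ('a, 'n) metric" where
  "kaehler_form g c x v w = g c x (Jmul v) w"

definition kaehler_metric :: "('a::topological_space, 'n::finite) chart set \<Rightarrow> ('a, 'n) metric \<Rightarrow> bool" where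
  "kaehler_metric A g \<longleftrightarrow>
     riemannian_metric A g \<and>
     (\<forall>c\<in>A. \<forall>x\<in>cmap c ` cdom c. \<forall>v w. g c x (Jmul v) (Jmul w) = g c x v w) \<and>
     (\<forall>c\<in>A. \<forall>x\<in>cmap c ` cdom c. \<forall>u v w.
        dir_deriv (\<lambda>y. kaehler_form g c y v w) x u
        + dir_deriv (\<lambda>y. kaehler_form g c y w u) x v
        + dir_deriv (\<lambda>y. kaehler_form g c y u v) x w = 0)"

definition ric_negative_on ::
  "('a, 'n::finite) chart set \<Rightarrow> ('a, 'n) metric \<Rightarrow> 'a set \<Rightarrow> bool" where
  "ric_negative_on A g S \<longleftrightarrow>
     (\<forall>p\<in>S. \<forall>c\<in>A. p \<in> cdom c \<longrightarrow> (\<forall>v. v \<noteq> 0 \<longrightarrow> ricci (g c) (cmap c p) v v < 0))"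

definition ric_positive_on ::
  "('a, 'n::finite) chart set \<Rightarrow> ('a, 'n) metric \<Rightarrow> 'a set \<Rightarrow> bool" where
  "ric_positive_on A g S \<longleftrightarrow>
     (\<forall>p\<in>S. \<forall>c\<in>A. p \<in> cdom c \<longrightarrow> (\<forall>v. v \<noteq> 0 \<longrightarrow> ricci (g c) (cmap c p) v v > 0))"


section \<open>Immersed submanifolds\<close>

definition chart_at :: "('a, 'n::finite) chart set \<Rightarrow> 'a \<Rightarrow> ('a, 'n) chart" where
  "chart_at A p = (SOME c. c \<in> A \<and> p \<in> cdom c)"

definition immersion :: "('a::topological_space, 'n::finite) chart set \<Rightarrow> (real ^ 'n \<Rightarrow> 'a) \<Rightarrow> bool" where
  "immersion A F \<longleftrightarrow> continuous_on UNIV F \<and>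
     (\<forall>c\<in>A. smooth_on (cmap c \<circ> F) (F -` cdom c) \<and>
        (\<forall>\<theta>\<in>F -` cdom c. inj (dir_deriv (cmap c \<circ> F) \<theta>)))"

definition riem_volume ::
  "('a, 'n::finite) chart set \<Rightarrow> ('a, 'n) metric \<Rightarrow> (real ^ 'n \<Rightarrow> 'a) \<Rightarrow> (real ^ 'n) set \<Rightarrow> real" where
  "riem_volume A g F D =
     integral D (\<lambda>\<theta>. let c = chart_at A (F \<theta>) in sqrt (det (gram (g c) (cmap c \<circ> F) \<theta>)))"

definition lagrangian ::
  "('a, 'n::finite) chart set \<Rightarrow> ('a, 'n) metric \<Rightarrow> (real ^ 'n \<Rightarrow> 'a) \<Rightarrow> bool" where
  "lagrangian A g F \<longleftrightarrow> (\<forall>c\<in>A. \<forall>\<theta>\<in>F -` cdom c. \<forall>v w.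
     kaehler_form g c (cmap c (F \<theta>))
       (dir_deriv (cmap c \<circ> F) \<theta> v) (dir_deriv (cmap c \<circ> F) \<theta> w) = 0)"

definition minimal ::
  "('a, 'n::finite) chart set \<Rightarrow> ('a, 'n) metric \<Rightarrow> (real ^ 'n \<Rightarrow> 'a) \<Rightarrow> bool" where
  "minimal A g F \<longleftrightarrow>
     (\<forall>c\<in>A. \<forall>\<theta>\<in>F -` cdom c. mean_curvature (g c) (cmap c \<circ> F) \<theta> = 0)"

(* F induces an injective immersion of the compact torus R^n / (2 pi Z)^n, hence an embedding,
   with image L *)
definition minimal_lagrangian_torus ::
  "('a::topological_space, 'n::finite) chart set \<Rightarrow> ('a, 'n) metric \<Rightarrow> 'a set \<Rightarrow> bool" where
  "minimal_lagrangian_torus A g L \<longleftrightarrow> (\<exists>F :: real ^ 'n \<Rightarrow> 'a.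
     immersion A F \<and> range F = L \<and>
     (\<forall>\<theta> \<eta>. F \<theta> = F \<eta> \<longleftrightarrow> (\<forall>i. \<exists>k::int. \<theta> $ i - \<eta> $ i = 2 * pi * of_int k)) \<and>
     lagrangian A g F \<and> minimal A g F)"


section \<open>Toric manifolds\<close>

text \<open>Products and the unit of \<open>complex ^ 'n\<close> are componentwise.\<close>

definition ctorus :: "(complex ^ 'n) set" where
  "ctorus = {t. \<forall>i. t $ i \<noteq> 0}"

definition torus :: "(complex ^ 'n) set" where
  "torus = {t. \<forall>i. norm (t $ i) = 1}"

definition holomorphic_action ::
  "('a::topological_space, 'n::finite) chart set \<Rightarrow> (complex ^ 'n \<Rightarrow> 'a \<Rightarrow> 'a) \<Rightarrow> bool" where
  "holomorphic_action A act \<longleftrightarrow>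
     (\<forall>p. act 1 p = p) \<and>
     (\<forall>s\<in>ctorus. \<forall>t\<in>ctorus. \<forall>p. act (s * t) p = act s (act t p)) \<and>
     continuous_on (ctorus \<times> UNIV) (\<lambda>(t, p). act t p) \<and>
     (\<forall>c\<in>A. \<forall>d\<in>A. holo_on (map_prod Jmul Jmul) Jmul
        (\<lambda>(t, x). cmap d (act t (cinv c x)))
        {(t, x). t \<in> ctorus \<and> x \<in> cmap c ` cdom c \<and> act t (cinv c x) \<in> cdom d})"

definition big_orbit :: "(complex ^ 'n \<Rightarrow> 'a \<Rightarrow> 'a) \<Rightarrow> 'a \<Rightarrow> 'a set" where
  "big_orbit act p0 = (\<lambda>t. act t p0) ` ctorus"

(* The complex torus is embedded by t |-> act t p0. An injective orbit map is an immersion, as a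
   kernel of its differential would integrate to a one-parameter group fixing p0; so it is
   biholomorphic onto its open image. *)
definition toric_manifold ::
  "('a::{t2_space,second_countable_topology}, 'n::finite) chart set \<Rightarrow>
     (complex ^ 'n \<Rightarrow> 'a \<Rightarrow> 'a) \<Rightarrow> 'a \<Rightarrow> bool" where
  "toric_manifold A act p0 \<longleftrightarrow>
     complex_atlas A \<and> holomorphic_action A act \<and>
     inj_on (\<lambda>t. act t p0) ctorus \<and>
     open (big_orbit act p0) \<and> closure (big_orbit act p0) = UNIV"

text \<open>The Lie algebra of the compact torus is \<open>real ^ 'n\<close> with exponential map
  \<open>X \<mapsto> (\<chi> i. cis (X $ i))\<close>; its dual is identified with \<open>real ^ 'n\<close> by the inner product. The
  torus is abelian, so left and right actions coincide and its coadjoint action is trivial.\<close>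

definition fundamental_field ::
  "(complex ^ 'n \<Rightarrow> 'a \<Rightarrow> 'a) \<Rightarrow> real ^ 'n \<Rightarrow> ('a, 'n::finite) chart \<Rightarrow> 'a \<Rightarrow> complex ^ 'n" where
  "fundamental_field act X c p =
     vector_derivative (\<lambda>r. cmap c (act (\<chi> i. cis (r * X $ i)) p)) (at 0)"

definition hamiltonian_torus_action ::
  "('a, 'n::finite) chart set \<Rightarrow> ('a, 'n) metric \<Rightarrow> (complex ^ 'n \<Rightarrow> 'a \<Rightarrow> 'a) \<Rightarrow> bool" where
  "hamiltonian_torus_action A g act \<longleftrightarrow> (\<exists>\<mu> :: 'a \<Rightarrow> real ^ 'n.
     (\<forall>c\<in>A. \<forall>p\<in>cdom c. \<forall>X.
        ((\<lambda>x. \<mu> (cinv c x) \<bullet> X) has_derivative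
           (\<lambda>v. kaehler_form g c (cmap c p) (fundamental_field act X c p) v)) (at (cmap c p))) \<and>
     (\<forall>t\<in>torus. \<forall>p. \<mu> (act t p) = \<mu> p))"

text \<open>The orbits of the compact torus in the big orbit are indexed by \<open>real ^ 'n\<close>: the point
  \<open>x\<close> stands for the orbit through \<open>act (exp x) p0\<close>, which is parametrised by the imaginary part
  of the exponential map of the complex torus.\<close>

definition orbit_param ::
  "(complex ^ 'n \<Rightarrow> 'a \<Rightarrow> 'a) \<Rightarrow> 'a \<Rightarrow> real ^ 'n \<Rightarrow> real ^ 'n \<Rightarrow> 'a" where
  "orbit_param act p0 x \<theta> = act (\<chi> i. exp (Complex (x $ i) (\<theta> $ i))) p0"

definition torus_orbit :: "(complex ^ 'n \<Rightarrow> 'a \<Rightarrow> 'a) \<Rightarrow> 'a \<Rightarrow> real ^ 'n \<Rightarrow> 'a set" where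
  "torus_orbit act p0 x = (\<lambda>t. act t (act (\<chi> i. exp (complex_of_real (x $ i))) p0)) ` torus"

definition orbit_volume ::
  "('a, 'n::finite) chart set \<Rightarrow> ('a, 'n) metric \<Rightarrow> (complex ^ 'n \<Rightarrow> 'a \<Rightarrow> 'a) \<Rightarrow> 'a \<Rightarrow>
     real ^ 'n \<Rightarrow> real" where
  "orbit_volume A g act p0 x =
     riem_volume A g (orbit_param act p0 x) (cbox 0 (\<chi> i. 2 * pi))"


section \<open>Strict convexity\<close>

(* The differential-geometric notion: positive second derivative along every straight line.
   For the weaker order-theoretic notion the equivalence with a strict sign of the Ricci
   curvature fails, as for (x::real)^4 at 0. *)
definition strictly_convex :: "('e::real_normed_vector \<Rightarrow> real) \<Rightarrow> bool" where
  "strictly_convex f \<longleftrightarrow> (\<forall>x v. v \<noteq> 0 \<longrightarrow> (\<exists>f' f''. \<forall>t.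
     ((\<lambda>t. f (x + t *\<^sub>R v)) has_real_derivative f' t) (at t) \<and>
     (f' has_real_derivative f'' t) (at t) \<and> f'' t > 0))"

definition critical_point :: "('e::real_normed_vector \<Rightarrow> real) \<Rightarrow> 'e \<Rightarrow> bool" where
  "critical_point f x \<longleftrightarrow> (f has_derivative (\<lambda>_. 0)) (at x)"

end

(* The orbit map of the complex torus turns the big orbit into logarithmic coordinates w = x + i t
   on C^n, in which the compact torus acts by translations of t. The moment map mu is a function of
   x, orbits of the compact torus are Lagrangian, and the metric is G(x)(X, X') + G(x)(Y, Y') on
   vectors X + iY, X' + iY', where G is minus the differential of mu and hence locally a Hessian.
   So Vol(x) is a constant times sqrt(det G(x)), and the Ricci curvature of X + iY is minus the sum
   of the second derivatives of log Vol along X and Y. If the manifold is compact, the Gram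
   determinant of the fundamental vector fields attains its maximum; it vanishes off the big orbit,
   since a point with independent fundamental fields has an open orbit. Hence Vol has a maximum,
   and the mean curvature of an orbit is the gradient of log Vol up to a factor. *)

theory Submission
  imports Defs
begin

section \<open>Calculus of smooth maps\<close>

text \<open>As exp is periodic, the logarithmic coordinates form a covering, not a chart: the orbit
  map read in a chart of the atlas is only a local diffeomorphism. Ricci curvature, Gram matrices
  and second fundamental forms are therefore transported along maps with injective differential.
  \<open>christoffel\<close> is a definite description, so even its differentiability has to be
  extracted from the linear equation that it solves.

  Let C be the connection of G. Total symmetry of dG gives dG = 2 G(C, .). Hence the connection of
  the Kaehler metric is the complex bilinear extension of C, and the trace of C is the differential
  of log Vol. In the Ricci trace the terms quadratic in C have to disappear. This is flatness of the
  connection with symbols 2 C, dual to the flat coordinate connection, and it comes from commuting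
  second derivatives of G.

  That the metric is constant along the orbits of the compact torus is deduced from the invariance
  of mu, whose derivative determines G.\<close>

lemmas frechet_derivative_worksI = frechet_derivative_works[THEN iffD1]

lemma linear_basis_expansion:
  assumes "linear (f :: 'a::euclidean_space \<Rightarrow> 'b::real_vector)"
  shows "f v = (\<Sum>b\<in>Basis. (v \<bullet> b) *\<^sub>R f b)"
proof -
  have "f v = f (\<Sum>b\<in>Basis. (v \<bullet> b) *\<^sub>R b)" by (simp add: euclidean_representation)
  also have "\<dots> = (\<Sum>b\<in>Basis. (v \<bullet> b) *\<^sub>R f b)"
    using assms by (simp add: linear_sum linear_cmul)
  finally show ?thesis .
qed

lemma dir_deriv_eq: "(f has_derivative f') (at x) \<Longrightarrow> dir_deriv f x v = f' v"
  by (metis frechet_derivative_at)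

text \<open>On an open set the values on \<open>S\<close> determine the germ at each point of
  \<open>S\<close>, hence derivatives of every order.\<close>

lemma Ck_on_cong:
  assumes "open S" "Ck_on k f S" "\<And>x. x \<in> S \<Longrightarrow> f x = g x"
  shows "Ck_on k g S"
  using assms
proof (induction k arbitrary: f g)
  case 0
  then show ?case by (simp add: continuous_on_eq)
next
  case (Suc k)
  have d: "g differentiable (at x)" if "x \<in> S" for x
    using Suc.prems that by (metis Ck_on.simps(2) differentiable_def has_derivative_transform_within_open)
  have "dir_deriv f x v = dir_deriv g x v" if "x \<in> S" for x v
    using Suc.prems that by (metis Ck_on.simps(2) frechet_derivative_transform_within_open)
  with Suc d show ?case by (metis (no_types, lifting) Ck_on.simps(2))
qed

lemma Ck_on_SucD: "Ck_on (Suc k) f S \<Longrightarrow> Ck_on k f S"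
proof (induction k arbitrary: f)
  case 0
  then show ?case
    by (auto intro!: continuous_at_imp_continuous_on differentiable_imp_continuous_within)
next
  case (Suc k)
  then show ?case by (metis Ck_on.simps(2))
qed

lemma Ck_on_subset: "Ck_on k f S \<Longrightarrow> T \<subseteq> S \<Longrightarrow> Ck_on k f T"
proof (induction k arbitrary: f)
  case 0
  then show ?case by (auto intro: continuous_on_subset)
next
  case (Suc k)
  then show ?case by (auto simp: subset_iff)
qed

lemma Ck_on_const: "Ck_on k (\<lambda>x. c) S"
  by (induction k arbitrary: c) auto

lemma Ck_on_bounded_linear:
  assumes "bounded_linear f"
  shows "Ck_on k f S"
proof (cases k)
  case 0
  with assms show ?thesis by (simp add: linear_continuous_on)
next
  case (Suc j)
  have "dir_deriv f x v = f v" for x v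
    using bounded_linear_imp_has_derivative[OF assms] by (metis frechet_derivative_at)
  with Suc assms show ?thesis
    by (simp add: Ck_on_const bounded_linear_imp_differentiable)
qed

lemma Ck_on_add:
  assumes "open S" "Ck_on k f S" "Ck_on k g S"
  shows "Ck_on k (\<lambda>x. f x + g x) S"
  using assms(2,3)
proof (induction k arbitrary: f g)
  case 0
  then show ?case by (simp add: continuous_on_add)
next
  case (Suc k)
  have "Ck_on k (\<lambda>x. dir_deriv (\<lambda>x. f x + g x) x v) S" for v
  proof (rule Ck_on_cong[OF assms(1)])
    show "Ck_on k (\<lambda>x. dir_deriv f x v + dir_deriv g x v) S"
      by (rule Suc.IH) (use Suc.prems in simp_all)
    show "dir_deriv f x v + dir_deriv g x v = dir_deriv (\<lambda>x. f x + g x) x v" if "x \<in> S" for x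
      by (rule dir_deriv_eq[symmetric], intro has_derivative_add)
        (use Suc.prems that in \<open>simp_all add: frechet_derivative_worksI\<close>)
  qed
  with Suc show ?case by simp
qed

lemma Ck_on_sum:
  assumes "open S" "\<And>i. i \<in> I \<Longrightarrow> Ck_on k (f i) S"
  shows "Ck_on k (\<lambda>x. \<Sum>i\<in>I. f i x) S"
  using assms(2)
  by (induction I rule: infinite_finite_induct) (auto simp: Ck_on_const intro: Ck_on_add assms(1))

text \<open>The Leibniz rule stays within expressions of the form \<open>B f g\<close>, so one
  induction over all \<open>f\<close> and \<open>g\<close> covers scalar multiples, inner products
  and componentwise products.\<close>

lemma Ck_on_bilinear:
  assumes "bounded_bilinear B" "open S" "Ck_on k f S" "Ck_on k g S"
  shows "Ck_on k (\<lambda>x. B (f x) (g x)) S"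
  using assms(3,4)
proof (induction k arbitrary: f g)
  case 0
  then show ?case using assms(1) by (simp add: bounded_bilinear.continuous_on)
next
  case (Suc k)
  have d: "((\<lambda>x. B (f x) (g x)) has_derivative (\<lambda>v. B (f x) (dir_deriv g x v) + B (dir_deriv f x v) (g x))) (at x)"
    if "x \<in> S" for x
    using Suc.prems that
    by (intro bounded_bilinear.FDERIV[OF assms(1)]) (simp_all add: frechet_derivative_worksI)
  have "Ck_on k (\<lambda>x. dir_deriv (\<lambda>x. B (f x) (g x)) x v) S" for v
  proof (rule Ck_on_cong[OF assms(2)])
    show "Ck_on k (\<lambda>x. B (f x) (dir_deriv g x v) + B (dir_deriv f x v) (g x)) S"
      using Suc.prems by (intro Ck_on_add assms(2) Suc.IH) (auto intro: Ck_on_SucD)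
    show "B (f x) (dir_deriv g x v) + B (dir_deriv f x v) (g x) = dir_deriv (\<lambda>x. B (f x) (g x)) x v"
      if "x \<in> S" for x
      using frechet_derivative_at[OF d[OF that]] by metis
  qed
  then show ?case using d by (auto simp: differentiable_def)
qed

text \<open>\<open>Ck_on\<close> controls derivatives in constant directions, while the chain rule
  produces the moving direction \<open>dir_deriv f x v\<close>. Expanding it in the basis leaves
  real coefficients times compositions of lower order.\<close>

lemma Ck_on_compose:
  fixes f :: "'a::euclidean_space \<Rightarrow> 'b::euclidean_space"
  assumes "open S" "open T" "Ck_on k g T" "Ck_on k f S" "\<And>x. x \<in> S \<Longrightarrow> f x \<in> T"
  shows "Ck_on k (\<lambda>x. g (f x)) S"
  using assms(3,4)
proof (induction k arbitrary: g)
  case 0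
  then show ?case
    using assms(5) by (auto intro!: continuous_on_compose2[of T g S f])
next
  case (Suc k)
  have d: "((\<lambda>x. g (f x)) has_derivative (\<lambda>v. dir_deriv g (f x) (dir_deriv f x v))) (at x)"
    if "x \<in> S" for x
    using Suc.prems that assms(5)
    by (intro diff_chain_at[of f _ x g, unfolded o_def]) (simp_all add: frechet_derivative_worksI)
  have "Ck_on k (\<lambda>x. dir_deriv (\<lambda>x. g (f x)) x v) S" for v
  proof (rule Ck_on_cong[OF assms(1)])
    show "Ck_on k (\<lambda>x. \<Sum>b\<in>Basis. (dir_deriv f x v \<bullet> b) *\<^sub>R dir_deriv g (f x) b) S"
    proof (intro Ck_on_sum assms(1) Ck_on_bilinear[OF bounded_bilinear_scaleR])
      fix b
      have "Ck_on k (\<lambda>x. dir_deriv f x v) S" using Suc.prems by simp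
      then show "Ck_on k (\<lambda>x. dir_deriv f x v \<bullet> b) S"
        by (intro Ck_on_bilinear[OF bounded_bilinear_inner] assms(1) Ck_on_const)
      show "Ck_on k (\<lambda>x. dir_deriv g (f x) b) S"
      proof (rule Suc.IH)
        show "Ck_on k (\<lambda>x. dir_deriv g x b) T" using Suc.prems by simp
      qed (rule Ck_on_SucD[OF Suc.prems(2)])
    qed
    show "(\<Sum>b\<in>Basis. (dir_deriv f x v \<bullet> b) *\<^sub>R dir_deriv g (f x) b) = dir_deriv (\<lambda>x. g (f x)) x v"
      if "x \<in> S" for x
    proof -
      have "linear (dir_deriv g (f x))"
        using Suc.prems that assms(5) by (simp add: linear_frechet_derivative)
      then have "dir_deriv g (f x) (dir_deriv f x v)
          = (\<Sum>b\<in>Basis. (dir_deriv f x v \<bullet> b) *\<^sub>R dir_deriv g (f x) b)"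
        by (rule linear_basis_expansion)
      then show ?thesis
        using frechet_derivative_at[OF d[OF that]] by metis
    qed
  qed
  then show ?case using d by (auto simp: differentiable_def)
qed

lemma smooth_on_cong:
  "open S \<Longrightarrow> smooth_on f S \<Longrightarrow> (\<And>x. x \<in> S \<Longrightarrow> f x = g x) \<Longrightarrow> smooth_on g S"
  unfolding smooth_on_def using Ck_on_cong by blast

lemma smooth_on_subset: "smooth_on f S \<Longrightarrow> T \<subseteq> S \<Longrightarrow> smooth_on f T"
  unfolding smooth_on_def using Ck_on_subset by blast

lemma smooth_on_const: "smooth_on (\<lambda>x. c) S"
  by (simp add: smooth_on_def Ck_on_const)

lemma smooth_on_bounded_linear: "bounded_linear f \<Longrightarrow> smooth_on f S"
  by (simp add: smooth_on_def Ck_on_bounded_linear)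

lemma smooth_on_linear:
  fixes f :: "'a::euclidean_space \<Rightarrow> 'b::real_normed_vector"
  shows "linear f \<Longrightarrow> smooth_on f S"
  by (simp add: smooth_on_bounded_linear linear_conv_bounded_linear)

lemma smooth_on_add:
  "open S \<Longrightarrow> smooth_on f S \<Longrightarrow> smooth_on g S \<Longrightarrow> smooth_on (\<lambda>x. f x + g x) S"
  by (simp add: smooth_on_def Ck_on_add)

lemma smooth_on_sum:
  "open S \<Longrightarrow> (\<And>i. i \<in> I \<Longrightarrow> smooth_on (f i) S) \<Longrightarrow> smooth_on (\<lambda>x. \<Sum>i\<in>I. f i x) S"
  by (simp add: smooth_on_def Ck_on_sum)

lemma smooth_on_bilinear:
  "bounded_bilinear B \<Longrightarrow> open S \<Longrightarrow> smooth_on f S \<Longrightarrow> smooth_on g S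
    \<Longrightarrow> smooth_on (\<lambda>x. B (f x) (g x)) S"
  by (simp add: smooth_on_def Ck_on_bilinear)

lemmas smooth_on_scaleR = smooth_on_bilinear[OF bounded_bilinear_scaleR]
lemmas smooth_on_inner = smooth_on_bilinear[OF bounded_bilinear_inner]

lemma smooth_on_compose:
  "open S \<Longrightarrow> open T \<Longrightarrow> smooth_on g T \<Longrightarrow> smooth_on f S \<Longrightarrow> (\<And>x. x \<in> S \<Longrightarrow> f x \<in> T)
    \<Longrightarrow> smooth_on (\<lambda>x. g (f x)) S"
  unfolding smooth_on_def using Ck_on_compose by blast

lemma smooth_on_compose_linear:
  fixes f :: "'a::euclidean_space \<Rightarrow> 'b::euclidean_space"
  assumes "open S" "linear L" "smooth_on f S"
  shows "smooth_on (\<lambda>x. L (f x)) S"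
  using smooth_on_compose[OF assms(1) open_UNIV smooth_on_linear[OF assms(2)] assms(3)] by simp

lemma smooth_on_differentiable: "smooth_on f S \<Longrightarrow> x \<in> S \<Longrightarrow> f differentiable (at x)"
  unfolding smooth_on_def by (drule spec[of _ "Suc 0"]) simp

lemma smooth_on_has_derivative:
  "smooth_on f S \<Longrightarrow> x \<in> S \<Longrightarrow> (f has_derivative dir_deriv f x) (at x)"
  by (simp add: frechet_derivative_worksI smooth_on_differentiable)

lemma smooth_on_continuous_on: "smooth_on f S \<Longrightarrow> continuous_on S f"
  unfolding smooth_on_def by (drule spec[of _ 0]) simp

lemma smooth_on_dir_deriv: "smooth_on f S \<Longrightarrow> smooth_on (\<lambda>x. dir_deriv f x v) S"
  unfolding smooth_on_def
proof
  fix k assume "\<forall>k. Ck_on k f S"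
  then have "Ck_on (Suc k) f S" by blast
  then show "Ck_on k (\<lambda>x. dir_deriv f x v) S" by simp
qed

lemma dir_deriv_cong:
  assumes "open S" "x \<in> S" "\<And>y. y \<in> S \<Longrightarrow> f y = g y" "f differentiable (at x)"
  shows "dir_deriv f x v = dir_deriv g x v"
  using assms by (metis frechet_derivative_transform_within_open)

lemma linear_dir_deriv: "f differentiable (at x) \<Longrightarrow> linear (dir_deriv f x)"
  by (rule linear_frechet_derivative)

section \<open>Linear and bilinear maps depending on a point\<close>

lemma smooth_on_linear_family:
  fixes L :: "'a::euclidean_space \<Rightarrow> 'b::euclidean_space \<Rightarrow> 'c::real_normed_vector"
  assumes "open S" "\<And>v. smooth_on (\<lambda>x. L x v) S" "\<And>x. x \<in> S \<Longrightarrow> linear (L x)" "smooth_on a S"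
  shows "smooth_on (\<lambda>x. L x (a x)) S"
proof (rule smooth_on_cong[OF assms(1)])
  show "smooth_on (\<lambda>x. \<Sum>b\<in>Basis. (a x \<bullet> b) *\<^sub>R L x b) S"
    by (intro smooth_on_sum smooth_on_scaleR smooth_on_inner smooth_on_const assms)
qed (simp add: linear_basis_expansion[OF assms(3), symmetric])

lemma smooth_on_bilinear_family:
  fixes B :: "'a::euclidean_space \<Rightarrow> 'b::euclidean_space \<Rightarrow> 'b \<Rightarrow> 'c::real_normed_vector"
  assumes "open S" "\<And>v w. smooth_on (\<lambda>x. B x v w) S" "\<And>x. x \<in> S \<Longrightarrow> bilinear (B x)"
    "smooth_on a S" "smooth_on b S"
  shows "smooth_on (\<lambda>x. B x (a x) (b x)) S"
proof (rule smooth_on_linear_family[OF assms(1) _ _ assms(5)])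
  show "smooth_on (\<lambda>x. B x (a x) w) S" for w
    by (rule smooth_on_linear_family[OF assms(1,2) _ assms(4)])
      (use assms(3) in \<open>auto simp: bilinear_def\<close>)
qed (use assms(3) in \<open>auto simp: bilinear_def\<close>)

text \<open>Product rule when base point and argument move together. Differentiability is given for
  each fixed argument, and the finitely many basis vectors recover it for a moving one.\<close>

lemma has_derivative_linear_family:
  fixes L :: "'y::euclidean_space \<Rightarrow> 'b::euclidean_space \<Rightarrow> 'c::real_normed_vector"
  assumes "open S" "\<phi> x \<in> S" "\<And>y. y \<in> S \<Longrightarrow> linear (L y)"
    and "\<And>v. (\<lambda>y. L y v) differentiable (at (\<phi> x))"
    and \<phi>: "(\<phi> has_derivative \<phi>') (at (x::'x::euclidean_space))" and a: "(a has_derivative a') (at x)"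
  shows "((\<lambda>x. L (\<phi> x) (a x)) has_derivative
           (\<lambda>u. dir_deriv (\<lambda>y. L y (a x)) (\<phi> x) (\<phi>' u) + L (\<phi> x) (a' u))) (at x)"
proof -
  let ?D = "\<lambda>b u. dir_deriv (\<lambda>y. L y b) (\<phi> x) u"
  have D: "((\<lambda>y. L y b) has_derivative ?D b) (at (\<phi> x))" for b
    by (simp add: assms(4) frechet_derivative_worksI)
  have "((\<lambda>y. \<Sum>b\<in>Basis. (a x \<bullet> b) *\<^sub>R L y b) has_derivative (\<lambda>u. \<Sum>b\<in>Basis. (a x \<bullet> b) *\<^sub>R ?D b u)) (at (\<phi> x))"
    by (intro has_derivative_sum has_derivative_scaleR_right D)
  then have "((\<lambda>y. L y (a x)) has_derivative (\<lambda>u. \<Sum>b\<in>Basis. (a x \<bullet> b) *\<^sub>R ?D b u)) (at (\<phi> x))"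
    by (rule has_derivative_transform_within_open[OF _ assms(1,2)])
      (simp add: linear_basis_expansion[OF assms(3), symmetric])
  \<comment> \<open>The derivative with the argument frozen at \<open>a x\<close> is its own basis
    expansion, which brings the sum below into the stated form.\<close>
  then have E: "?D (a x) u = (\<Sum>b\<in>Basis. (a x \<bullet> b) *\<^sub>R ?D b u)" for u
    by (rule dir_deriv_eq)
  have "((\<lambda>x. \<Sum>b\<in>Basis. (a x \<bullet> b) *\<^sub>R L (\<phi> x) b) has_derivative
      (\<lambda>u. \<Sum>b\<in>Basis. (a x \<bullet> b) *\<^sub>R ?D b (\<phi>' u) + (a' u \<bullet> b) *\<^sub>R L (\<phi> x) b)) (at x)"
    by (intro has_derivative_sum has_derivative_scaleR has_derivative_inner_left a
        diff_chain_at[OF \<phi> D, unfolded o_def])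
  moreover have "(\<Sum>b\<in>Basis. (a x \<bullet> b) *\<^sub>R ?D b (\<phi>' u) + (a' u \<bullet> b) *\<^sub>R L (\<phi> x) b)
      = ?D (a x) (\<phi>' u) + L (\<phi> x) (a' u)" for u
    by (simp add: sum.distrib E[symmetric] linear_basis_expansion[OF assms(3)[OF assms(2)], symmetric])
  ultimately have *: "((\<lambda>x. \<Sum>b\<in>Basis. (a x \<bullet> b) *\<^sub>R L (\<phi> x) b) has_derivative
      (\<lambda>u. ?D (a x) (\<phi>' u) + L (\<phi> x) (a' u))) (at x)" by simp
  \<comment> \<open>Linearity is given on \<open>S\<close> only, so the expansion is undone just
    near \<open>x\<close>, where \<open>\<phi>\<close> stays in \<open>S\<close>.\<close>
  have "continuous (at x) \<phi>"
    using \<phi> by (simp add: has_derivative_continuous)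
  then have "eventually (\<lambda>z. \<phi> z \<in> S) (at x)"
    using assms(1,2) by (simp add: continuous_within tendsto_def)
  then have "eventually (\<lambda>z. (\<Sum>b\<in>Basis. (a z \<bullet> b) *\<^sub>R L (\<phi> z) b) = L (\<phi> z) (a z)) (at x)"
    by eventually_elim (simp add: linear_basis_expansion[OF assms(3), symmetric])
  with * show ?thesis
    by (rule has_derivative_transform_eventually)
      (simp_all add: linear_basis_expansion[OF assms(3)[OF assms(2)], symmetric])
qed

lemma has_derivative_bilinear_family:
  fixes B :: "'y::euclidean_space \<Rightarrow> 'b::euclidean_space \<Rightarrow> 'b \<Rightarrow> 'c::real_normed_vector"
  assumes "open S" "\<phi> x \<in> S" "\<And>y. y \<in> S \<Longrightarrow> bilinear (B y)"
    and D: "\<And>v w. (\<lambda>y. B y v w) differentiable (at (\<phi> x))"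
    and \<phi>: "(\<phi> has_derivative \<phi>') (at (x::'x::euclidean_space))"
    and a: "(a has_derivative a') (at x)" and b: "(b has_derivative b') (at x)"
  shows "((\<lambda>x. B (\<phi> x) (a x) (b x)) has_derivative
           (\<lambda>u. dir_deriv (\<lambda>y. B y (a x) (b x)) (\<phi> x) (\<phi>' u)
              + B (\<phi> x) (a' u) (b x) + B (\<phi> x) (a x) (b' u))) (at x)"
proof -
  let ?T = "{z. \<phi> z \<in> S}"
  have l: "linear (\<lambda>v. B y v w)" "linear (B y v)" if "y \<in> S" for y v w
    using assms(3)[OF that] by (auto simp: bilinear_def)
  have a1: "((\<lambda>y. B y v (w::'b)) has_derivative dir_deriv (\<lambda>y. B y v w) (\<phi> x)) (at (\<phi> x))" for v w
    by (simp add: D frechet_derivative_worksI)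
  \<comment> \<open>With the first slot fixed, the second one is the linear case; the first slot is
    then expanded in the basis.\<close>
  have A: "((\<lambda>x. B (\<phi> x) v (b x)) has_derivative
      (\<lambda>u. dir_deriv (\<lambda>y. B y v (b x)) (\<phi> x) (\<phi>' u) + B (\<phi> x) v (b' u))) (at x)" for v
    by (rule has_derivative_linear_family[OF assms(1,2) l(2) D \<phi> b])
  have E: "dir_deriv (\<lambda>y. B y (a x) (b x)) (\<phi> x) u = (\<Sum>i\<in>Basis. (a x \<bullet> i) *\<^sub>R dir_deriv (\<lambda>y. B y i (b x)) (\<phi> x) u)" for u
  proof (rule dir_deriv_eq)
    have "((\<lambda>y. \<Sum>i\<in>Basis. (a x \<bullet> i) *\<^sub>R B y i (b x)) has_derivative
        (\<lambda>u. \<Sum>i\<in>Basis. (a x \<bullet> i) *\<^sub>R dir_deriv (\<lambda>y. B y i (b x)) (\<phi> x) u)) (at (\<phi> x))"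
      by (intro has_derivative_sum has_derivative_scaleR_right a1)
    then show "((\<lambda>y. B y (a x) (b x)) has_derivative
        (\<lambda>u. \<Sum>i\<in>Basis. (a x \<bullet> i) *\<^sub>R dir_deriv (\<lambda>y. B y i (b x)) (\<phi> x) u)) (at (\<phi> x))"
      by (rule has_derivative_transform_within_open[OF _ assms(1,2)])
        (simp add: linear_basis_expansion[OF l(1), symmetric])
  qed
  have "((\<lambda>x. \<Sum>i\<in>Basis. (a x \<bullet> i) *\<^sub>R B (\<phi> x) i (b x)) has_derivative
      (\<lambda>u. \<Sum>i\<in>Basis. (a x \<bullet> i) *\<^sub>R (dir_deriv (\<lambda>y. B y i (b x)) (\<phi> x) (\<phi>' u) + B (\<phi> x) i (b' u))
         + (a' u \<bullet> i) *\<^sub>R B (\<phi> x) i (b x))) (at x)"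
    by (intro has_derivative_sum has_derivative_scaleR has_derivative_inner_left a A)
  moreover have "(\<Sum>i\<in>Basis. (a x \<bullet> i) *\<^sub>R (dir_deriv (\<lambda>y. B y i (b x)) (\<phi> x) (\<phi>' u) + B (\<phi> x) i (b' u))
         + (a' u \<bullet> i) *\<^sub>R B (\<phi> x) i (b x))
     = dir_deriv (\<lambda>y. B y (a x) (b x)) (\<phi> x) (\<phi>' u) + B (\<phi> x) (a' u) (b x) + B (\<phi> x) (a x) (b' u)" for u
    by (simp add: sum.distrib scaleR_add_right E[symmetric]
        linear_basis_expansion[OF l(1)[OF assms(2)], symmetric])
  ultimately have *: "((\<lambda>x. \<Sum>i\<in>Basis. (a x \<bullet> i) *\<^sub>R B (\<phi> x) i (b x)) has_derivative
      (\<lambda>u. dir_deriv (\<lambda>y. B y (a x) (b x)) (\<phi> x) (\<phi>' u) + B (\<phi> x) (a' u) (b x) + B (\<phi> x) (a x) (b' u))) (at x)"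
    by simp
  have "continuous (at x) \<phi>"
    using \<phi> by (simp add: has_derivative_continuous)
  then have "eventually (\<lambda>z. \<phi> z \<in> S) (at x)"
    using assms(1,2) by (simp add: continuous_within tendsto_def)
  then have "eventually (\<lambda>z. (\<Sum>i\<in>Basis. (a z \<bullet> i) *\<^sub>R B (\<phi> z) i (b z)) = B (\<phi> z) (a z) (b z)) (at x)"
    by eventually_elim (simp add: linear_basis_expansion[OF l(1), symmetric])
  moreover have "(\<Sum>i\<in>Basis. (a x \<bullet> i) *\<^sub>R B (\<phi> x) i (b x)) = B (\<phi> x) (a x) (b x)"
    by (simp add: linear_basis_expansion[OF l(1)[OF assms(2)], symmetric])
  ultimately show ?thesis
    using * by (intro has_derivative_transform_eventually[OF *]) simp_all
qed

subsection \<open>Symmetry of second derivatives\<close>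

text \<open>The mean value theorem is applied along \<open>u\<close> to the difference of
  \<open>f\<close> on two parallel edges of a square, and then along \<open>v\<close>. The second
  difference on the left is symmetric in \<open>u\<close> and \<open>v\<close>, which is the source
  of the symmetry of mixed derivatives.\<close>

lemma second_difference_mean_value:
  fixes f :: "'a::euclidean_space \<Rightarrow> real"
  assumes f: "smooth_on f S" and h: "h > 0"
    and in_S: "\<And>s t. 0 \<le> s \<Longrightarrow> s \<le> h \<Longrightarrow> 0 \<le> t \<Longrightarrow> t \<le> h \<Longrightarrow> x + s *\<^sub>R u + t *\<^sub>R v \<in> S"
  shows "\<exists>s t. 0 \<le> s \<and> s \<le> h \<and> 0 \<le> t \<and> t \<le> h \<and>
    f (x + h *\<^sub>R u + h *\<^sub>R v) - f (x + h *\<^sub>R u) - f (x + h *\<^sub>R v) + f x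
      = h\<^sup>2 * dir_deriv (\<lambda>y. dir_deriv f y u) (x + s *\<^sub>R u + t *\<^sub>R v) v"
proof -
  have der: "((\<lambda>s. g (y + s *\<^sub>R w)) has_real_derivative dir_deriv g (y + s *\<^sub>R w) w) (at s)"
    if "smooth_on g S" "y + s *\<^sub>R w \<in> S" for g :: "'a \<Rightarrow> real" and y w s
  proof -
    have "((\<lambda>s. g (y + s *\<^sub>R w)) has_derivative (\<lambda>r. dir_deriv g (y + s *\<^sub>R w) (r *\<^sub>R w))) (at s)"
      by (rule diff_chain_at[of "\<lambda>s. y + s *\<^sub>R w", unfolded o_def, OF _ smooth_on_has_derivative[OF that]])
        (auto intro!: derivative_eq_intros)
    then show ?thesis
      using linear_cmul[OF linear_dir_deriv[OF smooth_on_differentiable[OF that]]]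
      by (simp add: has_field_derivative_def mult_commute_abs)
  qed
  let ?F = "\<lambda>s. f ((x + h *\<^sub>R v) + s *\<^sub>R u) - f (x + s *\<^sub>R u)"
  have in1: "x + s *\<^sub>R u \<in> S" if "0 \<le> s" "s \<le> h" for s using in_S[of s 0] that h by simp
  have in2: "(x + h *\<^sub>R v) + s *\<^sub>R u \<in> S" if "0 \<le> s" "s \<le> h" for s
    using in_S[of s h] that h by (simp add: algebra_simps)
  have "\<exists>s>0. s < h \<and> ?F h - ?F 0
      = (h - 0) * (dir_deriv f ((x + h *\<^sub>R v) + s *\<^sub>R u) u - dir_deriv f (x + s *\<^sub>R u) u)"
    using h in1 in2 by (intro MVT2) (auto intro!: DERIV_diff der f)
  then obtain s where s: "0 < s" "s < h" and F: "?F h - ?F 0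
      = h * (dir_deriv f ((x + h *\<^sub>R v) + s *\<^sub>R u) u - dir_deriv f (x + s *\<^sub>R u) u)" by auto
  let ?G = "\<lambda>t. dir_deriv f ((x + s *\<^sub>R u) + t *\<^sub>R v) u"
  have "\<exists>t>0. t < h \<and> ?G h - ?G 0
      = (h - 0) * dir_deriv (\<lambda>y. dir_deriv f y u) ((x + s *\<^sub>R u) + t *\<^sub>R v) v"
    using h s in_S by (intro MVT2) (auto intro!: der smooth_on_dir_deriv f)
  then obtain t where t: "0 < t" "t < h" and G: "?G h - ?G 0
      = h * dir_deriv (\<lambda>y. dir_deriv f y u) ((x + s *\<^sub>R u) + t *\<^sub>R v) v" by auto
  have "f (x + h *\<^sub>R u + h *\<^sub>R v) - f (x + h *\<^sub>R u) - f (x + h *\<^sub>R v) + f x = ?F h - ?F 0"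
    by (simp add: algebra_simps)
  also have "\<dots> = h * (?G h - ?G 0)"
    unfolding F by (simp add: algebra_simps)
  finally show ?thesis
    unfolding G using s t by (intro exI[of _ s] exI[of _ t]) (simp add: power2_eq_square)
qed

lemma isCont_eventually_near:
  fixes f :: "'a::t2_space \<Rightarrow> 'b::metric_space"
  assumes "isCont f x" "e > 0"
  shows "eventually (\<lambda>y. dist (f y) (f x) < e) (nhds x)"
  using assms unfolding isCont_def tendsto_at_iff_tendsto_nhds by (rule tendstoD)

lemma dir_deriv_symmetric_real:
  fixes f :: "'a::euclidean_space \<Rightarrow> real"
  assumes S: "open S" "x \<in> S" and f: "smooth_on f S"
  shows "dir_deriv (\<lambda>y. dir_deriv f y u) x v = dir_deriv (\<lambda>y. dir_deriv f y v) x u"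
proof (rule ccontr)
  let ?A = "\<lambda>y. dir_deriv (\<lambda>y. dir_deriv f y u) y v" and ?B = "\<lambda>y. dir_deriv (\<lambda>y. dir_deriv f y v) y u"
  assume "?A x \<noteq> ?B x"
  \<comment> \<open>Half the supposed gap: if both mixed derivatives stay within \<open>e\<close> of
    their values at \<open>x\<close>, a common value at two intermediate points contradicts the
    gap.\<close>
  define e where "e = \<bar>?A x - ?B x\<bar> / 2"
  have e: "e > 0" using \<open>?A x \<noteq> ?B x\<close> by (simp add: e_def)
  have "continuous (at x) ?A" "continuous (at x) ?B"
    using S f by (auto intro!: smooth_on_dir_deriv smooth_on_differentiable differentiable_imp_continuous_within)
  note isCont_eventually_near[OF this(1) e] isCont_eventually_near[OF this(2) e]
  moreover have "eventually (\<lambda>y. y \<in> S) (nhds x)" using S by (simp add: eventually_nhds_in_open)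
  ultimately have "eventually (\<lambda>y. y \<in> S \<and> dist (?A y) (?A x) < e \<and> dist (?B y) (?B x) < e) (nhds x)"
    by eventually_elim auto
  then obtain r where r: "r > 0" and near: "\<And>y. dist y x < r \<Longrightarrow> y \<in> S \<and> dist (?A y) (?A x) < e \<and> dist (?B y) (?B x) < e"
    unfolding eventually_nhds_metric by blast
  \<comment> \<open>The summand 1 keeps \<open>N\<close> positive when both directions vanish;
    \<open>h = r / (2 * N)\<close> then keeps the whole square within distance \<open>r / 2\<close>
    of \<open>x\<close>.\<close>
  define N where "N = norm u + norm v + 1"
  define h where "h = r / (2 * N)"
  have pos: "N > 0" unfolding N_def using norm_ge_zero[of u] norm_ge_zero[of v] by linarith
  have h: "h > 0" using r pos by (simp add: h_def)
  have close: "dist (x + s *\<^sub>R u + t *\<^sub>R v) x < r" if "0 \<le> s" "s \<le> h" "0 \<le> t" "t \<le> h" for s t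
  proof -
    have "dist (x + s *\<^sub>R u + t *\<^sub>R v) x = norm (s *\<^sub>R u + t *\<^sub>R v)" by (simp add: dist_norm algebra_simps)
    also have "\<dots> \<le> norm (s *\<^sub>R u) + norm (t *\<^sub>R v)" by (rule norm_triangle_ineq)
    also have "\<dots> \<le> h * norm u + h * norm v"
      using that by (intro add_mono) (auto intro!: mult_right_mono)
    also have "\<dots> \<le> h * N" using h by (simp add: N_def algebra_simps)
    also have "\<dots> = r / 2" using pos by (simp add: h_def)
    finally show ?thesis using r by simp
  qed
  obtain s t where st: "0 \<le> s" "s \<le> h" "0 \<le> t" "t \<le> h"
    and 1: "f (x + h *\<^sub>R u + h *\<^sub>R v) - f (x + h *\<^sub>R u) - f (x + h *\<^sub>R v) + f x = h\<^sup>2 * ?A (x + s *\<^sub>R u + t *\<^sub>R v)"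
    using second_difference_mean_value[OF f h, of x u v] close near by blast
  have comm: "x + s *\<^sub>R v + t *\<^sub>R u = x + t *\<^sub>R u + s *\<^sub>R v" for s t by (simp add: add_ac)
  have "x + s *\<^sub>R v + t *\<^sub>R u \<in> S" if "0 \<le> s" "s \<le> h" "0 \<le> t" "t \<le> h" for s t
    unfolding comm using close near that by blast
  from second_difference_mean_value[OF f h this]
  obtain s' t' where st': "0 \<le> s'" "s' \<le> h" "0 \<le> t'" "t' \<le> h"
    and 2: "f (x + h *\<^sub>R v + h *\<^sub>R u) - f (x + h *\<^sub>R v) - f (x + h *\<^sub>R u) + f x = h\<^sup>2 * ?B (x + s' *\<^sub>R v + t' *\<^sub>R u)"
    by blast
  have "h\<^sup>2 * ?A (x + s *\<^sub>R u + t *\<^sub>R v) = h\<^sup>2 * ?B (x + t' *\<^sub>R u + s' *\<^sub>R v)"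
    using 1 2 unfolding comm by linarith
  then have "?A (x + s *\<^sub>R u + t *\<^sub>R v) = ?B (x + t' *\<^sub>R u + s' *\<^sub>R v)" using h by simp
  moreover have "dist (?A (x + s *\<^sub>R u + t *\<^sub>R v)) (?A x) < e"
    using near close st by blast
  moreover have "dist (?B (x + t' *\<^sub>R u + s' *\<^sub>R v)) (?B x) < e"
    using near close st' by blast
  ultimately have "\<bar>?A x - ?B x\<bar> < e + e" by (simp add: dist_real_def)
  then show False by (simp add: e_def)
qed

lemma dir_deriv_inner_left:
  "f differentiable (at x) \<Longrightarrow> dir_deriv (\<lambda>y. f y \<bullet> b) x v = dir_deriv f x v \<bullet> b"
  by (rule dir_deriv_eq) (auto intro!: has_derivative_inner_left frechet_derivative_worksI)

text \<open>The mean value theorem is a statement about real functions, so vector values are treated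
  one component at a time.\<close>

lemma dir_deriv_symmetric:
  fixes f :: "'a::euclidean_space \<Rightarrow> 'b::euclidean_space"
  assumes S: "open S" "x \<in> S" and f: "smooth_on f S"
  shows "dir_deriv (\<lambda>y. dir_deriv f y u) x v = dir_deriv (\<lambda>y. dir_deriv f y v) x u"
proof (rule euclidean_eqI)
  fix b :: 'b assume "b \<in> Basis"
  have fb: "smooth_on (\<lambda>y. f y \<bullet> b) S"
    by (intro smooth_on_inner smooth_on_const f S)
  have "dir_deriv (\<lambda>y. dir_deriv f y w) x z \<bullet> b = dir_deriv (\<lambda>y. dir_deriv (\<lambda>y. f y \<bullet> b) y w) x z" for w z
  proof -
    have "dir_deriv (\<lambda>y. dir_deriv f y w) x z \<bullet> b = dir_deriv (\<lambda>y. dir_deriv f y w \<bullet> b) x z"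
      using smooth_on_differentiable[OF smooth_on_dir_deriv[OF f] S(2)] by (simp add: dir_deriv_inner_left)
    also have "\<dots> = dir_deriv (\<lambda>y. dir_deriv (\<lambda>y. f y \<bullet> b) y w) x z"
    proof (rule dir_deriv_cong[OF S])
      show "dir_deriv f y w \<bullet> b = dir_deriv (\<lambda>y. f y \<bullet> b) y w" if "y \<in> S" for y
        by (simp add: dir_deriv_inner_left smooth_on_differentiable[OF f that])
      show "(\<lambda>y. dir_deriv f y w \<bullet> b) differentiable (at x)"
        by (intro smooth_on_differentiable[OF _ S(2)] smooth_on_inner smooth_on_dir_deriv smooth_on_const f S)
    qed
    finally show ?thesis .
  qed
  with dir_deriv_symmetric_real[OF S fb] show "dir_deriv (\<lambda>y. dir_deriv f y u) x v \<bullet> b = dir_deriv (\<lambda>y. dir_deriv f y v) x u \<bullet> b"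
    by simp
qed

section \<open>Local Riemannian geometry\<close>

lemma linear_dir_deriv_family:
  fixes L :: "'y::euclidean_space \<Rightarrow> 'b::euclidean_space \<Rightarrow> 'c::real_normed_vector"
  assumes "open S" "x \<in> S" "\<And>y. y \<in> S \<Longrightarrow> linear (L y)" "\<And>v. (\<lambda>y. L y v) differentiable (at x)"
  shows "linear (\<lambda>v. dir_deriv (\<lambda>y. L y v) x u)"
proof (rule linearI)
  have D: "((\<lambda>y. L y v) has_derivative dir_deriv (\<lambda>y. L y v) x) (at x)" for v
    by (simp add: assms(4) frechet_derivative_worksI)
  show "dir_deriv (\<lambda>y. L y (v + w)) x u = dir_deriv (\<lambda>y. L y v) x u + dir_deriv (\<lambda>y. L y w) x u" for v w
    by (rule dir_deriv_eq, rule has_derivative_transform_within_open[OF has_derivative_add[OF D D] assms(1,2)])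
      (simp add: assms(3) linear_add)
  show "dir_deriv (\<lambda>y. L y (r *\<^sub>R v)) x u = r *\<^sub>R dir_deriv (\<lambda>y. L y v) x u" for r v
    by (rule dir_deriv_eq, rule has_derivative_transform_within_open[OF has_derivative_scaleR_right[OF D] assms(1,2)])
      (simp add: assms(3) linear_cmul)
qed

lemma bilinear_dir_deriv_family:
  fixes B :: "'y::euclidean_space \<Rightarrow> 'b::euclidean_space \<Rightarrow> 'd::euclidean_space \<Rightarrow> 'c::real_normed_vector"
  assumes "open S" "x \<in> S" "\<And>y. y \<in> S \<Longrightarrow> bilinear (B y)" "\<And>v w. (\<lambda>y. B y v w) differentiable (at x)"
  shows "bilinear (\<lambda>v w. dir_deriv (\<lambda>y. B y v w) x u)"
  unfolding bilinear_def
  using linear_dir_deriv_family[OF assms(1,2), of "\<lambda>y. B y v" for v]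
    linear_dir_deriv_family[OF assms(1,2), of "\<lambda>y v. B y v w" for w] assms(3,4)
  by (simp add: bilinear_def)

text \<open>Riesz representation: \<open>T u\<close> represents the functional \<open>B u\<close> in
  the standard inner product; \<open>T\<close> is injective by positivity, hence surjective by
  dimension.\<close>

lemma posdef_representation:
  fixes B :: "'e::euclidean_space \<Rightarrow> 'e \<Rightarrow> real"
  assumes B: "bilinear B" and pos: "\<And>v. v \<noteq> 0 \<Longrightarrow> B v v > 0" and f: "linear f"
  shows "\<exists>u. \<forall>z. B u z = f z"
proof -
  define T where "T u = (\<Sum>b\<in>Basis. B u b *\<^sub>R b)" for u
  have l1: "linear (\<lambda>u. B u z)" and l2: "linear (B z)" for z
    using B by (auto simp: bilinear_def)
  have T: "linear T"
    by (rule linearI)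
      (simp_all add: T_def linear_add[OF l1] linear_cmul[OF l1] scaleR_add_left sum.distrib scaleR_sum_right)
  have Tz: "T u \<bullet> z = B u z" for u z
    using linear_basis_expansion[OF l2, of u z]
    by (simp add: T_def inner_sum_left inner_commute[of z] mult.commute)
  have "inj T"
    unfolding linear_injective_0[OF T] using pos Tz by (metis inner_zero_left less_irrefl)
  then have "surj T" by (rule linear_inj_imp_surj[OF T])
  then obtain u where u: "T u = (\<Sum>b\<in>Basis. f b *\<^sub>R b)" by (metis surjD)
  have "B u z = f z" for z
    using linear_basis_expansion[OF f, of z] unfolding Tz[symmetric] u
    by (simp add: inner_sum_left inner_commute[of z] mult.commute)
  then show ?thesis by blast
qed

lemma posdef_cancel:
  fixes B :: "'e::euclidean_space \<Rightarrow> 'e \<Rightarrow> real"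
  assumes "bilinear B" "\<And>v. v \<noteq> 0 \<Longrightarrow> B v v > 0" "\<And>z. B u z = B u' z"
  shows "u = u'"
proof (rule ccontr)
  assume "u \<noteq> u'"
  then have "B (u - u') (u - u') > 0" using assms(2) by simp
  then show False using assms(1,3) by (simp add: bilinear_lsub)
qed

lemma isCont_iff_tendsto_nhds: "isCont f x \<longleftrightarrow> (f \<longlongrightarrow> f x) (nhds x)"
  unfolding isCont_def by (rule tendsto_at_iff_tendsto_nhds)

text \<open>Here \<open>f\<close> is merely continuous, at the price that \<open>r\<close> vanishes
  at \<open>x\<close>: the error \<open>(f y - f x) * r y\<close> is a null factor times one of
  linear growth. This is the passage from continuity to differentiability for solutions of linear
  systems.\<close>

lemma has_derivative_mult_zero:
  fixes f r :: "'a::real_normed_vector \<Rightarrow> real"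
  assumes f: "isCont f x" and r: "(r has_derivative r') (at x)" and r0: "r x = 0"
  shows "((\<lambda>y. f y * r y) has_derivative (\<lambda>v. f x * r' v)) (at x)"
proof -
  have bl: "bounded_linear r'" using r by (rule has_derivative_bounded_linear)
  have "((\<lambda>y. (f y - f x) * r y) has_derivative (\<lambda>v. 0)) (at x)"
    unfolding has_derivative_at
  proof (intro conjI bounded_linear_zero)
    have 1: "((\<lambda>h. norm (r (x + h) - r x - r' h) / norm h) \<longlongrightarrow> 0) (at 0)"
      using r unfolding has_derivative_at by blast
    have 2: "((\<lambda>h. \<bar>f (x + h) - f x\<bar>) \<longlongrightarrow> 0) (at 0)"
      using f unfolding isCont_iff by (simp add: LIM_zero tendsto_rabs_zero)
    have 3: "((\<lambda>h. \<bar>f (x + h) - f x\<bar> * (norm (r (x + h) - r x - r' h) / norm h + onorm r')) \<longlongrightarrow> 0) (at 0)"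
      using tendsto_mult[OF 2 tendsto_add[OF 1 tendsto_const[of "onorm r'"]]] by simp
    show "((\<lambda>h. norm ((f (x + h) - f x) * r (x + h) - (f x - f x) * r x - 0) / norm h) \<longlongrightarrow> 0) (at 0)"
    proof (rule Lim_null_comparison[OF _ 3])
      have "norm (norm ((f (x + h) - f x) * r (x + h) - (f x - f x) * r x - 0) / norm h)
          \<le> \<bar>f (x + h) - f x\<bar> * (norm (r (x + h) - r x - r' h) / norm h + onorm r')" if "h \<noteq> 0" for h
      proof -
        have "\<bar>r (x + h)\<bar> \<le> norm (r (x + h) - r x - r' h) + norm (r' h)"
          using r0 by simp
        also have "norm (r' h) \<le> onorm r' * norm h" by (rule onorm[OF bl])
        finally have "\<bar>r (x + h)\<bar> / norm h \<le> norm (r (x + h) - r x - r' h) / norm h + onorm r'"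
          using that by (simp add: field_simps)
        from mult_left_mono[OF this, of "\<bar>f (x + h) - f x\<bar>"] show ?thesis
          by (simp add: abs_mult)
      qed
      then show "\<forall>\<^sub>F h in at 0. norm (norm ((f (x + h) - f x) * r (x + h) - (f x - f x) * r x - 0) / norm h)
          \<le> \<bar>f (x + h) - f x\<bar> * (norm (r (x + h) - r x - r' h) / norm h + onorm r')"
        by (auto simp: eventually_at_filter)
    qed
  qed
  from has_derivative_add[OF has_derivative_mult_right[OF r, of "f x"] this]
  show ?thesis by (simp add: algebra_simps)
qed

text \<open>A system of linear equations with differentiable coefficients has a differentiable solution:
  expanding around \<open>x\<close>, the solution is a fixed point whose self-dependence has a coefficient
  vanishing at \<open>x\<close>. Hence it is bounded, then continuous, then differentiable.\<close>

lemma differentiable_solution: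
  fixes B :: "'a::euclidean_space \<Rightarrow> 'e::euclidean_space \<Rightarrow> 'e \<Rightarrow> real"
  assumes S: "open S" "x \<in> S" and bil: "\<And>y. y \<in> S \<Longrightarrow> bilinear (B y)"
    and pos: "\<And>v. v \<noteq> 0 \<Longrightarrow> B x v v > 0"
    and dB: "\<And>v w. (\<lambda>y. B y v w) differentiable (at x)"
    and dk: "\<And>z. (\<lambda>y. k y z) differentiable (at x)"
    and sol: "\<And>y z. y \<in> S \<Longrightarrow> B y (u y) z = k y z"
  shows "u differentiable (at x)"
proof -
  have bx: "bilinear (B x)" using S bil by simp
  then have bx': "bilinear (\<lambda>v w. B x w v)" by (auto simp: bilinear_def)
  \<comment> \<open>Testing against \<open>s b\<close> reads off the \<open>b\<close>-component
    exactly when the coefficients are those at \<open>x\<close>; the defect at \<open>y\<close> is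
    collected in \<open>r\<close>.\<close>
  have "\<exists>s. \<forall>v. B x v s = v \<bullet> b" for b
    using posdef_representation[OF bx', of "\<lambda>v. v \<bullet> b"] pos
    by (auto intro: bounded_linear.linear bounded_linear_inner_left)
  then obtain s where s: "\<And>b v. B x v (s b) = v \<bullet> b" by metis
  define r where "r i b y = B y i (s b) - B x i (s b)" for i b y
  have dr: "(r i b) differentiable (at x)" for i b
    unfolding r_def by (intro derivative_intros dB)
  have r0: "r i b x = 0" for i b by (simp add: r_def)
  have eq: "u y \<bullet> b = k y (s b) - (\<Sum>i\<in>Basis. (u y \<bullet> i) * r i b y)" if "y \<in> S" for y b
  proof -
    have l: "linear (\<lambda>v. B y v (s b))" "linear (\<lambda>v. B x v (s b))"
      using bil that bx by (auto simp: bilinear_def)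
    have "k y (s b) - u y \<bullet> b = B y (u y) (s b) - B x (u y) (s b)"
      using sol that s by simp
    also have "\<dots> = (\<Sum>i\<in>Basis. (u y \<bullet> i) * B y i (s b)) - (\<Sum>i\<in>Basis. (u y \<bullet> i) * B x i (s b))"
      using linear_basis_expansion[OF l(1), of "u y"] linear_basis_expansion[OF l(2), of "u y"] by simp
    also have "\<dots> = (\<Sum>i\<in>Basis. (u y \<bullet> i) * r i b y)"
      by (simp add: r_def right_diff_distrib sum_subtractf)
    finally show ?thesis by simp
  qed
  define R where "R y = (\<Sum>b\<in>Basis. \<Sum>i\<in>Basis. \<bar>r i b y\<bar>)" for y
  define K where "K y = (\<Sum>b\<in>Basis. \<bar>k y (s b)\<bar>)" for y
  have cr: "isCont (r i b) x" and ck: "isCont (\<lambda>y. k y z) x" for i b z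
    using dr dk by (simp_all add: differentiable_imp_continuous_within)
  have cR: "isCont R x" unfolding R_def by (intro continuous_intros cr)
  have cK: "isCont K x" unfolding K_def by (intro continuous_intros ck)
  have evS: "eventually (\<lambda>y. y \<in> S) (nhds x)" using S by (simp add: eventually_nhds_in_open)
  have "R x = 0" by (simp add: R_def r0)
  then have "eventually (\<lambda>y. \<bar>R y\<bar> < 1/2) (nhds x)"
    using isCont_eventually_near[OF cR, of "1/2"] by (simp add: dist_real_def)
  moreover have "eventually (\<lambda>y. \<bar>K y - K x\<bar> < 1) (nhds x)"
    using isCont_eventually_near[OF cK, of 1] by (simp add: dist_real_def)
  \<comment> \<open>Where \<open>R y\<close> is below 1/2, at most half of the norm of
    \<open>u y\<close> reappears on the right and is absorbed; hence the factor 2.\<close>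
  ultimately have bdd: "eventually (\<lambda>y. norm (u y) \<le> 2 * (K x + 1)) (nhds x)"
    using evS
  proof eventually_elim
    case (elim y)
    have "norm (u y) \<le> (\<Sum>b\<in>Basis. \<bar>u y \<bullet> b\<bar>)" by (rule norm_le_l1)
    also have "\<dots> \<le> (\<Sum>b\<in>Basis. \<bar>k y (s b)\<bar> + (\<Sum>i\<in>Basis. norm (u y) * \<bar>r i b y\<bar>))"
    proof (rule sum_mono)
      fix b :: 'e assume "b \<in> Basis"
      have "\<bar>\<Sum>i\<in>Basis. (u y \<bullet> i) * r i b y\<bar> \<le> (\<Sum>i\<in>Basis. \<bar>(u y \<bullet> i) * r i b y\<bar>)" by (rule sum_abs)
      also have "\<dots> \<le> (\<Sum>i\<in>Basis. norm (u y) * \<bar>r i b y\<bar>)"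
        by (intro sum_mono) (simp add: abs_mult mult_right_mono Basis_le_norm)
      finally show "\<bar>u y \<bullet> b\<bar> \<le> \<bar>k y (s b)\<bar> + (\<Sum>i\<in>Basis. norm (u y) * \<bar>r i b y\<bar>)"
        using eq[OF elim(3), of b] by linarith
    qed
    also have "\<dots> = K y + norm (u y) * R y"
      by (simp add: K_def R_def sum.distrib sum_distrib_left)
    also have "\<dots> \<le> K y + norm (u y) * (1/2)"
      using elim(1) by (intro add_left_mono mult_left_mono) auto
    finally have "norm (u y) \<le> K y + norm (u y) * (1/2)" .
    moreover have "K y < K x + 1" using elim(2) by (simp add: abs_less_iff)
    ultimately show ?case by simp
  qed
  have cu: "isCont (\<lambda>y. u y \<bullet> b) x" for b
  proof -
    have z: "((\<lambda>y. (u y \<bullet> i) * r i b y) \<longlongrightarrow> 0) (nhds x)" if "i \<in> Basis" for i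
    proof (rule Lim_null_comparison)
      show "eventually (\<lambda>y. norm ((u y \<bullet> i) * r i b y) \<le> 2 * (K x + 1) * \<bar>r i b y\<bar>) (nhds x)"
        using bdd
      proof eventually_elim
        case (elim y)
        have "\<bar>u y \<bullet> i\<bar> \<le> 2 * (K x + 1)" using elim Basis_le_norm[OF that, of "u y"] by linarith
        then show ?case by (simp add: abs_mult mult_right_mono)
      qed
      have "((\<lambda>y. r i b y) \<longlongrightarrow> 0) (nhds x)"
        using isCont_iff_tendsto_nhds[THEN iffD1, OF cr, of i b] by (simp add: r0)
      then show "((\<lambda>y. 2 * (K x + 1) * \<bar>r i b y\<bar>) \<longlongrightarrow> 0) (nhds x)"
        by (intro tendsto_mult_right_zero tendsto_rabs_zero)
    qed
    have "((\<lambda>y. k y (s b)) \<longlongrightarrow> k x (s b)) (nhds x)"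
      by (rule isCont_iff_tendsto_nhds[THEN iffD1, OF ck])
    from tendsto_diff[OF this tendsto_null_sum[OF z]]
    have 1: "((\<lambda>y. k y (s b) - (\<Sum>i\<in>Basis. (u y \<bullet> i) * r i b y)) \<longlongrightarrow> k x (s b)) (nhds x)" by simp
    have 2: "eventually (\<lambda>y. k y (s b) - (\<Sum>i\<in>Basis. (u y \<bullet> i) * r i b y) = u y \<bullet> b) (nhds x)"
      using evS by eventually_elim (simp add: eq)
    have "k x (s b) = u x \<bullet> b" using eq[OF S(2), of b] by (simp add: r0)
    with Lim_transform_eventually[OF 1 2] have "((\<lambda>y. u y \<bullet> b) \<longlongrightarrow> u x \<bullet> b) (nhds x)" by simp
    then show ?thesis by (rule isCont_iff_tendsto_nhds[THEN iffD2])
  qed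
  \<comment> \<open>Continuity of the components of \<open>u\<close> now suffices, because every
    factor \<open>r i b\<close> vanishes at \<open>x\<close>.\<close>
  have "(\<lambda>y. u y \<bullet> b) differentiable (at x)" for b
  proof -
    have "(\<lambda>y. k y (s b) - (\<Sum>i\<in>Basis. (u y \<bullet> i) * r i b y)) differentiable (at x)"
    proof (rule differentiable_diff[OF dk differentiable_sum[OF finite_Basis]], rule)
      fix i :: 'e
      show "(\<lambda>y. (u y \<bullet> i) * r i b y) differentiable (at x)"
        using has_derivative_mult_zero[OF cu frechet_derivative_worksI[OF dr] r0]
        by (rule differentiableI)
    qed
    from has_derivative_transform_within_open[OF frechet_derivative_worksI[OF this] S eq[symmetric]]
    show ?thesis by (rule differentiableI)
  qed
  then show ?thesis
    by (subst differentiable_componentwise_within) simp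
qed

section \<open>The Levi-Civita connection of a metric on an open set\<close>

locale local_metric =
  fixes h :: "'e::euclidean_space \<Rightarrow> 'e \<Rightarrow> 'e \<Rightarrow> real" and U :: "'e set"
  assumes open_U: "open U"
    and smooth_h: "\<And>v w. smooth_on (\<lambda>x. h x v w) U"
    and bilinear_h: "\<And>x. x \<in> U \<Longrightarrow> bilinear (h x)"
    and sym_h: "\<And>x v w. x \<in> U \<Longrightarrow> h x v w = h x w v"
    and pos_h: "\<And>x v. x \<in> U \<Longrightarrow> v \<noteq> 0 \<Longrightarrow> h x v v > 0"
begin

definition koszul :: "'e \<Rightarrow> 'e \<Rightarrow> 'e \<Rightarrow> 'e \<Rightarrow> real" where
  "koszul x v w z =
     (dir_deriv (\<lambda>y. h y w z) x v + dir_deriv (\<lambda>y. h y v z) x w - dir_deriv (\<lambda>y. h y v w) x z) / 2"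

lemma differentiable_h: "x \<in> U \<Longrightarrow> (\<lambda>y. h y v w) differentiable (at x)"
  by (rule smooth_on_differentiable[OF smooth_h])

lemma linear_h: "x \<in> U \<Longrightarrow> linear (h x v)" "x \<in> U \<Longrightarrow> linear (\<lambda>v. h x v w)"
  using bilinear_h by (auto simp: bilinear_def)

lemma bilinear_dh: "x \<in> U \<Longrightarrow> bilinear (\<lambda>v w. dir_deriv (\<lambda>y. h y v w) x u)"
  by (rule bilinear_dir_deriv_family[OF open_U _ bilinear_h differentiable_h])

lemma linear_dh:
  assumes "x \<in> U"
  shows "linear (dir_deriv (\<lambda>y. h y v w) x)"
    "linear (\<lambda>w. dir_deriv (\<lambda>y. h y v w) x u)" "linear (\<lambda>v. dir_deriv (\<lambda>y. h y v w) x u)"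
  using bilinear_dh[OF assms, of u] linear_dir_deriv[OF differentiable_h[OF assms]]
  by (auto simp: bilinear_def)

lemma dh_sym: "x \<in> U \<Longrightarrow> dir_deriv (\<lambda>y. h y v w) x u = dir_deriv (\<lambda>y. h y w v) x u"
  by (rule dir_deriv_cong[OF open_U _ sym_h differentiable_h])

lemma linear_koszul:
  assumes "x \<in> U"
  shows "linear (koszul x v w)" "linear (\<lambda>w. koszul x v w z)" "linear (\<lambda>v. koszul x v w z)"
  unfolding linear_iff koszul_def
  using linear_dh[OF assms, unfolded linear_iff]
  by (auto simp: field_simps)

lemma h_cancel: "x \<in> U \<Longrightarrow> (\<And>z. h x u z = h x u' z) \<Longrightarrow> u = u'"
  by (rule posdef_cancel[OF bilinear_h pos_h])

lemma christoffel_eqI: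
  assumes "x \<in> U" "\<And>z. h x u z = koszul x v w z"
  shows "christoffel h x v w = u"
  unfolding christoffel_def
proof (rule the_equality)
  show "\<forall>z. h x u z = (dir_deriv (\<lambda>y. h y w z) x v + dir_deriv (\<lambda>y. h y v z) x w - dir_deriv (\<lambda>y. h y v w) x z) / 2"
    using assms(2) by (simp add: koszul_def)
  show "u' = u"
    if "\<forall>z. h x u' z = (dir_deriv (\<lambda>y. h y w z) x v + dir_deriv (\<lambda>y. h y v z) x w - dir_deriv (\<lambda>y. h y v w) x z) / 2" for u'
    by (rule h_cancel[OF assms(1)]) (simp add: that[rule_format] assms(2) koszul_def)
qed

lemma christoffel_koszul: "x \<in> U \<Longrightarrow> h x (christoffel h x v w) z = koszul x v w z"
  using posdef_representation[OF bilinear_h pos_h linear_koszul(1)] christoffel_eqI by metis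

lemma christoffel_sym: "x \<in> U \<Longrightarrow> christoffel h x v w = christoffel h x w v"
proof (rule christoffel_eqI)
  fix z assume "x \<in> U"
  then show "h x (christoffel h x w v) z = koszul x v w z"
    using dh_sym[OF \<open>x \<in> U\<close>, of v w z]
    by (simp add: christoffel_koszul koszul_def)
qed

lemma linear_christoffel:
  assumes "x \<in> U"
  shows "linear (christoffel h x v)" "linear (\<lambda>v. christoffel h x v w)"
proof -
  show *: "linear (christoffel h x v)" for v
    by (rule linearI; rule christoffel_eqI[OF assms])
      (simp_all add: linear_add[OF linear_h(2)[OF assms]] linear_cmul[OF linear_h(2)[OF assms]]
        christoffel_koszul[OF assms] linear_add[OF linear_koszul(2)[OF assms]] linear_cmul[OF linear_koszul(2)[OF assms]])
  show "linear (\<lambda>v. christoffel h x v w)"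
    using *[of w] by (simp add: christoffel_sym[OF assms, of _ w])
qed

lemma bilinear_christoffel: "x \<in> U \<Longrightarrow> bilinear (christoffel h x)"
  using linear_christoffel by (simp add: bilinear_def)

text \<open>A definite description carries no regularity of its own; here it comes from the linear
  system with coefficients \<open>h y\<close> and right side \<open>koszul y\<close>.\<close>

lemma differentiable_christoffel:
  assumes "x \<in> U"
  shows "(\<lambda>y. christoffel h y v w) differentiable (at x)"
proof (rule differentiable_solution[OF open_U assms bilinear_h pos_h[OF assms] differentiable_h[OF assms]])
  show "(\<lambda>y. koszul y v w z) differentiable (at x)" for z
    unfolding koszul_def
    by (intro derivative_intros smooth_on_differentiable[OF _ assms] smooth_on_dir_deriv smooth_h) simp
  show "h y (christoffel h y v w) z = koszul y v w z" if "y \<in> U" for y z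
    by (rule christoffel_koszul[OF that])
qed

lemma linear_riemann: "x \<in> U \<Longrightarrow> linear (\<lambda>u. riemann h x u v w)"
  unfolding riemann_def
  by (intro linear_compose_add linear_compose_sub linear_dir_deriv differentiable_christoffel
      linear_christoffel linear_dir_deriv_family[OF open_U] linear_compose[unfolded o_def, OF linear_christoffel(2) linear_christoffel(1)])

end

subsection \<open>Change of coordinates\<close>

text \<open>Cyclicity of the trace: the basis sum in \<open>ricci\<close> is unaffected by
  conjugation with a differential.\<close>

lemma trace_conjugate:
  fixes f g :: "'e::euclidean_space \<Rightarrow> 'e"
  assumes "linear f" "linear g"
  shows "(\<Sum>b\<in>Basis. f (g b) \<bullet> b) = (\<Sum>b\<in>Basis. g (f b) \<bullet> b)"
proof -
  have "(\<Sum>b\<in>Basis. f (g b) \<bullet> b) = (\<Sum>b\<in>Basis. \<Sum>b'\<in>Basis. (g b \<bullet> b') * (f b' \<bullet> b))"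
    using linear_basis_expansion[OF assms(1), of "g _"] by (simp add: inner_sum_left)
  also have "\<dots> = (\<Sum>b'\<in>Basis. \<Sum>b\<in>Basis. (f b' \<bullet> b) * (g b \<bullet> b'))"
    by (subst sum.swap) (simp add: mult.commute)
  also have "\<dots> = (\<Sum>b\<in>Basis. g (f b) \<bullet> b)"
    using linear_basis_expansion[OF assms(2), of "f _"] by (simp add: inner_sum_left)
  finally show ?thesis .
qed

text \<open>Injectivity is asked of the differential and not of \<open>\<phi>\<close>, because the
  orbit map to which this applies is periodic. Source and target share the type \<open>'e\<close>,
  so each differential is an isomorphism.\<close>

locale metric_pullback = target: local_metric h2 V
  for h2 :: "'e::euclidean_space \<Rightarrow> 'e \<Rightarrow> 'e \<Rightarrow> real" and V :: "'e set" +
  fixes \<phi> :: "'e \<Rightarrow> 'e" and U :: "'e set" and h1 :: "'e \<Rightarrow> 'e \<Rightarrow> 'e \<Rightarrow> real"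
  assumes open_dom: "open U" and smooth_\<phi>: "smooth_on \<phi> U" and maps: "\<And>x. x \<in> U \<Longrightarrow> \<phi> x \<in> V"
    and inj_d\<phi>: "\<And>x. x \<in> U \<Longrightarrow> inj (dir_deriv \<phi> x)"
    and pull: "\<And>x v w. x \<in> U \<Longrightarrow> h1 x v w = h2 (\<phi> x) (dir_deriv \<phi> x v) (dir_deriv \<phi> x w)"
begin

abbreviation d\<phi> :: "'e \<Rightarrow> 'e \<Rightarrow> 'e" where "d\<phi> \<equiv> dir_deriv \<phi>"
abbreviation dd\<phi> :: "'e \<Rightarrow> 'e \<Rightarrow> 'e \<Rightarrow> 'e" where "dd\<phi> x v w \<equiv> dir_deriv (\<lambda>y. d\<phi> y w) x v"

lemma linear_d\<phi>: "x \<in> U \<Longrightarrow> linear (d\<phi> x)"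
  by (rule linear_dir_deriv[OF smooth_on_differentiable[OF smooth_\<phi>]])

lemma surj_d\<phi>: "x \<in> U \<Longrightarrow> surj (d\<phi> x)"
  by (rule linear_inj_imp_surj[OF linear_d\<phi> inj_d\<phi>])

lemma dd\<phi>_sym: "x \<in> U \<Longrightarrow> dd\<phi> x v w = dd\<phi> x w v"
  by (rule dir_deriv_symmetric[OF open_dom _ smooth_\<phi>])

lemma d\<phi>_zero_iff: "x \<in> U \<Longrightarrow> d\<phi> x v = 0 \<longleftrightarrow> v = 0"
  using linear_injective_0[OF linear_d\<phi>] inj_d\<phi> linear_0[OF linear_d\<phi>] by metis

lemma has_derivative_\<phi>: "x \<in> U \<Longrightarrow> (\<phi> has_derivative d\<phi> x) (at x)"
  by (rule smooth_on_has_derivative[OF smooth_\<phi>])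

lemma has_derivative_d\<phi>: "x \<in> U \<Longrightarrow> ((\<lambda>y. d\<phi> y w) has_derivative (\<lambda>v. dd\<phi> x v w)) (at x)"
  by (rule smooth_on_has_derivative[OF smooth_on_dir_deriv[OF smooth_\<phi>]])

sublocale source: local_metric h1 U
proof
  show "open U" by (rule open_dom)
  show "smooth_on (\<lambda>x. h1 x v w) U" for v w
  proof (rule smooth_on_cong[OF open_dom])
    show "smooth_on (\<lambda>x. h2 (\<phi> x) (d\<phi> x v) (d\<phi> x w)) U"
      by (rule smooth_on_bilinear_family[OF open_dom])
        (auto intro!: smooth_on_dir_deriv smooth_\<phi> target.bilinear_h maps
          smooth_on_compose[OF open_dom target.open_U target.smooth_h])
  qed (simp add: pull)
  fix x assume x: "x \<in> U"
  note l = target.linear_h[OF maps[OF x]] linear_d\<phi>[OF x]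
  show "bilinear (h1 x)"
    unfolding bilinear_def pull[OF x] using l(1,2)[THEN linear_compose[OF l(3), unfolded o_def]] by blast
  show "h1 x v w = h1 x w v" for v w
    by (simp add: pull[OF x] target.sym_h[OF maps[OF x]])
  show "h1 x v v > 0" if "v \<noteq> 0" for v
    using that x by (simp add: pull target.pos_h maps d\<phi>_zero_iff)
qed

lemma dir_deriv_pull:
  assumes "x \<in> U"
  shows "dir_deriv (\<lambda>y. h1 y v w) x u = dir_deriv (\<lambda>y. h2 y (d\<phi> x v) (d\<phi> x w)) (\<phi> x) (d\<phi> x u)
    + h2 (\<phi> x) (dd\<phi> x u v) (d\<phi> x w) + h2 (\<phi> x) (d\<phi> x v) (dd\<phi> x u w)"
proof (rule dir_deriv_eq)
  have "((\<lambda>y. h2 (\<phi> y) (d\<phi> y v) (d\<phi> y w)) has_derivative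
      (\<lambda>u. dir_deriv (\<lambda>y. h2 y (d\<phi> x v) (d\<phi> x w)) (\<phi> x) (d\<phi> x u)
        + h2 (\<phi> x) (dd\<phi> x u v) (d\<phi> x w) + h2 (\<phi> x) (d\<phi> x v) (dd\<phi> x u w))) (at x)"
    using assms
    by (intro has_derivative_bilinear_family[OF target.open_U, where \<phi> = \<phi>] target.bilinear_h
        target.differentiable_h maps has_derivative_\<phi> has_derivative_d\<phi>)
  then show "((\<lambda>y. h1 y v w) has_derivative
      (\<lambda>u. dir_deriv (\<lambda>y. h2 y (d\<phi> x v) (d\<phi> x w)) (\<phi> x) (d\<phi> x u)
        + h2 (\<phi> x) (dd\<phi> x u v) (d\<phi> x w) + h2 (\<phi> x) (d\<phi> x v) (dd\<phi> x u w))) (at x)"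
    by (rule has_derivative_transform_within_open[OF _ open_dom assms]) (simp add: pull)
qed

text \<open>Second derivatives of \<open>\<phi>\<close> enter the three Koszul terms six times. By
  symmetry four of them cancel, and the remaining two are equal, which makes up for the factor
  1/2.\<close>

lemma christoffel_pull:
  assumes x: "x \<in> U"
  shows "d\<phi> x (christoffel h1 x v w) = christoffel h2 (\<phi> x) (d\<phi> x v) (d\<phi> x w) + dd\<phi> x v w"
proof -
  note V = maps[OF x]
  have "christoffel h2 (\<phi> x) (d\<phi> x v) (d\<phi> x w) = d\<phi> x (christoffel h1 x v w) - dd\<phi> x v w"
  proof (rule target.christoffel_eqI[OF V])
    fix z'
    obtain z where z': "z' = d\<phi> x z" using surj_d\<phi>[OF x] by (metis surjD)
    note s = target.sym_h[OF V]
    have "h2 (\<phi> x) (d\<phi> x (christoffel h1 x v w)) z' = source.koszul x v w z"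
      unfolding z' pull[OF x, symmetric] by (rule source.christoffel_koszul[OF x])
    also have "\<dots> = target.koszul (\<phi> x) (d\<phi> x v) (d\<phi> x w) z' + h2 (\<phi> x) (dd\<phi> x v w) z'"
      unfolding source.koszul_def target.koszul_def dir_deriv_pull[OF x] z'
      using dd\<phi>_sym[OF x, of v w] dd\<phi>_sym[OF x, of v z] dd\<phi>_sym[OF x, of w z]
        s[of "d\<phi> x w" "dd\<phi> x v z"] s[of "d\<phi> x v" "dd\<phi> x w z"] by (simp add: field_simps)
    finally show "h2 (\<phi> x) (d\<phi> x (christoffel h1 x v w) - dd\<phi> x v w) z'
        = target.koszul (\<phi> x) (d\<phi> x v) (d\<phi> x w) z'"
      by (simp add: linear_diff[OF target.linear_h(2)[OF V]])
  qed
  then show ?thesis by simp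
qed

text \<open>Both sides of the transformation law \<open>christoffel_pull\<close> are differentiated
  along \<open>u\<close>; uniqueness of the derivative equates the results.\<close>

lemma dir_deriv_christoffel_pull:
  assumes x: "x \<in> U"
  shows "dd\<phi> x u (christoffel h1 x v w) + d\<phi> x (dir_deriv (\<lambda>y. christoffel h1 y v w) x u)
    = dir_deriv (\<lambda>y. christoffel h2 y (d\<phi> x v) (d\<phi> x w)) (\<phi> x) (d\<phi> x u)
      + christoffel h2 (\<phi> x) (dd\<phi> x u v) (d\<phi> x w) + christoffel h2 (\<phi> x) (d\<phi> x v) (dd\<phi> x u w)
      + dir_deriv (\<lambda>y. dd\<phi> y v w) x u"
proof -
  let ?R = "\<lambda>u. dir_deriv (\<lambda>y. christoffel h2 y (d\<phi> x v) (d\<phi> x w)) (\<phi> x) (d\<phi> x u)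
      + christoffel h2 (\<phi> x) (dd\<phi> x u v) (d\<phi> x w) + christoffel h2 (\<phi> x) (d\<phi> x v) (dd\<phi> x u w)
      + dir_deriv (\<lambda>y. dd\<phi> y v w) x u"
  have L: "((\<lambda>y. d\<phi> y (christoffel h1 y v w)) has_derivative
      (\<lambda>u. dd\<phi> x u (christoffel h1 x v w) + d\<phi> x (dir_deriv (\<lambda>y. christoffel h1 y v w) x u))) (at x)"
    by (rule has_derivative_linear_family[OF open_dom, where \<phi> = "\<lambda>x. x"])
      (use x in \<open>auto intro!: linear_d\<phi> has_derivative_ident frechet_derivative_worksI
        source.differentiable_christoffel smooth_on_differentiable[OF smooth_on_dir_deriv[OF smooth_\<phi>]]\<close>)
  have "((\<lambda>y. christoffel h2 (\<phi> y) (d\<phi> y v) (d\<phi> y w) + dd\<phi> y v w) has_derivative ?R) (at x)"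
    by (intro has_derivative_add has_derivative_bilinear_family[OF target.open_U]
        maps[OF x] target.bilinear_christoffel target.differentiable_christoffel has_derivative_\<phi>[OF x] has_derivative_d\<phi>[OF x]
        smooth_on_has_derivative[OF smooth_on_dir_deriv[OF smooth_on_dir_deriv[OF smooth_\<phi>]] x])
  then have "((\<lambda>y. d\<phi> y (christoffel h1 y v w)) has_derivative ?R) (at x)"
    by (rule has_derivative_transform_within_open[OF _ open_dom x]) (simp add: christoffel_pull)
  from has_derivative_unique[OF L this] show ?thesis by meson
qed

text \<open>All inhomogeneous terms are symmetric in \<open>u\<close> and \<open>v\<close>, so they
  drop out of the antisymmetrised expression.\<close>

lemma riemann_pull:
  assumes x: "x \<in> U"
  shows "d\<phi> x (riemann h1 x u v w) = riemann h2 (\<phi> x) (d\<phi> x u) (d\<phi> x v) (d\<phi> x w)"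
proof -
  note V = maps[OF x] and ad = linear_add[OF linear_d\<phi>[OF x]] linear_diff[OF linear_d\<phi>[OF x]]
  define C1 where "C1 = christoffel h1 x"
  define C2 where "C2 = christoffel h2 (\<phi> x)"
  note cp = christoffel_pull[OF x, folded C1_def C2_def]
  have C2: "linear (C2 v)" for v unfolding C2_def by (rule target.linear_christoffel[OF V])
  have sym: "C2 v w = C2 w v" for v w unfolding C2_def by (rule target.christoffel_sym[OF V])
  have third: "dir_deriv (\<lambda>y. dd\<phi> y v w) x u = dir_deriv (\<lambda>y. dd\<phi> y u w) x v"
    by (rule dir_deriv_symmetric[OF open_dom x smooth_on_dir_deriv[OF smooth_\<phi>]])
  \<comment> \<open>The last bracket collects the inhomogeneous terms; exchanging \<open>u\<close>
    and \<open>v\<close> only permutes them, the third derivative included.\<close>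
  have half: "d\<phi> x (dir_deriv (\<lambda>y. christoffel h1 y v w) x u) + d\<phi> x (C1 u (C1 v w))
      = dir_deriv (\<lambda>y. christoffel h2 y (d\<phi> x v) (d\<phi> x w)) (\<phi> x) (d\<phi> x u)
        + C2 (d\<phi> x u) (C2 (d\<phi> x v) (d\<phi> x w))
        + (C2 (dd\<phi> x u v) (d\<phi> x w) + C2 (d\<phi> x v) (dd\<phi> x u w) + C2 (d\<phi> x u) (dd\<phi> x v w)
           + dir_deriv (\<lambda>y. dd\<phi> y v w) x u)" for u v
    using dir_deriv_christoffel_pull[OF x, where u = u and v = v and w = w, folded C1_def C2_def]
    unfolding cp[of u "C1 v w"] cp[of v w] by (simp add: linear_add[OF C2] algebra_simps)
  show ?thesis
    unfolding riemann_def C1_def[symmetric] C2_def[symmetric] ad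
    using half[where u = u and v = v] half[where u = v and v = u] third dd\<phi>_sym[OF x, of u v] by (simp add: algebra_simps)
qed

lemma ricci_pull:
  assumes x: "x \<in> U"
  shows "ricci h1 x v w = ricci h2 (\<phi> x) (d\<phi> x v) (d\<phi> x w)"
proof -
  obtain \<psi> where \<psi>: "linear \<psi>" "\<And>v. \<psi> (d\<phi> x v) = v" "\<And>v. d\<phi> x (\<psi> v) = v"
    using linear_injective_left_inverse[OF linear_d\<phi>[OF x] inj_d\<phi>[OF x]] surj_d\<phi>[OF x]
    by (metis comp_apply id_apply surjD)
  have l: "linear (\<lambda>b. riemann h1 x (\<psi> b) v w)"
    using linear_compose[OF \<psi>(1) source.linear_riemann[OF x]] by (simp add: o_def)
  have "ricci h2 (\<phi> x) (d\<phi> x v) (d\<phi> x w) = (\<Sum>b\<in>Basis. riemann h2 (\<phi> x) (d\<phi> x (\<psi> b)) (d\<phi> x v) (d\<phi> x w) \<bullet> b)"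
    by (simp add: ricci_def \<psi>(3))
  also have "\<dots> = (\<Sum>b\<in>Basis. d\<phi> x (riemann h1 x (\<psi> b) v w) \<bullet> b)"
    by (simp add: riemann_pull[OF x])
  also have "\<dots> = (\<Sum>b\<in>Basis. riemann h1 x (\<psi> (d\<phi> x b)) v w \<bullet> b)"
    by (rule trace_conjugate[OF linear_d\<phi>[OF x] l])
  finally show ?thesis by (simp add: ricci_def \<psi>(2))
qed

lemma partial_d_pull:
  assumes "smooth_on u T" "\<theta> \<in> T" "u \<theta> \<in> U"
  shows "partial_d (\<phi> \<circ> u) i \<theta> = d\<phi> (u \<theta>) (partial_d u i \<theta>)"
proof -
  have "((\<phi> \<circ> u) has_derivative d\<phi> (u \<theta>) \<circ> dir_deriv u \<theta>) (at \<theta>)"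
    using assms by (intro diff_chain_at smooth_on_has_derivative has_derivative_\<phi>) auto
  then show ?thesis
    unfolding partial_d_def by (simp add: dir_deriv_eq)
qed

lemma gram_pull:
  assumes "smooth_on u T" "\<theta> \<in> T" "u \<theta> \<in> U"
  shows "gram h2 (\<phi> \<circ> u) \<theta> = gram h1 u \<theta>"
  using assms(3) by (simp add: gram_def partial_d_pull[OF assms] pull)

end

text \<open>Any other candidate \<open>N\<close> differs from \<open>w\<close> by a vector that is
  both tangent and orthogonal to all tangent vectors, hence zero.\<close>

lemma normal_part_eq_self:
  assumes b: "bilinear (h (u \<theta>))" and pos: "\<And>v. v \<noteq> 0 \<Longrightarrow> h (u \<theta>) v v > 0"
    and w: "\<And>k. h (u \<theta>) w (partial_d u k \<theta>) = 0"
  shows "normal_part h u \<theta> w = w"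
  unfolding normal_part_def
proof (rule the_equality)
  show "(\<forall>k. h (u \<theta>) w (partial_d u k \<theta>) = 0) \<and> w - w \<in> span (range (\<lambda>k. partial_d u k \<theta>))"
    using w by (simp add: span_zero)
  fix N assume N: "(\<forall>k. h (u \<theta>) N (partial_d u k \<theta>) = 0) \<and> w - N \<in> span (range (\<lambda>k. partial_d u k \<theta>))"
  have "h (u \<theta>) (w - N) z = 0" if "z \<in> span (range (\<lambda>k. partial_d u k \<theta>))" for z
    using that
  proof (induction rule: span_induct_alt)
    case base
    then show ?case using b by (simp add: bilinear_rzero)
  next
    case (step c x y)
    then show ?case using b N w by (auto simp: bilinear_radd bilinear_rmul bilinear_lsub)
  qed
  with N have "h (u \<theta>) (w - N) (w - N) = 0" by blast
  then show "N = w" using pos[of "w - N"] by fastforce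
qed

context metric_pullback
begin

text \<open>The second derivative of \<open>\<phi>\<close> in the acceleration of
  \<open>\<phi> \<circ> u\<close> cancels the inhomogeneous term of the Christoffel symbols. An
  acceleration normal for \<open>h1\<close> has a normal image, so the projection does
  nothing.\<close>

lemma second_ff_pull:
  assumes T: "open T" "\<theta> \<in> T" and u: "smooth_on u T" and uU: "\<And>\<eta>. \<eta> \<in> T \<Longrightarrow> u \<eta> \<in> U"
    and normal: "\<And>k. h1 (u \<theta>) (partial_d (partial_d u j) i \<theta>
        + christoffel h1 (u \<theta>) (partial_d u i \<theta>) (partial_d u j \<theta>)) (partial_d u k \<theta>) = 0"
  shows "second_ff h2 (\<phi> \<circ> u) \<theta> i j = d\<phi> (u \<theta>) (partial_d (partial_d u j) i \<theta>
        + christoffel h1 (u \<theta>) (partial_d u i \<theta>) (partial_d u j \<theta>))"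
proof -
  note U = uU[OF T(2)]
  have du: "(u has_derivative dir_deriv u \<eta>) (at \<eta>)" if "\<eta> \<in> T" for \<eta>
    using u that by (rule smooth_on_has_derivative)
  have pu: "smooth_on (partial_d u j) T" for j
    unfolding partial_d_def[abs_def] by (rule smooth_on_dir_deriv[OF u])
  have "((\<lambda>\<eta>. d\<phi> (u \<eta>) (partial_d u j \<eta>)) has_derivative
      (\<lambda>t. dir_deriv (\<lambda>y. d\<phi> y (partial_d u j \<theta>)) (u \<theta>) (dir_deriv u \<theta> t)
        + d\<phi> (u \<theta>) (dir_deriv (partial_d u j) \<theta> t))) (at \<theta>)"
    using U du[OF T(2)] pu T u
    by (intro has_derivative_linear_family[OF open_dom] linear_d\<phi>
        smooth_on_differentiable[OF smooth_on_dir_deriv[OF smooth_\<phi>]] smooth_on_has_derivative)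
  then have "((partial_d (\<phi> \<circ> u) j) has_derivative
      (\<lambda>t. dir_deriv (\<lambda>y. d\<phi> y (partial_d u j \<theta>)) (u \<theta>) (dir_deriv u \<theta> t)
        + d\<phi> (u \<theta>) (dir_deriv (partial_d u j) \<theta> t))) (at \<theta>)"
    by (rule has_derivative_transform_within_open[OF _ T]) (simp add: partial_d_pull[OF u] uU)
  from dir_deriv_eq[OF this, of "axis i 1"]
  have "partial_d (partial_d (\<phi> \<circ> u) j) i \<theta>
      = dd\<phi> (u \<theta>) (partial_d u i \<theta>) (partial_d u j \<theta>) + d\<phi> (u \<theta>) (partial_d (partial_d u j) i \<theta>)"
    unfolding partial_d_def[of "partial_d _ _"] partial_d_def[of u i] .
  then have "partial_d (partial_d (\<phi> \<circ> u) j) i \<theta>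
      + christoffel h2 ((\<phi> \<circ> u) \<theta>) (partial_d (\<phi> \<circ> u) i \<theta>) (partial_d (\<phi> \<circ> u) j \<theta>)
    = d\<phi> (u \<theta>) (partial_d (partial_d u j) i \<theta> + christoffel h1 (u \<theta>) (partial_d u i \<theta>) (partial_d u j \<theta>))"
    by (simp add: partial_d_pull[OF u T(2) U] linear_add[OF linear_d\<phi>[OF U]] christoffel_pull[OF U])
  then show ?thesis
    unfolding second_ff_def using normal U
    by (simp, subst normal_part_eq_self)
      (auto simp: target.bilinear_h target.pos_h maps partial_d_pull[OF u T(2) U] pull)
qed

end

section \<open>Determinants\<close>

text \<open>Jacobi's formula with the derivative of \<open>A\<close> written as
  \<open>P u ** A x\<close>: the factor \<open>P u\<close> plays the role of dA times the inverse of
  A, so that no inverse occurs.\<close>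

lemma has_derivative_det:
  fixes A :: "'x::real_normed_vector \<Rightarrow> real ^ 'n ^ 'n"
  assumes A: "\<And>i j. ((\<lambda>x. A x $ i $ j) has_derivative (\<lambda>u. (P u ** A x) $ i $ j)) (at x)"
  shows "((\<lambda>x. det (A x)) has_derivative (\<lambda>u. trace (P u) * det (A x))) (at x)"
proof -
  let ?D = "\<lambda>u. \<Sum>p | p permutes (UNIV :: 'n set). of_int (sign p) *
      (\<Sum>i\<in>UNIV. (P u ** A x) $ i $ p i * (\<Prod>j\<in>UNIV - {i}. A x $ j $ p j))"
  have "((\<lambda>x. det (A x)) has_derivative ?D) (at x)"
    unfolding det_def by (intro has_derivative_sum has_derivative_mult_right has_derivative_prod A)
  moreover have "?D u = trace (P u) * det (A x)" for u
  proof -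
    \<comment> \<open>The new row \<open>k\<close> is a combination of the rows of
      \<open>A x\<close>; only row \<open>k\<close> itself, with coefficient
      \<open>P u $ k $ k\<close>, contributes to the determinant.\<close>
    let ?B = "\<lambda>k. \<chi> i. if i = k then (P u ** A x) $ i else A x $ i"
    have split: "(\<Prod>i\<in>UNIV. ?B k $ i $ p i) = (P u ** A x) $ k $ p k * (\<Prod>j\<in>UNIV - {k}. A x $ j $ p j)" for k p
      by (subst prod.remove[of UNIV k]) auto
    have "?D u = (\<Sum>k\<in>UNIV. det (?B k))"
      unfolding det_def split by (subst sum.swap) (simp add: sum_distrib_left mult.assoc)
    also have "\<dots> = (\<Sum>k\<in>UNIV. P u $ k $ k * det (A x))"
    proof (rule sum.cong[OF refl])
      fix k :: 'n
      have "?B k = (\<chi> i. if i = k then \<Sum>l\<in>UNIV. P u $ k $ l *s row l (A x) else row i (A x))"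
        by (simp add: vec_eq_iff matrix_matrix_mult_def row_def)
      then show "det (?B k) = P u $ k $ k * det (A x)"
        by (simp add: cramer_lemma_transpose)
    qed
    finally show ?thesis by (simp add: trace_def sum_distrib_right)
  qed
  ultimately show ?thesis by simp
qed

text \<open>The segment from the identity to a positive definite matrix avoids singular matrices.\<close>

lemma det_posdef:
  fixes A :: "real ^ 'n ^ 'n"
  assumes "\<And>v. v \<noteq> 0 \<Longrightarrow> v \<bullet> (A *v v) > 0"
  shows "det A > 0"
proof (rule ccontr)
  assume "\<not> det A > 0"
  define M where "M t = (1 - t) *\<^sub>R mat 1 + t *\<^sub>R A" for t :: real
  have "continuous_on {0..1} (\<lambda>t. det (M t))"
    unfolding M_def det_def by (intro continuous_intros)
  moreover have "det (M 1) \<le> 0" "0 \<le> det (M 0)"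
    using \<open>\<not> det A > 0\<close> by (simp_all add: M_def)
  ultimately obtain t where t: "0 \<le> t" "t \<le> 1" "det (M t) = 0"
    using IVT2'[of "\<lambda>t. det (M t)" 1 0 0] by auto
  then obtain v where v: "v \<noteq> 0" "M t *v v = 0"
    using det_nz_iff_inj[of "(*v) (M t)"] linear_injective_0[of "(*v) (M t)"]
    by (auto simp: matrix_vector_mul_linear)
  have "v \<bullet> (M t *v v) = (1 - t) * (v \<bullet> v) + t * (v \<bullet> (A *v v))"
    by (simp add: M_def matrix_vector_mult_add_rdistrib scaleR_matrix_vector_assoc[symmetric] inner_add_right)
  also have "\<dots> > 0"
  proof (cases "t = 0")
    case False
    then show ?thesis using assms[OF v(1)] t by (intro add_nonneg_pos) auto
  qed (use v in simp)
  finally show False using v by simp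
qed


section \<open>Kaehler metrics with a potential depending on the real part\<close>

definition re_vec :: "complex ^ 'n \<Rightarrow> real ^ 'n" where "re_vec v = (\<chi> i. Re (v $ i))"
definition im_vec :: "complex ^ 'n \<Rightarrow> real ^ 'n" where "im_vec v = (\<chi> i. Im (v $ i))"
definition cvec :: "real ^ 'n \<Rightarrow> real ^ 'n \<Rightarrow> complex ^ 'n" where
  "cvec a b = (\<chi> i. Complex (a $ i) (b $ i))"

lemma re_vec_cvec [simp]: "re_vec (cvec a b) = a" and im_vec_cvec [simp]: "im_vec (cvec a b) = b"
  and cvec_re_im [simp]: "cvec (re_vec v) (im_vec v) = v"
  by (simp_all add: re_vec_def im_vec_def cvec_def vec_eq_iff)

lemma re_vec_nth [simp]: "re_vec v $ i = Re (v $ i)" and im_vec_nth [simp]: "im_vec v $ i = Im (v $ i)"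
  by (simp_all add: re_vec_def im_vec_def)

lemma linear_re_vec: "linear re_vec"
  by (auto intro!: linearI simp: re_vec_def vec_eq_iff)

lemma bounded_linear_re_vec: "bounded_linear re_vec"
  using linear_re_vec by (simp add: linear_conv_bounded_linear)

lemma re_vec_simps [simp]:
  "re_vec 0 = 0" "re_vec (v + w) = re_vec v + re_vec w" "re_vec (v - w) = re_vec v - re_vec w"
  "re_vec (- v) = - re_vec v" "re_vec (r *\<^sub>R v) = r *\<^sub>R re_vec v"
  by (simp_all add: re_vec_def vec_eq_iff)

lemma im_vec_simps [simp]:
  "im_vec 0 = 0" "im_vec (v + w) = im_vec v + im_vec w" "im_vec (v - w) = im_vec v - im_vec w"
  "im_vec (- v) = - im_vec v" "im_vec (r *\<^sub>R v) = r *\<^sub>R im_vec v"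
  by (simp_all add: im_vec_def vec_eq_iff)

lemma cvec_add: "cvec a b + cvec c d = cvec (a + c) (b + d)"
  by (simp add: cvec_def vec_eq_iff complex_eq_iff)

lemma cvec_zero [simp]: "cvec 0 0 = 0"
  by (simp add: cvec_def vec_eq_iff complex_eq_iff)

lemma cvec_scaleR: "r *\<^sub>R cvec a b = cvec (r *\<^sub>R a) (r *\<^sub>R b)"
  by (simp add: cvec_def vec_eq_iff complex_eq_iff)

lemma cvec_eq_iff: "cvec a b = cvec c d \<longleftrightarrow> a = c \<and> b = d"
  by (metis re_vec_cvec im_vec_cvec)

lemma re_im_eqI: "re_vec v = re_vec w \<Longrightarrow> im_vec v = im_vec w \<Longrightarrow> v = w"
  by (metis cvec_re_im)

lemma re_im_zero_iff: "v = 0 \<longleftrightarrow> re_vec v = 0 \<and> im_vec v = 0"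
  by (metis re_im_eqI re_vec_simps(1) im_vec_simps(1))

lemma Jmul_cvec: "Jmul (cvec a b) = cvec (- b) a"
  by (simp add: Jmul_def cvec_def vec_eq_iff complex_eq_iff)

lemma bounded_linear_cvec: "bounded_linear (\<lambda>p. cvec (fst p) (snd p))"
  unfolding linear_conv_bounded_linear[symmetric]
  by (rule linearI) (simp_all add: cvec_def vec_eq_iff complex_eq_iff)

lemma has_derivative_cvec:
  assumes "(a has_derivative a') (at x)" "(b has_derivative b') (at x)"
  shows "((\<lambda>x. cvec (a x) (b x)) has_derivative (\<lambda>u. cvec (a' u) (b' u))) (at x)"
  using bounded_linear.has_derivative[OF bounded_linear_cvec has_derivative_Pair[OF assms]] by simp

lemma sum_Basis_complex_vec:
  fixes f :: "complex ^ 'n \<Rightarrow> 'b::comm_monoid_add"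
  shows "(\<Sum>b\<in>Basis. f b) = (\<Sum>i\<in>UNIV. f (cvec (axis i 1) 0)) + (\<Sum>i\<in>UNIV. f (cvec 0 (axis i 1)))"
proof -
  have e: "axis i 1 = cvec (axis i 1) 0" "axis i \<i> = cvec 0 (axis i 1)" for i :: 'n
    by (auto simp: cvec_def vec_eq_iff axis_def complex_eq_iff)
  let ?r = "\<lambda>i :: 'n. cvec (axis i 1) 0" and ?i = "\<lambda>i :: 'n. cvec 0 (axis i 1)"
  have B: "(Basis :: (complex ^ 'n) set) = range ?r \<union> range ?i"
    unfolding e[symmetric] by (auto simp: Basis_vec_def Basis_complex_def)
  have disj: "range ?r \<inter> range ?i = {}"
    by (auto simp: cvec_eq_iff axis_eq_0_iff)
  have inj: "inj ?r" "inj ?i"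
    by (auto simp: inj_def cvec_eq_iff axis_eq_axis)
  show ?thesis
    unfolding B by (subst sum.union_disjoint[OF _ _ disj]) (simp_all only: finite_UNIV finite_imageI finite sum.reindex[OF inj(1)] sum.reindex[OF inj(2)] o_def)
qed

lemma inner_cvec: "v \<bullet> cvec a b = re_vec v \<bullet> a + im_vec v \<bullet> b"
  by (simp add: inner_vec_def cvec_def inner_complex_def sum.distrib)

definition complexify ::
  "(real ^ 'n \<Rightarrow> real ^ 'n \<Rightarrow> real ^ 'n \<Rightarrow> real) \<Rightarrow> complex ^ 'n \<Rightarrow> complex ^ 'n \<Rightarrow> complex ^ 'n \<Rightarrow> real" where
  "complexify G w u v = G (re_vec w) (re_vec u) (re_vec v) + G (re_vec w) (im_vec u) (im_vec v)"

text \<open>The symmetry of the first derivatives says that the metric is locally a Hessian.\<close>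

locale hessian_metric = local_metric G UNIV
  for G :: "real ^ 'n \<Rightarrow> real ^ 'n \<Rightarrow> real ^ 'n \<Rightarrow> real" +
  assumes dG_sym: "\<And>x u v w. dir_deriv (\<lambda>y. G y v w) x u = dir_deriv (\<lambda>y. G y u w) x v"
begin

abbreviation C :: "real ^ 'n \<Rightarrow> real ^ 'n \<Rightarrow> real ^ 'n \<Rightarrow> real ^ 'n" where "C \<equiv> christoffel G"
abbreviation dC :: "real ^ 'n \<Rightarrow> real ^ 'n \<Rightarrow> real ^ 'n \<Rightarrow> real ^ 'n \<Rightarrow> real ^ 'n" where
  "dC x u v w \<equiv> dir_deriv (\<lambda>y. C y v w) x u"

text \<open>Total symmetry of dG makes the three Koszul terms equal, so one of them survives with
  factor 1/2.\<close>

lemma dG_christoffel: "dir_deriv (\<lambda>y. G y v w) x u = 2 * G x (C x u v) w"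
proof -
  have "dir_deriv (\<lambda>y. G y u w) x v = dir_deriv (\<lambda>y. G y v w) x u"
    by (rule dG_sym)
  moreover have "dir_deriv (\<lambda>y. G y u v) x w = dir_deriv (\<lambda>y. G y v w) x u"
    by (subst dG_sym, subst dh_sym) simp_all
  ultimately show ?thesis
    by (simp only: christoffel_koszul[OF UNIV_I] koszul_def) simp
qed

lemma has_derivative_C: "((\<lambda>y. C y v w) has_derivative (\<lambda>u. dC x u v w)) (at x)"
  by (simp add: frechet_derivative_worksI differentiable_christoffel)

lemma bilinear_C: "bilinear (C x)" by (simp add: bilinear_christoffel)

lemmas C_simps = bilinear_ladd[OF bilinear_C] bilinear_radd[OF bilinear_C]
  bilinear_lneg[OF bilinear_C] bilinear_rneg[OF bilinear_C] bilinear_lsub[OF bilinear_C]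
  bilinear_rsub[OF bilinear_C] bilinear_lzero[OF bilinear_C] bilinear_rzero[OF bilinear_C]

lemma C_sym: "C x v w = C x w v" by (simp add: christoffel_sym)

lemma dC_sym: "dC x u v w = dC x u w v" by (simp add: C_sym[of _ v])

text \<open>The connection dual to the flat coordinate connection of a Hessian metric has symbols
  \<open>2 C\<close>; its curvature is twice the antisymmetrisation of this expression in
  \<open>u\<close> and \<open>v\<close>.\<close>

definition dual_curvature :: "real ^ 'n \<Rightarrow> real ^ 'n \<Rightarrow> real ^ 'n \<Rightarrow> real ^ 'n \<Rightarrow> real ^ 'n" where
  "dual_curvature x u v w = dC x u v w + 2 *\<^sub>R C x u (C x v w)"

text \<open>Differentiating \<open>2 G(C(v, w), z) = dG(v; w, z)\<close> turns this into a second derivative of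
  \<open>G\<close>.\<close>

lemma G_dual_curvature:
  "2 * G x (dual_curvature x u v w) z = dir_deriv (\<lambda>y. dir_deriv (\<lambda>y. G y w z) y v) x u"
proof -
  have "((\<lambda>y. 2 * G y (C y v w) z) has_derivative
      (\<lambda>u. 2 * (dir_deriv (\<lambda>y. G y (C x v w) z) x u + G x (dC x u v w) z))) (at x)"
    using has_derivative_linear_family[of UNIV "\<lambda>x. x" x "\<lambda>y v. G y v z" "\<lambda>u. u" "\<lambda>y. C y v w",
        OF _ _ _ _ has_derivative_ident has_derivative_C]
    by (intro has_derivative_mult_right) (simp add: linear_h differentiable_h)
  then have "dir_deriv (\<lambda>y. dir_deriv (\<lambda>y. G y w z) y v) x u
      = 2 * (dir_deriv (\<lambda>y. G y (C x v w) z) x u + G x (dC x u v w) z)"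
    unfolding dG_christoffel by (rule dir_deriv_eq)
  then show ?thesis
    unfolding dG_christoffel dual_curvature_def
    by (simp add: linear_add[OF linear_h(2)] linear_cmul[OF linear_h(2)])
qed

text \<open>Second derivatives of \<open>G\<close> commute, and in this form that says that the dual
  connection is flat.\<close>

lemma dual_curvature_sym: "dual_curvature x u v w = dual_curvature x v u w"
proof (rule h_cancel)
  fix z
  have "dir_deriv (\<lambda>y. dir_deriv (\<lambda>y. G y w z) y v) x u = dir_deriv (\<lambda>y. dir_deriv (\<lambda>y. G y w z) y u) x v"
    by (rule dir_deriv_symmetric[OF open_UNIV UNIV_I smooth_h])
  then show "G x (dual_curvature x u v w) z = G x (dual_curvature x v u w) z"
    using G_dual_curvature[where x = x and u = u and v = v and w = w and z = z]
      G_dual_curvature[where x = x and u = v and v = u and w = w and z = z] by linarith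
qed simp

subsection \<open>The Ricci curvature\<close>

abbreviation H :: "complex ^ 'n \<Rightarrow> complex ^ 'n \<Rightarrow> complex ^ 'n \<Rightarrow> real" where "H \<equiv> complexify G"

sublocale cplx: local_metric H UNIV
proof
  show "smooth_on (\<lambda>x. H x v w) UNIV" for v w
    unfolding complexify_def
    by (intro smooth_on_add smooth_on_compose[OF open_UNIV open_UNIV smooth_h smooth_on_linear[OF linear_re_vec]]) auto
  show "bilinear (H x)" for x
    unfolding bilinear_def
    by (auto intro!: linearI simp: complexify_def linear_add[OF linear_h(1)] linear_add[OF linear_h(2)]
        linear_cmul[OF linear_h(1)] linear_cmul[OF linear_h(2)] algebra_simps)
  show "H x v w = H x w v" for x v w
    by (simp add: complexify_def sym_h[of _ "re_vec v"] sym_h[of _ "im_vec v"])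
  show "H x v v > 0" if "v \<noteq> 0" for x v
  proof (cases "re_vec v = 0")
    case True
    with that have "im_vec v \<noteq> 0" by (simp add: re_im_zero_iff)
    with True show ?thesis by (simp add: complexify_def pos_h linear_0[OF linear_h(1)])
  next
    case False
    moreover have "G (re_vec x) (im_vec v) (im_vec v) \<ge> 0"
      by (cases "im_vec v = 0") (auto simp: linear_0[OF linear_h(1)] pos_h intro: less_imp_le)
    ultimately show ?thesis by (simp add: complexify_def pos_h add_pos_nonneg)
  qed
qed simp

lemma dir_deriv_H:
  "dir_deriv (\<lambda>y. H y v w) x u
    = 2 * G (re_vec x) (C (re_vec x) (re_vec u) (re_vec v)) (re_vec w)
      + 2 * G (re_vec x) (C (re_vec x) (re_vec u) (im_vec v)) (im_vec w)"
proof (rule dir_deriv_eq)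
  have "((\<lambda>x. G (re_vec x) v w) has_derivative (\<lambda>u. dir_deriv (\<lambda>y. G y v w) (re_vec x) (re_vec u))) (at x)" for v w x
  proof -
    have "((\<lambda>y. G y v w) has_derivative dir_deriv (\<lambda>y. G y v w) (re_vec x)) (at (re_vec x))"
      by (simp add: frechet_derivative_worksI differentiable_h)
    from diff_chain_at[OF bounded_linear_imp_has_derivative[OF bounded_linear_re_vec] this]
    show ?thesis by (simp add: o_def)
  qed
  then show "((\<lambda>y. H y v w) has_derivative
      (\<lambda>u. 2 * G (re_vec x) (C (re_vec x) (re_vec u) (re_vec v)) (re_vec w)
      + 2 * G (re_vec x) (C (re_vec x) (re_vec u) (im_vec v)) (im_vec w))) (at x)"
    unfolding complexify_def dG_christoffel by (intro has_derivative_add)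
qed

text \<open>In terms of a local potential of \<open>G\<close> the expression is half of its third
  derivative, so all arguments may be permuted.\<close>

lemma G_C_sym: "G x (C x u v) w = G x (C x w v) u" "G x (C x u v) w = G x (C x u w) v"
proof -
  show *: "G x (C x u v) w = G x (C x u w) v" for u v w
    using dh_sym[of x v w u] dG_christoffel by simp
  show "G x (C x u v) w = G x (C x w v) u"
    using *[of v u w] by (simp add: C_sym[of x u v] C_sym[of x w v])
qed

text \<open>The connection is the complex bilinear extension of \<open>C\<close>.\<close>

lemma christoffel_H:
  "christoffel H x v w = cvec (C (re_vec x) (re_vec v) (re_vec w) - C (re_vec x) (im_vec v) (im_vec w))
     (C (re_vec x) (re_vec v) (im_vec w) + C (re_vec x) (im_vec v) (re_vec w))"
proof (rule cplx.christoffel_eqI)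
  fix z
  let ?g = "\<lambda>a b c. G (re_vec x) (C (re_vec x) a b) c"
  have perm: "?g a b c = ?g b a c" "?g a b c = ?g c b a" "?g a b c = ?g a c b" for a b c
    using G_C_sym by (simp_all add: C_sym[of _ a b])
  show "H x (cvec (C (re_vec x) (re_vec v) (re_vec w) - C (re_vec x) (im_vec v) (im_vec w))
     (C (re_vec x) (re_vec v) (im_vec w) + C (re_vec x) (im_vec v) (re_vec w))) z = cplx.koszul x v w z"
    using perm[of "re_vec v" "re_vec w" "re_vec z"] perm[of "re_vec w" "re_vec v" "re_vec z"]
      perm[of "re_vec z" "im_vec v" "im_vec w"] perm[of "re_vec v" "im_vec w" "im_vec z"]
      perm[of "im_vec v" "im_vec w" "re_vec z"]
      perm[of "re_vec w" "im_vec v" "im_vec z"] perm[of "im_vec v" "re_vec w" "im_vec z"]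
    unfolding cplx.koszul_def dir_deriv_H
    by (simp add: complexify_def linear_add[OF linear_h(2)] linear_diff[OF linear_h(2)])
qed simp

lemma dir_deriv_christoffel_H:
  "dir_deriv (\<lambda>y. christoffel H y v w) x u
    = cvec (dC (re_vec x) (re_vec u) (re_vec v) (re_vec w) - dC (re_vec x) (re_vec u) (im_vec v) (im_vec w))
        (dC (re_vec x) (re_vec u) (re_vec v) (im_vec w) + dC (re_vec x) (re_vec u) (im_vec v) (re_vec w))"
proof (rule dir_deriv_eq)
  have *: "((\<lambda>x. C (re_vec x) v w) has_derivative (\<lambda>u. dC (re_vec x) (re_vec u) v w)) (at x)" for v w x
    using diff_chain_at[OF bounded_linear_imp_has_derivative[OF bounded_linear_re_vec] has_derivative_C]
    by (simp add: o_def)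
  show "((\<lambda>y. christoffel H y v w) has_derivative (\<lambda>u.
      cvec (dC (re_vec x) (re_vec u) (re_vec v) (re_vec w) - dC (re_vec x) (re_vec u) (im_vec v) (im_vec w))
        (dC (re_vec x) (re_vec u) (re_vec v) (im_vec w) + dC (re_vec x) (re_vec u) (im_vec v) (re_vec w)))) (at x)"
    unfolding christoffel_H
    by (intro has_derivative_cvec has_derivative_add has_derivative_diff *)
qed

lemma linear_dC: "linear (\<lambda>u. dC x u v w)"
  by (rule linear_dir_deriv) (simp add: differentiable_christoffel)

lemma bilinear_dC: "bilinear (dC x u)"
  by (rule bilinear_dir_deriv_family[OF open_UNIV UNIV_I bilinear_C]) (simp add: differentiable_christoffel)

lemmas dC_zero = linear_0[OF linear_dC] bilinear_lzero[OF bilinear_dC] bilinear_rzero[OF bilinear_dC]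

text \<open>The left side is the part of the Ricci trace coming from \<open>z\<close> and
  \<open>i z\<close>. Flatness of the dual connection trades derivatives along \<open>z\<close> for
  derivatives along the real and imaginary parts of \<open>v\<close> and absorbs every term
  quadratic in \<open>C\<close>.\<close>

lemma riemann_H_trace:
  "re_vec (riemann H x (cvec z 0) v v) + im_vec (riemann H x (cvec 0 z) v v)
    = - dC (re_vec x) (re_vec v) (re_vec v) z - dC (re_vec x) (im_vec v) (im_vec v) z"
proof -
  let ?x = "re_vec x" and ?X = "re_vec v" and ?Y = "im_vec v"
  have S: "dC ?x z ?X ?X = dC ?x ?X z ?X + 2 *\<^sub>R C ?x ?X (C ?x z ?X) - 2 *\<^sub>R C ?x z (C ?x ?X ?X)"
    "dC ?x z ?Y ?Y = dC ?x ?Y z ?Y + 2 *\<^sub>R C ?x ?Y (C ?x z ?Y) - 2 *\<^sub>R C ?x z (C ?x ?Y ?Y)"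
    using dual_curvature_sym[of ?x z ?X ?X] dual_curvature_sym[of ?x z ?Y ?Y]
    unfolding dual_curvature_def by (simp_all add: eq_diff_eq)
  show ?thesis
    unfolding riemann_def dir_deriv_christoffel_H unfolding christoffel_H
    by (simp add: S C_simps dC_zero dC_sym[where v = ?X and w = z] dC_sym[where v = ?Y and w = z] C_sym[of ?x ?X z] scaleR_2 algebra_simps)
qed

text \<open>This turns out to be the differential of the logarithmic volume density
  (\<open>has_derivative_ln_density\<close>), so \<open>dtrC\<close> below is its Hessian, the
  quantity that appears in the Ricci curvature.\<close>

definition trC :: "real ^ 'n \<Rightarrow> real ^ 'n \<Rightarrow> real" where
  "trC x v = (\<Sum>i\<in>UNIV. C x v (axis i 1) $ i)"

definition dtrC :: "real ^ 'n \<Rightarrow> real ^ 'n \<Rightarrow> real ^ 'n \<Rightarrow> real" where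
  "dtrC x u v = (\<Sum>i\<in>UNIV. dC x u v (axis i 1) $ i)"

lemma has_derivative_trC: "((\<lambda>y. trC y v) has_derivative (\<lambda>u. dtrC x u v)) (at x)"
  unfolding trC_def dtrC_def
  by (intro has_derivative_sum bounded_linear.has_derivative[OF bounded_linear_vec_nth] has_derivative_C)

lemma ricci_H: "ricci H x v v = - dtrC (re_vec x) (re_vec v) (re_vec v) - dtrC (re_vec x) (im_vec v) (im_vec v)"
proof -
  have "ricci H x v v = (\<Sum>i\<in>UNIV. (re_vec (riemann H x (cvec (axis i 1) 0) v v)
      + im_vec (riemann H x (cvec 0 (axis i 1)) v v)) $ i)"
    unfolding ricci_def sum_Basis_complex_vec
    by (simp add: inner_cvec inner_axis sum.distrib)
  then show ?thesis
    unfolding riemann_H_trace by (simp add: dtrC_def sum_subtractf sum_negf)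
qed

subsection \<open>The volume density of the orbits\<close>

definition gmat :: "real ^ 'n \<Rightarrow> real ^ 'n ^ 'n" where
  "gmat x = (\<chi> i j. G x (axis i 1) (axis j 1))"

lemma axis_expansion: "v = (\<Sum>i\<in>UNIV. (v $ i) *\<^sub>R axis i (1::real))"
  using basis_expansion[of v] by (simp add: scalar_mult_eq_scaleR)

lemma G_left_expansion: "G x v w = (\<Sum>i\<in>UNIV. v $ i * G x (axis i 1) w)"
  by (subst axis_expansion[of v]) (simp add: linear_sum[OF linear_h(2)] linear_cmul[OF linear_h(2)])

lemma gmat_inner: "v \<bullet> (gmat x *v w) = G x v w"
proof -
  have "G x v w = (\<Sum>i\<in>UNIV. v $ i * (\<Sum>j\<in>UNIV. w $ j * G x (axis j 1) (axis i 1)))"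
    by (subst G_left_expansion[of x v w], subst sym_h, simp, subst G_left_expansion) simp
  then show ?thesis
    by (simp add: inner_vec_def matrix_vector_mult_def gmat_def mult.commute sym_h[of x "axis _ 1" "axis _ 1"])
qed

lemma det_gmat_pos: "det (gmat x) > 0"
  by (rule det_posdef) (simp add: gmat_inner pos_h)

lemma has_derivative_det_gmat:
  "((\<lambda>x. det (gmat x)) has_derivative (\<lambda>u. 2 * trC x u * det (gmat x))) (at x)"
proof -
  \<comment> \<open>Row \<open>i\<close> holds the coordinates of twice
    \<open>C x u (axis i 1)\<close>, as suggested by \<open>dG_christoffel\<close>; the trace of
    this matrix is \<open>2 * trC x u\<close>.\<close>
  define P :: "real ^ 'n \<Rightarrow> real ^ 'n ^ 'n" where "P u = (\<chi> i k. 2 * C x u (axis i 1) $ k)" for u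
  have "((\<lambda>x. gmat x $ i $ j) has_derivative (\<lambda>u. (P u ** gmat x) $ i $ j)) (at x)" for i j
  proof -
    have "((\<lambda>x. G x (axis i 1) (axis j 1)) has_derivative (\<lambda>u. 2 * G x (C x u (axis i 1)) (axis j 1))) (at x)"
      unfolding dG_christoffel[symmetric] by (simp add: frechet_derivative_worksI differentiable_h)
    moreover have "2 * G x (C x u (axis i 1)) (axis j 1) = (P u ** gmat x) $ i $ j" for u
      by (subst G_left_expansion) (simp add: P_def gmat_def matrix_matrix_mult_def sum_distrib_left mult.assoc)
    ultimately show ?thesis by (simp add: gmat_def)
  qed
  from has_derivative_det[of gmat P x, OF this]
  show ?thesis by (simp add: P_def trace_def trC_def sum_distrib_left)
qed

lemma has_derivative_ln_density:
  "((\<lambda>x. ln (sqrt (det (gmat x)))) has_derivative trC x) (at x)"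
proof -
  have "((\<lambda>x. (1 / 2) * ln (det (gmat x))) has_derivative
      (\<lambda>u. (1 / 2) * (2 * trC x u * det (gmat x) * inverse (det (gmat x))))) (at x)"
    by (intro has_derivative_mult_right has_derivative_ln has_derivative_det_gmat det_gmat_pos)
  moreover have "(1 / 2) * (2 * trC x u * det (gmat x) * inverse (det (gmat x))) = trC x u" for u
    using det_gmat_pos[of x] by simp
  moreover have "(1 / 2) * ln (det (gmat x)) = ln (sqrt (det (gmat x)))" for x
    using ln_sqrt[OF less_imp_le[OF det_gmat_pos[of x]]] by linarith
  ultimately show ?thesis by (simp only:)
qed

text \<open>The torus through \<open>x\<close> is \<open>\<theta> \<mapsto> cvec x \<theta>\<close>; the left hand side is minus its mean curvature in the
  metric \<open>H\<close>, a real vector.\<close>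

lemma trace_second_ff_zero:
  assumes "\<And>v. trC x v = 0"
  shows "(\<Sum>i\<in>UNIV. \<Sum>j\<in>UNIV. matrix_inv (gmat x) $ i $ j *\<^sub>R C x (axis i 1) (axis j 1)) = 0"
proof (rule h_cancel)
  fix z
  have inv: "gmat x ** matrix_inv (gmat x) = mat 1"
    using someI_ex[of "\<lambda>B. gmat x ** B = mat 1 \<and> B ** gmat x = mat 1"]
      invertible_det_nz[of "gmat x"] det_gmat_pos[of x]
    unfolding matrix_inv_def invertible_def by simp
  \<comment> \<open>Paired with \<open>z\<close>, total symmetry moves \<open>z\<close> into
    \<open>C\<close>; contracting \<open>gmat x\<close> with its inverse then leaves the trace
    \<open>trC x z\<close>.\<close>
  have "G x (\<Sum>i\<in>UNIV. \<Sum>j\<in>UNIV. matrix_inv (gmat x) $ i $ j *\<^sub>R C x (axis i 1) (axis j 1)) z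
      = (\<Sum>i\<in>UNIV. \<Sum>j\<in>UNIV. matrix_inv (gmat x) $ i $ j * G x (C x z (axis j 1)) (axis i 1))"
    by (simp add: linear_sum[OF linear_h(2)] linear_cmul[OF linear_h(2)] G_C_sym(1)[of x _ _ z])
  also have "\<dots> = (\<Sum>i\<in>UNIV. \<Sum>j\<in>UNIV. \<Sum>k\<in>UNIV. C x z (axis j 1) $ k * (gmat x $ k $ i * matrix_inv (gmat x) $ i $ j))"
    by (subst G_left_expansion) (simp add: gmat_def sum_distrib_left mult_ac)
  also have "\<dots> = (\<Sum>j\<in>UNIV. \<Sum>k\<in>UNIV. \<Sum>i\<in>UNIV. C x z (axis j 1) $ k * (gmat x $ k $ i * matrix_inv (gmat x) $ i $ j))"
    by (subst sum.swap) (intro sum.cong refl sum.swap)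
  also have "\<dots> = (\<Sum>j\<in>UNIV. \<Sum>k\<in>UNIV. C x z (axis j 1) $ k * (gmat x ** matrix_inv (gmat x)) $ k $ j)"
    by (simp add: matrix_matrix_mult_def sum_distrib_left)
  also have "\<dots> = trC x z"
    unfolding inv by (simp add: mat_def trC_def if_distrib[of "(*) _"] cong: if_cong)
  finally show "G x (\<Sum>i\<in>UNIV. \<Sum>j\<in>UNIV. matrix_inv (gmat x) $ i $ j *\<^sub>R C x (axis i 1) (axis j 1)) z = G x 0 z"
    using assms by (simp add: linear_0[OF linear_h(2)])
qed simp

end

section \<open>Logarithmic coordinates on a toric manifold\<close>

text \<open>The metric in logarithmic coordinates is accessible on preimages of chart domains only;
  these pieces are glued here.\<close>

lemma smooth_on_local:
  assumes "\<And>x. x \<in> S \<Longrightarrow> \<exists>T. open T \<and> x \<in> T \<and> smooth_on f T"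
  shows "smooth_on f S"
  unfolding smooth_on_def
proof
  fix k
  have "\<forall>x\<in>S. \<exists>T. open T \<and> x \<in> T \<and> Ck_on k f T"
    using assms unfolding smooth_on_def by blast
  then show "Ck_on k f S"
  proof (induction k arbitrary: f)
    case 0
    then show ?case
      by (auto intro!: continuous_at_imp_continuous_on dest!: bspec simp: continuous_on_eq_continuous_at)
  next
    case (Suc k)
    have "f differentiable (at x)" if "x \<in> S" for x
      using Suc.prems that by auto
    moreover have "Ck_on k (\<lambda>x. dir_deriv f x v) S" for v
    proof (rule Suc.IH)
      show "\<forall>x\<in>S. \<exists>T. open T \<and> x \<in> T \<and> Ck_on k (\<lambda>x. dir_deriv f x v) T"
        using Suc.prems by (force dest: bspec)
    qed
    ultimately show ?case by simp
  qed
qed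

text \<open>Serves for the moment map, of which only a first derivative is given: this derivative is
  expressed by the smooth metric.\<close>

lemma smooth_on_of_derivative:
  assumes S: "open S" and f: "\<And>x. x \<in> S \<Longrightarrow> (f has_derivative f' x) (at x)"
    and f': "\<And>v. smooth_on (\<lambda>x. f' x v) S"
  shows "smooth_on f S"
  unfolding smooth_on_def
proof
  fix k
  show "Ck_on k f S"
  proof (cases k)
    case 0
    then show ?thesis
      using f by (auto intro!: continuous_at_imp_continuous_on has_derivative_continuous)
  next
    case (Suc j)
    have "Ck_on j (\<lambda>x. dir_deriv f x v) S" for v
    proof (rule Ck_on_cong[OF S])
      show "Ck_on j (\<lambda>x. f' x v) S" using f' by (simp add: smooth_on_def)
      show "f' x v = dir_deriv f x v" if "x \<in> S" for x
        using dir_deriv_eq[OF f[OF that]] by simp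
    qed
    then show ?thesis
      using f Suc by (auto intro: differentiableI)
  qed
qed

section \<open>The exponential map of the complex torus\<close>

definition cexp :: "complex ^ 'n \<Rightarrow> complex ^ 'n" where "cexp w = (\<chi> i. exp (w $ i))"

lemma cexp_add: "cexp (w + z) = cexp w * cexp z"
  by (simp add: cexp_def vec_eq_iff exp_add)

lemma cexp_zero [simp]: "cexp 0 = 1"
  by (simp add: cexp_def vec_eq_iff)

lemma cexp_in_ctorus [simp]: "cexp w \<in> ctorus"
  by (simp add: cexp_def ctorus_def)

lemma ctorus_eq_range_cexp: "ctorus = range cexp"
proof -
  have "t = cexp (\<chi> i. Ln (t $ i))" if "t \<in> ctorus" for t :: "complex ^ 'n"
    using that by (simp add: cexp_def ctorus_def vec_eq_iff)
  then show ?thesis by auto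
qed

lemma open_ctorus: "open (ctorus :: (complex ^ 'n) set)"
proof -
  have eq: "ctorus = (\<Inter>i. {t :: complex ^ 'n. t $ i \<noteq> 0})" by (auto simp: ctorus_def)
  show ?thesis
    unfolding eq by (intro open_INT ballI open_Collect_neq continuous_intros) simp
qed

lemma has_derivative_vec_lambda:
  fixes f :: "'a::real_normed_vector \<Rightarrow> 'n::finite \<Rightarrow> 'b::euclidean_space"
  assumes "\<And>i. ((\<lambda>x. f x i) has_derivative (\<lambda>v. f' v i)) (at x)"
  shows "((\<lambda>x. \<chi> i. f x i) has_derivative (\<lambda>v. \<chi> i. f' v i)) (at x)"
proof -
  have bl: "bounded_linear (axis i :: 'b \<Rightarrow> 'b ^ 'n)" for i
    unfolding linear_conv_bounded_linear[symmetric]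
    by (rule linearI) (simp_all add: axis_def vec_eq_iff)
  have e: "(\<chi> i. h i) = (\<Sum>i\<in>UNIV. axis i (h i))" for h :: "'n \<Rightarrow> 'b"
    by (simp add: vec_eq_iff axis_def)
  show ?thesis
    unfolding e by (intro has_derivative_sum bounded_linear.has_derivative[OF bl] assms)
qed

lemma has_derivative_cexp: "(cexp has_derivative (\<lambda>v. cexp w * v)) (at w)"
proof -
  have "((\<lambda>w. exp (w $ i)) has_derivative (\<lambda>v. exp (w $ i) * v $ i)) (at w)" for i
  proof -
    have "(exp has_derivative (*) (exp (w $ i))) (at (w $ i))"
      using DERIV_exp[of "w $ i"] by (simp add: has_field_derivative_def)
    from diff_chain_at[OF bounded_linear_imp_has_derivative[OF bounded_linear_vec_nth] this]
    show ?thesis by (simp add: o_def)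
  qed
  from has_derivative_vec_lambda[of "\<lambda>w i. exp (w $ i)", OF this]
  show ?thesis by (simp add: cexp_def[abs_def] times_vec_def)
qed

lemma bounded_bilinear_times_vec: "bounded_bilinear ((*) :: complex ^ 'n \<Rightarrow> _)"
  unfolding bilinear_conv_bounded_bilinear[symmetric] bilinear_def
  by (auto intro!: linearI simp: vec_eq_iff algebra_simps)

lemma smooth_on_cexp: "smooth_on cexp S"
  unfolding smooth_on_def
proof
  fix k
  have "Ck_on k cexp (UNIV :: (complex ^ 'n) set)"
  proof (induction k)
    case 0
    then show ?case
      by (auto intro!: continuous_at_imp_continuous_on has_derivative_continuous has_derivative_cexp)
  next
    case (Suc k)
    have "Ck_on k (\<lambda>x. dir_deriv cexp x v) UNIV" for v :: "complex ^ 'n"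
      unfolding dir_deriv_eq[OF has_derivative_cexp]
      by (intro Ck_on_bilinear[OF bounded_bilinear_times_vec] Suc Ck_on_const) simp
    then show ?case by (auto intro: differentiableI has_derivative_cexp)
  qed
  then show "Ck_on k cexp S" by (rule Ck_on_subset) simp
qed

lemma Jmul_times: "Jmul (a * b) = a * Jmul b"
  by (simp add: Jmul_def vec_eq_iff)

lemma Jmul_zero [simp]: "Jmul 0 = 0"
  by (simp add: Jmul_def vec_eq_iff)

section \<open>Charts and the action in charts\<close>

locale toric =
  fixes A :: "('a::{t2_space,second_countable_topology}, 'n::finite) chart set"
    and act :: "complex ^ 'n \<Rightarrow> 'a \<Rightarrow> 'a" and p0 :: 'a
  assumes toric: "toric_manifold A act p0"
begin

lemma ex_chart: "\<exists>c\<in>A. p \<in> cdom c"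
  using toric unfolding toric_manifold_def complex_atlas_def by blast

lemma chart_at: "chart_at A p \<in> A" "p \<in> cdom (chart_at A p)"
proof -
  have "\<exists>c. c \<in> A \<and> p \<in> cdom c" using ex_chart by blast
  from someI_ex[OF this] show "chart_at A p \<in> A" "p \<in> cdom (chart_at A p)"
    unfolding chart_at_def by blast+
qed

lemma chart:
  assumes "c \<in> A"
  shows open_cdom: "open (cdom c)" and open_image: "open (cmap c ` cdom c)"
    and homeo: "homeomorphism (cdom c) (cmap c ` cdom c) (cmap c) (cinv c)"
  using assms toric unfolding toric_manifold_def complex_atlas_def by blast+

lemma cinv_cmap [simp]: "c \<in> A \<Longrightarrow> p \<in> cdom c \<Longrightarrow> cinv c (cmap c p) = p"
  using homeo unfolding homeomorphism_def by blast

lemma cmap_cinv: "x \<in> cmap c ` cdom c \<Longrightarrow> cmap c (cinv c x) = x" "x \<in> cmap c ` cdom c \<Longrightarrow> cinv c x \<in> cdom c"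
  by (simp_all add: f_inv_into_f inv_into_into)

lemma continuous_on_cmap: "c \<in> A \<Longrightarrow> continuous_on (cdom c) (cmap c)"
  and continuous_on_cinv: "c \<in> A \<Longrightarrow> continuous_on (cmap c ` cdom c) (cinv c)"
  using homeo unfolding homeomorphism_def by blast+

lemma open_cmap_image:
  assumes "c \<in> A" "open S" "S \<subseteq> cdom c"
  shows "open (cmap c ` S)"
proof -
  have "openin (top_of_set (cmap c ` cdom c)) (cmap c ` S)"
    using homeomorphism_imp_open_map[OF homeo[OF assms(1)]] assms
    by (simp add: openin_open_eq open_cdom)
  then show ?thesis
    using open_image[OF assms(1)] by (simp add: openin_open_eq)
qed

lemma open_cinv_image:
  assumes "c \<in> A" "open S" "S \<subseteq> cmap c ` cdom c"
  shows "open (cinv c ` S)"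
proof -
  have "cinv c ` S = cdom c \<inter> cmap c -` S"
  proof (intro equalityI subsetI)
    fix p assume "p \<in> cdom c \<inter> cmap c -` S"
    then show "p \<in> cinv c ` S" using cinv_cmap[OF assms(1), of p] by (auto intro!: image_eqI[of _ _ "cmap c p"])
  next
    fix p assume "p \<in> cinv c ` S"
    then obtain x where x: "x \<in> S" "p = cinv c x" by blast
    then have "x \<in> cmap c ` cdom c" using assms(3) by blast
    with x show "p \<in> cdom c \<inter> cmap c -` S" using cmap_cinv[of x c] by simp
  qed
  then show ?thesis
    using continuous_open_preimage[OF continuous_on_cmap[OF assms(1)] open_cdom[OF assms(1)] assms(2)] by simp
qed

lemma smooth_transition:
  assumes "c \<in> A" "d \<in> A"
  shows "smooth_on (cmap d \<circ> cinv c) (cmap c ` (cdom c \<inter> cdom d))" "open (cmap c ` (cdom c \<inter> cdom d))"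
proof -
  show "smooth_on (cmap d \<circ> cinv c) (cmap c ` (cdom c \<inter> cdom d))"
    using assms toric unfolding toric_manifold_def complex_atlas_def holo_on_def by blast
  show "open (cmap c ` (cdom c \<inter> cdom d))"
    using assms by (intro open_cmap_image open_Int open_cdom) auto
qed

lemma act_one [simp]: "act 1 p = p"
  and act_mult: "s \<in> ctorus \<Longrightarrow> t \<in> ctorus \<Longrightarrow> act (s * t) p = act s (act t p)"
  and continuous_act: "continuous_on (ctorus \<times> UNIV) (\<lambda>(t, p). act t p)"
  using toric unfolding toric_manifold_def holomorphic_action_def by blast+

definition act_dom :: "('a, 'n) chart \<Rightarrow> ('a, 'n) chart \<Rightarrow> ((complex ^ 'n) \<times> (complex ^ 'n)) set" where
  "act_dom c d = {(t, x). t \<in> ctorus \<and> x \<in> cmap c ` cdom c \<and> act t (cinv c x) \<in> cdom d}"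

definition act_in :: "('a, 'n) chart \<Rightarrow> ('a, 'n) chart \<Rightarrow> (complex ^ 'n) \<times> (complex ^ 'n) \<Rightarrow> complex ^ 'n" where
  "act_in c d = (\<lambda>(t, x). cmap d (act t (cinv c x)))"

lemma
  assumes "c \<in> A" "d \<in> A"
  shows smooth_act_in: "smooth_on (act_in c d) (act_dom c d)"
    and holo_act_in: "\<And>z v. z \<in> act_dom c d \<Longrightarrow>
      dir_deriv (act_in c d) z (map_prod Jmul Jmul v) = Jmul (dir_deriv (act_in c d) z v)"
  using assms toric
  unfolding toric_manifold_def holomorphic_action_def holo_on_def act_in_def act_dom_def by blast+

lemma open_act_dom:
  assumes "c \<in> A" "d \<in> A"
  shows "open (act_dom c d)"
proof -
  let ?T = "ctorus \<times> cmap c ` cdom c"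
  have "continuous_on ?T (\<lambda>z. (fst z, cinv c (snd z)))"
    by (intro continuous_intros continuous_on_compose2[OF continuous_on_cinv[OF assms(1)]]) auto
  then have "continuous_on ?T (\<lambda>z. (\<lambda>(t, p). act t p) (fst z, cinv c (snd z)))"
    by (rule continuous_on_compose2[OF continuous_act]) auto
  moreover have "open ?T" by (intro open_Times open_ctorus open_image assms)
  ultimately have "open (?T \<inter> (\<lambda>z. (\<lambda>(t, p). act t p) (fst z, cinv c (snd z))) -` cdom d)"
    by (rule continuous_open_preimage[OF _ _ open_cdom[OF assms(2)]])
  also have "?T \<inter> (\<lambda>z. (\<lambda>(t, p). act t p) (fst z, cinv c (snd z))) -` cdom d = act_dom c d"
    by (auto simp: act_dom_def)
  finally show ?thesis .
qed

section \<open>Orbit maps of the complex torus in additive coordinates\<close>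

definition flow :: "'a \<Rightarrow> complex ^ 'n \<Rightarrow> 'a" where "flow p w = act (cexp w) p"

lemma flow_zero [simp]: "flow p 0 = p"
  by (simp add: flow_def)

lemma flow_flow: "flow (flow p w) z = flow p (w + z)"
  by (simp add: flow_def cexp_add act_mult[symmetric] mult.commute)

lemma act_flow: "act (cexp z) (flow p w) = flow p (w + z)"
  by (subst flow_flow[symmetric]) (simp add: flow_def)

lemma continuous_flow: "continuous_on UNIV (flow p)"
proof -
  have "continuous_on UNIV (\<lambda>w. (cexp w, p))"
    by (intro continuous_intros smooth_on_continuous_on[OF smooth_on_cexp])
  then have "continuous_on UNIV (\<lambda>w. (\<lambda>(t, p). act t p) (cexp w, p))"
    by (rule continuous_on_compose2[OF continuous_act]) auto
  then show ?thesis by (simp add: flow_def[abs_def])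
qed

text \<open>The base point is arbitrary, since the compact case also examines orbits that are not
  yet known to be the big one.\<close>

definition orb :: "'a \<Rightarrow> ('a, 'n) chart \<Rightarrow> complex ^ 'n \<Rightarrow> complex ^ 'n" where "orb p c w = cmap c (flow p w)"
definition orb_dom :: "'a \<Rightarrow> ('a, 'n) chart \<Rightarrow> (complex ^ 'n) set" where "orb_dom p c = {w. flow p w \<in> cdom c}"

lemma open_orb_dom: "c \<in> A \<Longrightarrow> open (orb_dom p c)"
  using continuous_open_preimage[OF continuous_flow open_UNIV open_cdom, of c p]
  by (simp add: orb_dom_def vimage_def)

lemma orb_in_image: "w \<in> orb_dom p c \<Longrightarrow> orb p c w \<in> cmap c ` cdom c"
  by (simp add: orb_def orb_dom_def)

lemma cinv_orb: "c \<in> A \<Longrightarrow> w \<in> orb_dom p c \<Longrightarrow> cinv c (orb p c w) = flow p w"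
  by (simp add: orb_def orb_dom_def)

lemma orb_eq_act_in: "d \<in> A \<Longrightarrow> p \<in> cdom d \<Longrightarrow> orb p c w = act_in d c (cexp w, cmap d p)"
  by (simp add: orb_def act_in_def flow_def)

lemma in_act_dom: "d \<in> A \<Longrightarrow> p \<in> cdom d \<Longrightarrow> w \<in> orb_dom p c \<Longrightarrow> (cexp w, cmap d p) \<in> act_dom d c"
  by (simp add: act_dom_def orb_dom_def flow_def)

text \<open>One chart \<open>d\<close> at the base point serves all \<open>w\<close>: the orbit map
  is a slice of the jointly smooth action.\<close>

lemma smooth_orb:
  assumes c: "c \<in> A"
  shows "smooth_on (orb p c) (orb_dom p c)"
proof -
  obtain d where d: "d \<in> A" "p \<in> cdom d" using ex_chart by blast
  have "smooth_on (\<lambda>w. (cexp w, cmap d p)) (orb_dom p c)"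
  proof -
    have lin: "linear (\<lambda>t :: complex ^ 'n. (t, 0 :: complex ^ 'n))" by (rule linearI) auto
    have "smooth_on (\<lambda>w. (cexp w, 0) + (0, cmap d p)) (orb_dom p c)"
      by (intro smooth_on_add smooth_on_compose_linear[OF _ lin] smooth_on_const smooth_on_cexp open_orb_dom c)
    then show ?thesis by simp
  qed
  then have "smooth_on (\<lambda>w. act_in d c (cexp w, cmap d p)) (orb_dom p c)"
    by (rule smooth_on_compose[OF open_orb_dom[OF c] open_act_dom[OF d(1) c] smooth_act_in[OF d(1) c]])
      (simp add: in_act_dom d)
  then show ?thesis
    by (rule smooth_on_cong[OF open_orb_dom[OF c]]) (simp add: orb_eq_act_in[OF d])
qed

abbreviation dorb :: "'a \<Rightarrow> ('a, 'n) chart \<Rightarrow> complex ^ 'n \<Rightarrow> complex ^ 'n \<Rightarrow> complex ^ 'n" where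
  "dorb p c \<equiv> dir_deriv (orb p c)"

lemma has_derivative_orb: "c \<in> A \<Longrightarrow> w \<in> orb_dom p c \<Longrightarrow> (orb p c has_derivative dorb p c w) (at w)"
  by (rule smooth_on_has_derivative[OF smooth_orb])

lemma linear_dorb: "c \<in> A \<Longrightarrow> w \<in> orb_dom p c \<Longrightarrow> linear (dorb p c w)"
  by (rule has_derivative_linear[OF has_derivative_orb])

lemma dorb_act_in:
  assumes c: "c \<in> A" and d: "d \<in> A" "p \<in> cdom d" and w: "w \<in> orb_dom p c"
  shows "dorb p c w v = dir_deriv (act_in d c) (cexp w, cmap d p) (cexp w * v, 0)"
proof -
  have 1: "((\<lambda>w. (cexp w, cmap d p)) has_derivative (\<lambda>v. (cexp w * v, 0))) (at w)"
    by (intro has_derivative_Pair has_derivative_cexp has_derivative_const)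
  have 2: "(act_in d c has_derivative dir_deriv (act_in d c) (cexp w, cmap d p)) (at (cexp w, cmap d p))"
    using smooth_act_in[OF d(1) c] in_act_dom[OF d w] by (rule smooth_on_has_derivative)
  have "orb p c = act_in d c \<circ> (\<lambda>w. (cexp w, cmap d p))"
    by (simp add: fun_eq_iff orb_eq_act_in[OF d])
  with diff_chain_at[OF 1 2] show ?thesis
    by (simp add: dir_deriv_eq o_def)
qed

lemma dorb_Jmul:
  assumes "c \<in> A" "w \<in> orb_dom p c"
  shows "dorb p c w (Jmul v) = Jmul (dorb p c w v)"
proof -
  obtain d where d: "d \<in> A" "p \<in> cdom d" using ex_chart by blast
  show ?thesis
    unfolding dorb_act_in[OF assms(1) d assms(2)]
    using holo_act_in[OF d(1) assms(1) in_act_dom[OF d assms(2)], of "(cexp w * v, 0)"]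
    by (simp add: Jmul_times)
qed

lemma orb_dom_zero: "p \<in> cdom c \<Longrightarrow> 0 \<in> orb_dom p c"
  by (simp add: orb_dom_def)

lemma dorb_flow:
  assumes "c \<in> A" "w + z \<in> orb_dom p c"
  shows "dorb (flow p w) c z v = dorb p c (w + z) v"
proof (rule dir_deriv_eq)
  have "((\<lambda>z. w + z) has_derivative (\<lambda>v. v)) (at z)"
    by (auto intro!: derivative_eq_intros)
  from diff_chain_at[OF this has_derivative_orb[OF assms]]
  show "(orb (flow p w) c has_derivative dorb p c (w + z)) (at z)"
    by (simp add: o_def orb_def[abs_def] flow_flow)
qed

lemma dorb_transition:
  assumes c: "c \<in> A" "w \<in> orb_dom p c" and d: "d \<in> A" "w \<in> orb_dom p d"
  shows "dorb p d w v = dir_deriv (cmap d \<circ> cinv c) (orb p c w) (dorb p c w v)"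
proof (rule dir_deriv_eq)
  have x: "orb p c w \<in> cmap c ` (cdom c \<inter> cdom d)"
    using c d by (auto simp: orb_def orb_dom_def)
  have "((cmap d \<circ> cinv c) \<circ> orb p c has_derivative
      dir_deriv (cmap d \<circ> cinv c) (orb p c w) \<circ> dorb p c w) (at w)"
    by (rule diff_chain_at[OF has_derivative_orb[OF c] smooth_on_has_derivative[OF smooth_transition(1)[OF c(1) d(1)] x]])
  then show "(orb p d has_derivative
      (\<lambda>v. dir_deriv (cmap d \<circ> cinv c) (orb p c w) (dorb p c w v))) (at w)"
    unfolding o_def[of "dir_deriv _ _"]
    by (rule has_derivative_transform_within_open[OF _ open_orb_dom[OF c(1)] c(2)])
      (use c(1) in \<open>simp add: cinv_orb\<close>, simp add: orb_def)
qed

text \<open>A kernel vector \<open>v\<close> is transported by the action along the one-parameter group of \<open>v\<close>,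
  whose orbit is therefore constant.\<close>

lemma dorb_kernel_flow:
  assumes c: "c \<in> A" "p \<in> cdom c" and v: "dorb p c 0 v = 0"
    and d: "d \<in> A" "w \<in> orb_dom p d"
  shows "dorb p d w v = 0"
proof -
  \<comment> \<open>This is the action of \<open>cexp w\<close> read in charts. The group is
    abelian, so it carries the orbit map of \<open>p\<close> to that of \<open>flow p w\<close>, and
    its differential carries kernel vectors to kernel vectors.\<close>
  let ?F = "\<lambda>x. act_in c d (cexp w, x)"
  have in_dom: "(cexp w, cmap c p) \<in> act_dom c d" by (rule in_act_dom[OF c d(2)])
  have 1: "((\<lambda>x. (cexp w, x)) has_derivative (\<lambda>v. (0, v))) (at x)" for x :: "complex ^ 'n"
    by (intro has_derivative_Pair has_derivative_const has_derivative_ident)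
  have F: "(?F has_derivative (\<lambda>u. dir_deriv (act_in c d) (cexp w, cmap c p) (0, u))) (at (orb p c 0))"
    using diff_chain_at[OF 1 smooth_on_has_derivative[OF smooth_act_in[OF c(1) d(1)] in_dom]]
    by (simp add: o_def orb_def)
  have "((\<lambda>z. ?F (orb p c z)) has_derivative
      (\<lambda>u. dir_deriv (act_in c d) (cexp w, cmap c p) (0, dorb p c 0 u))) (at 0)"
    using diff_chain_at[OF has_derivative_orb[OF c(1) orb_dom_zero[OF c(2)]] F] by (simp add: o_def)
  then have "(orb (flow p w) d has_derivative
      (\<lambda>u. dir_deriv (act_in c d) (cexp w, cmap c p) (0, dorb p c 0 u))) (at 0)"
    by (rule has_derivative_transform_within_open[OF _ open_orb_dom[OF c(1)] orb_dom_zero[OF c(2)]])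
      (simp add: act_in_def c(1) orb_def orb_dom_def act_flow flow_flow add.commute)
  from dir_deriv_eq[OF this, of v] v
  have "dorb (flow p w) d 0 v = dir_deriv (act_in c d) (cexp w, cmap c p) 0" by (simp add: zero_prod_def)
  also have "\<dots> = 0"
    using smooth_on_differentiable[OF smooth_act_in[OF c(1) d(1)] in_dom]
    by (intro linear_0 linear_dir_deriv)
  finally show ?thesis using dorb_flow[OF d(1), of w 0 p v] d(2) by simp
qed

text \<open>The set of times at which the orbit is back at \<open>p\<close> is closed by the
  Hausdorff property. It is open because, as long as the curve stays in the chart, its derivative
  vanishes by \<open>dorb_kernel_flow\<close>. It contains 0, and the line is connected.\<close>

lemma kernel_flow_constant:
  assumes c: "c \<in> A" "p \<in> cdom c" and v: "dorb p c 0 v = 0"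
  shows "flow p (s *\<^sub>R v) = p"
proof -
  let ?Z = "{s :: real. flow p (s *\<^sub>R v) = p}"
  have cont: "continuous_on UNIV (\<lambda>s :: real. flow p (s *\<^sub>R v))"
    by (intro continuous_on_compose2[OF continuous_flow] continuous_intros) auto
  have "closed ?Z"
    using cont by (intro closed_Collect_eq continuous_on_const)
  moreover have "open ?Z"
    unfolding open_contains_ball
  proof
    fix s assume "s \<in> ?Z"
    have "open {s :: real. flow p (s *\<^sub>R v) \<in> cdom c}"
      using continuous_open_preimage[OF cont open_UNIV open_cdom[OF c(1)]] by (simp add: vimage_def)
    moreover have "s \<in> {s. flow p (s *\<^sub>R v) \<in> cdom c}" using \<open>s \<in> ?Z\<close> c by simp
    ultimately obtain e where e: "e > 0" "ball s e \<subseteq> {s. flow p (s *\<^sub>R v) \<in> cdom c}"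
      unfolding open_contains_ball by blast
    have "((\<lambda>r. orb p c (r *\<^sub>R v)) has_derivative (\<lambda>_. 0)) (at r within ball s e)" if "r \<in> ball s e" for r
    proof -
      have dom: "r *\<^sub>R v \<in> orb_dom p c" using e that by (auto simp: orb_dom_def)
      have 1: "((\<lambda>r. r *\<^sub>R v) has_derivative (\<lambda>t. t *\<^sub>R v)) (at r)"
        by (auto intro!: derivative_eq_intros)
      have "dorb p c (r *\<^sub>R v) (t *\<^sub>R v) = 0" for t
        using dorb_kernel_flow[OF c v c(1) dom] linear_dorb[OF c(1) dom] by (simp add: linear_cmul)
      with diff_chain_at[OF 1 has_derivative_orb[OF c(1) dom]]
      have "((\<lambda>r. orb p c (r *\<^sub>R v)) has_derivative (\<lambda>_. 0)) (at r)" by (simp add: o_def)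
      then show ?thesis by (rule has_derivative_at_withinI)
    qed
    then have "\<exists>k. \<forall>r\<in>ball s e. orb p c (r *\<^sub>R v) = k"
      by (intro has_derivative_zero_constant) auto
    then obtain k where k: "orb p c (r *\<^sub>R v) = k" if "r \<in> ball s e" for r by auto
    have const: "orb p c (r *\<^sub>R v) = orb p c (s *\<^sub>R v)" if "r \<in> ball s e" for r
      using k[OF that] k[of s] e(1) by simp
    have "flow p (r *\<^sub>R v) = p" if "r \<in> ball s e" for r
    proof -
      have "r *\<^sub>R v \<in> orb_dom p c" "s *\<^sub>R v \<in> orb_dom p c"
        using e that \<open>s \<in> ?Z\<close> c by (auto simp: orb_dom_def)
      then have "flow p (r *\<^sub>R v) = flow p (s *\<^sub>R v)"
        using const[OF that] cinv_orb[OF c(1), of "r *\<^sub>R v" p] cinv_orb[OF c(1), of "s *\<^sub>R v" p] by simp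
      then show ?thesis using \<open>s \<in> ?Z\<close> by simp
    qed
    then show "\<exists>e>0. ball s e \<subseteq> ?Z" using e(1) by blast
  qed
  ultimately have "?Z = {} \<or> ?Z = UNIV" using clopen[of ?Z] by blast
  moreover have "0 \<in> ?Z" by simp
  ultimately show ?thesis by blast
qed

lemma flow_p0_inj: "flow p0 w = flow p0 z \<longleftrightarrow> cexp w = cexp z"
  using toric unfolding toric_manifold_def flow_def by (auto dest: inj_onD)

text \<open>A kernel vector \<open>v\<close> yields a one-parameter group fixing a point with
  trivial stabiliser, so the exponential of \<open>s\<close> times \<open>v $ i\<close> is 1 for
  every real \<open>s\<close>; differentiating at 0 gives \<open>v $ i = 0\<close>.\<close>

lemma inj_dorb:
  assumes c: "c \<in> A" "w \<in> orb_dom p0 c"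
  shows "inj (dorb p0 c w)"
  unfolding linear_injective_0[OF linear_dorb[OF c]]
proof (intro allI impI)
  fix v assume v: "dorb p0 c w v = 0"
  have p: "flow p0 w \<in> cdom c" using c by (simp add: orb_dom_def)
  have "dorb (flow p0 w) c 0 v = 0" using v dorb_flow[OF c(1), of w 0] c by simp
  from kernel_flow_constant[OF c(1) p this]
  have "cexp (w + s *\<^sub>R v) = cexp w" for s
    by (simp add: flow_flow flow_p0_inj)
  then have "cexp w * cexp (s *\<^sub>R v) = cexp w" for s by (simp add: cexp_add)
  then have one: "exp (s *\<^sub>R (v $ i)) = 1" for s i
    by (auto simp: cexp_def vec_eq_iff dest!: meta_spec[of _ s])
  have "v $ i = 0" for i
  proof -
    have "((\<lambda>s. exp (s *\<^sub>R (v $ i))) has_vector_derivative (exp (0 *\<^sub>R (v $ i)) * v $ i)) (at 0)"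
      by (rule exp_scaleR_has_vector_derivative_right)
    moreover have "((\<lambda>s. exp (s *\<^sub>R (v $ i))) has_vector_derivative 0) (at 0)"
      unfolding one by simp
    ultimately show ?thesis by (metis vector_derivative_at scaleR_zero_left exp_zero mult_1)
  qed
  then show "v = 0" by (simp add: vec_eq_iff)
qed

lemma big_orbit_eq: "big_orbit act p0 = range (flow p0)"
  by (auto simp: big_orbit_def ctorus_eq_range_cexp flow_def)

lemma fundamental_field_eq:
  assumes "c \<in> A" "p \<in> cdom c"
  shows "fundamental_field act X c p = dorb p c 0 (cvec 0 X)"
  unfolding fundamental_field_def
proof (rule vector_derivative_at)
  have "(\<chi> i. cis (r * X $ i)) = cexp (r *\<^sub>R cvec 0 X)" for r
  proof -
    have "\<i> * complex_of_real (r * x) = r *\<^sub>R Complex 0 x" for x by (simp add: complex_eq_iff)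
    then show ?thesis unfolding cexp_def cvec_def vec_eq_iff cis_conv_exp by simp
  qed
  then have e: "(\<lambda>r. cmap c (act (\<chi> i. cis (r * X $ i)) p)) = (\<lambda>r. orb p c (r *\<^sub>R cvec 0 X))"
    by (simp add: orb_def flow_def)
  have "((\<lambda>r. r *\<^sub>R cvec 0 X) has_derivative (\<lambda>t. t *\<^sub>R cvec 0 X)) (at 0)"
    by (auto intro!: derivative_eq_intros)
  moreover have "(orb p c has_derivative dorb p c 0) (at (0 *\<^sub>R cvec 0 X))"
    using has_derivative_orb[OF assms(1) orb_dom_zero[OF assms(2)]] by simp
  ultimately have "((\<lambda>r. orb p c (r *\<^sub>R cvec 0 X)) has_derivative (\<lambda>t. dorb p c 0 (t *\<^sub>R cvec 0 X))) (at 0)"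
    using diff_chain_at[of "\<lambda>r. r *\<^sub>R cvec 0 X" _ 0 "orb p c"] by (simp add: o_def)
  then show "((\<lambda>r. cmap c (act (\<chi> i. cis (r * X $ i)) p)) has_vector_derivative dorb p c 0 (cvec 0 X)) (at 0)"
    unfolding e has_vector_derivative_def
    using linear_cmul[OF linear_dorb[OF assms(1) orb_dom_zero[OF assms(2)]]] by simp
qed

end

section \<open>Invariant Kaehler metrics on a toric manifold\<close>

locale toric_kaehler = toric A act p0
  for A :: "('a::{t2_space,second_countable_topology}, 'n::finite) chart set"
    and act :: "complex ^ 'n \<Rightarrow> 'a \<Rightarrow> 'a" and p0 :: 'a +
  fixes g :: "('a, 'n) metric"
  assumes kaehler: "kaehler_metric A g" and hamiltonian: "hamiltonian_torus_action A g act"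
begin

section \<open>The metric along orbit maps\<close>

lemma chart_metric:
  assumes "c \<in> A"
  shows "local_metric (g c) (cmap c ` cdom c)"
proof -
  have r: "riemannian_metric A g" using kaehler unfolding kaehler_metric_def by blast
  have s: "smooth_on (\<lambda>x. g c x v w) (cmap c ` cdom c)" for v w
    using r assms unfolding riemannian_metric_def by blast
  have "bilinear (g c x)" "g c x v w = g c x w v" "v \<noteq> 0 \<longrightarrow> g c x v v > 0"
    if "x \<in> cmap c ` cdom c" for x v w
    using r[unfolded riemannian_metric_def, THEN conjunct2, THEN conjunct1, THEN bspec, OF assms, THEN bspec, OF that]
    by blast+
  with s show ?thesis
    by (intro local_metric.intro open_image assms) blast+
qed

lemma metric_transition:
  "c \<in> A \<Longrightarrow> d \<in> A \<Longrightarrow> x \<in> cmap c ` (cdom c \<inter> cdom d) \<Longrightarrow>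
    g c x v w = g d ((cmap d \<circ> cinv c) x) (dir_deriv (cmap d \<circ> cinv c) x v) (dir_deriv (cmap d \<circ> cinv c) x w)"
  using kaehler unfolding kaehler_metric_def riemannian_metric_def by blast

lemma metric_Jmul: "c \<in> A \<Longrightarrow> x \<in> cmap c ` cdom c \<Longrightarrow> g c x (Jmul v) (Jmul w) = g c x v w"
  using kaehler unfolding kaehler_metric_def by blast

text \<open>The pullback of the metric by \<open>flow p\<close>, a form that may degenerate for
  general \<open>p\<close>. The chosen chart is immaterial by \<open>gorb_eq\<close>.\<close>

definition gorb :: "'a \<Rightarrow> complex ^ 'n \<Rightarrow> complex ^ 'n \<Rightarrow> complex ^ 'n \<Rightarrow> real" where
  "gorb p w v u = (let c = chart_at A (flow p w) in g c (orb p c w) (dorb p c w v) (dorb p c w u))"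

lemma gorb_eq:
  assumes c: "c \<in> A" "w \<in> orb_dom p c"
  shows "gorb p w v u = g c (orb p c w) (dorb p c w v) (dorb p c w u)"
proof -
  define d where "d = chart_at A (flow p w)"
  have d: "d \<in> A" "w \<in> orb_dom p d" using chart_at by (simp_all add: d_def orb_dom_def)
  have "orb p c w \<in> cmap c ` (cdom c \<inter> cdom d)"
    using c d by (auto simp: orb_def orb_dom_def)
  from metric_transition[OF c(1) d(1) this]
  have "g c (orb p c w) (dorb p c w v) (dorb p c w u)
    = g d ((cmap d \<circ> cinv c) (orb p c w)) (dorb p d w v) (dorb p d w u)"
    unfolding dorb_transition[OF c d] .
  also have "(cmap d \<circ> cinv c) (orb p c w) = orb p d w"
    using c by (simp add: cinv_orb) (simp add: orb_def)
  finally show ?thesis unfolding gorb_def d_def[symmetric] Let_def by simp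
qed

lemma ex_orb_chart: "\<exists>c\<in>A. w \<in> orb_dom p c"
  using ex_chart[of "flow p w"] by (simp add: orb_dom_def)

lemma gorb_flow: "gorb (flow p w) z v u = gorb p (w + z) v u"
proof -
  obtain c where c: "c \<in> A" "w + z \<in> orb_dom p c" using ex_orb_chart by blast
  then have "z \<in> orb_dom (flow p w) c" by (simp add: orb_dom_def flow_flow)
  with c show ?thesis
    by (simp add: gorb_eq dorb_flow) (simp add: orb_def flow_flow)
qed

lemma bilinear_gorb: "bilinear (gorb p w)"
proof -
  obtain c where c: "c \<in> A" "w \<in> orb_dom p c" using ex_orb_chart by blast
  interpret local_metric "g c" "cmap c ` cdom c" by (rule chart_metric[OF c(1)])
  have e: "gorb p w = (\<lambda>v u. g c (orb p c w) (dorb p c w v) (dorb p c w u))"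
    using gorb_eq[OF c] by blast
  show ?thesis
    unfolding e bilinear_def
    using linear_h[OF orb_in_image[OF c(2)]] linear_compose[OF linear_dorb[OF c], unfolded o_def] by blast
qed

lemmas gorb_simps = bilinear_ladd[OF bilinear_gorb] bilinear_radd[OF bilinear_gorb]
  bilinear_lneg[OF bilinear_gorb] bilinear_rneg[OF bilinear_gorb]
  bilinear_lzero[OF bilinear_gorb] bilinear_rzero[OF bilinear_gorb]

lemma gorb_sym: "gorb p w v u = gorb p w u v"
proof -
  obtain c where c: "c \<in> A" "w \<in> orb_dom p c" using ex_orb_chart by blast
  interpret local_metric "g c" "cmap c ` cdom c" by (rule chart_metric[OF c(1)])
  show ?thesis using sym_h[OF orb_in_image[OF c(2)]] by (simp add: gorb_eq[OF c])
qed

lemma gorb_Jmul: "gorb p w (Jmul v) (Jmul u) = gorb p w v u"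
proof -
  obtain c where c: "c \<in> A" "w \<in> orb_dom p c" using ex_orb_chart by blast
  show ?thesis
    using metric_Jmul[OF c(1) orb_in_image[OF c(2)]] by (simp add: gorb_eq[OF c] dorb_Jmul[OF c])
qed

section \<open>What the moment map says about the metric\<close>

definition moment :: "'a \<Rightarrow> real ^ 'n" where
  "moment = (SOME \<mu>. (\<forall>c\<in>A. \<forall>p\<in>cdom c. \<forall>X.
        ((\<lambda>x. \<mu> (cinv c x) \<bullet> X) has_derivative
           (\<lambda>v. kaehler_form g c (cmap c p) (fundamental_field act X c p) v)) (at (cmap c p))) \<and>
     (\<forall>t\<in>torus. \<forall>p. \<mu> (act t p) = \<mu> p))"

lemma
  shows moment_field: "\<And>c p X. c \<in> A \<Longrightarrow> p \<in> cdom c \<Longrightarrow> ((\<lambda>x. moment (cinv c x) \<bullet> X) has_derivative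
           (\<lambda>v. kaehler_form g c (cmap c p) (fundamental_field act X c p) v)) (at (cmap c p))"
    and moment_act: "\<And>t p. t \<in> torus \<Longrightarrow> moment (act t p) = moment p"
  using someI_ex[OF hamiltonian[unfolded hamiltonian_torus_action_def], folded moment_def] by blast+

lemma moment_flow_imag: "moment (flow p (w + cvec 0 \<theta>)) = moment (flow p w)"
proof -
  have "cexp (cvec 0 \<theta>) \<in> torus"
    by (simp add: torus_def cexp_def cvec_def)
  from moment_act[OF this, of "flow p w"] show ?thesis by (simp add: act_flow)
qed

lemma cvec_neg: "cvec (- X) 0 = - cvec X 0"
  by (rule re_im_eqI) simp_all

text \<open>The generator of \<open>X\<close> is the imaginary vector \<open>cvec 0 X\<close>, and
  \<open>Jmul\<close> sends it to minus \<open>cvec X 0\<close>: this is the sign that makes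
  \<open>G\<close> minus the differential of the moment map.\<close>

lemma has_derivative_moment:
  "((\<lambda>z. moment (flow p z) \<bullet> X) has_derivative (\<lambda>v. - gorb p w (cvec X 0) v)) (at w)"
proof -
  obtain c where c: "c \<in> A" "w \<in> orb_dom p c" using ex_orb_chart by blast
  interpret local_metric "g c" "cmap c ` cdom c" by (rule chart_metric[OF c(1)])
  have q: "flow p w \<in> cdom c" using c by (simp add: orb_dom_def)
  have ff: "fundamental_field act X c (flow p w) = dorb p c w (cvec 0 X)"
    using fundamental_field_eq[OF c(1) q] dorb_flow[OF c(1), of w 0] c(2) by simp
  have "((\<lambda>x. moment (cinv c x) \<bullet> X) has_derivative
      (\<lambda>v. kaehler_form g c (orb p c w) (dorb p c w (cvec 0 X)) v)) (at (orb p c w))"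
    using moment_field[OF c(1) q, of X] unfolding ff by (simp add: orb_def)
  from diff_chain_at[OF has_derivative_orb[OF c] this]
  have "((\<lambda>z. moment (cinv c (orb p c z)) \<bullet> X) has_derivative
      (\<lambda>v. kaehler_form g c (orb p c w) (dorb p c w (cvec 0 X)) (dorb p c w v))) (at w)"
    by (simp add: o_def)
  moreover have "kaehler_form g c (orb p c w) (dorb p c w (cvec 0 X)) (dorb p c w v) = - gorb p w (cvec X 0) v" for v
    unfolding kaehler_form_def dorb_Jmul[OF c, symmetric] gorb_eq[OF c, symmetric] Jmul_cvec cvec_neg
    by (simp add: gorb_simps)
  ultimately have "((\<lambda>z. moment (cinv c (orb p c z)) \<bullet> X) has_derivative (\<lambda>v. - gorb p w (cvec X 0) v)) (at w)"
    by simp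
  then show ?thesis
    by (rule has_derivative_transform_within_open[OF _ open_orb_dom[OF c(1)] c(2)]) (simp add: cinv_orb c(1))
qed

text \<open>The moment map is constant along orbits of the compact torus, so its derivative in
  imaginary directions is zero. This holds for every \<open>p\<close>, including points off the big
  orbit.\<close>

lemma gorb_orthogonal: "gorb p w (cvec X 0) (cvec 0 Y) = 0"
proof -
  have 1: "((\<lambda>t. w + t *\<^sub>R cvec 0 Y) has_derivative (\<lambda>t. t *\<^sub>R cvec 0 Y)) (at (0::real))"
    by (auto intro!: derivative_eq_intros)
  have "((\<lambda>z. moment (flow p z) \<bullet> X) has_derivative (\<lambda>v. - gorb p w (cvec X 0) v)) (at (w + 0 *\<^sub>R cvec 0 Y))"
    using has_derivative_moment by simp
  from diff_chain_at[OF 1 this]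
  have "((\<lambda>t. moment (flow p (w + t *\<^sub>R cvec 0 Y)) \<bullet> X) has_derivative
      (\<lambda>t. - gorb p w (cvec X 0) (t *\<^sub>R cvec 0 Y))) (at (0::real))"
    by (simp add: o_def)
  moreover have "((\<lambda>t. moment (flow p (w + t *\<^sub>R cvec 0 Y)) \<bullet> X) has_derivative (\<lambda>t. 0)) (at (0::real))"
    by (simp add: cvec_scaleR moment_flow_imag)
  ultimately have "(\<lambda>t::real. - gorb p w (cvec X 0) (t *\<^sub>R cvec 0 Y)) = (\<lambda>t. 0)"
    by (rule has_derivative_unique)
  from fun_cong[OF this, of 1] show ?thesis by simp
qed

text \<open>The moment map does not change under imaginary translations, hence neither does its
  derivative, which is the metric with one real argument.\<close>

lemma gorb_invariant: "gorb p (w + cvec 0 \<theta>) (cvec X 0) v = gorb p w (cvec X 0) v"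
proof -
  have 1: "((\<lambda>z. z + cvec 0 \<theta>) has_derivative (\<lambda>v. v)) (at w)"
    by (auto intro!: derivative_eq_intros)
  from diff_chain_at[OF 1 has_derivative_moment]
  have "((\<lambda>z. moment (flow p z) \<bullet> X) has_derivative (\<lambda>v. - gorb p (w + cvec 0 \<theta>) (cvec X 0) v)) (at w)"
    by (simp add: o_def moment_flow_imag)
  from has_derivative_unique[OF this has_derivative_moment]
  show ?thesis by (metis minus_equation_iff)
qed

definition G :: "real ^ 'n \<Rightarrow> real ^ 'n \<Rightarrow> real ^ 'n \<Rightarrow> real" where
  "G x X Y = gorb p0 (cvec x 0) (cvec X 0) (cvec Y 0)"

text \<open>Orthogonality removes the mixed terms, \<open>Jmul\<close> identifies the imaginary
  block with the real one, and invariance discards the imaginary part of the base point.\<close>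

lemma gorb_eq_complexify: "gorb p0 = complexify G"
proof (intro ext)
  fix w v u :: "complex ^ 'n"
  have w: "w = cvec (re_vec w) 0 + cvec 0 (im_vec w)"
    by (simp add: cvec_add)
  have e: "v = cvec (re_vec v) 0 + cvec 0 (im_vec v)" for v :: "complex ^ 'n"
    by (simp add: cvec_add)
  have J: "gorb p0 w (cvec 0 X) (cvec 0 Y) = gorb p0 w (cvec X 0) (cvec Y 0)" for X Y
    using gorb_Jmul[of p0 w "cvec X 0" "cvec Y 0"] by (simp add: Jmul_cvec)
  have R: "gorb p0 w (cvec X 0) (cvec Y 0) = G (re_vec w) X Y" for X Y
    unfolding G_def by (subst w) (rule gorb_invariant)
  have "gorb p0 w v u = gorb p0 w (cvec (re_vec v) 0 + cvec 0 (im_vec v)) (cvec (re_vec u) 0 + cvec 0 (im_vec u))"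
    using e[of v] e[of u] by simp
  also have "\<dots> = gorb p0 w (cvec (re_vec v) 0) (cvec (re_vec u) 0) + gorb p0 w (cvec 0 (im_vec v)) (cvec 0 (im_vec u))"
    using gorb_orthogonal gorb_sym[of p0 w "cvec 0 _" "cvec _ 0"] by (simp add: gorb_simps)
  finally show "gorb p0 w v u = complexify G w v u"
    by (simp add: J R complexify_def)
qed

text \<open>The bridge between atlas and logarithmic coordinates: curvature, Gram matrices and
  second fundamental forms of \<open>g c\<close> may now be computed for
  \<open>complexify G\<close>.\<close>

lemma orb_pullback:
  assumes c: "c \<in> A"
  shows "metric_pullback (g c) (cmap c ` cdom c) (orb p0 c) (orb_dom p0 c) (complexify G)"
proof -
  interpret local_metric "g c" "cmap c ` cdom c" by (rule chart_metric[OF c])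
  show ?thesis
  proof
    show "open (orb_dom p0 c)" "smooth_on (orb p0 c) (orb_dom p0 c)"
      by (simp_all add: open_orb_dom smooth_orb c)
    show "orb p0 c x \<in> cmap c ` cdom c" "inj (dorb p0 c x)"
      "complexify G x v w = g c (orb p0 c x) (dorb p0 c x v) (dorb p0 c x w)" if "x \<in> orb_dom p0 c" for x v w
      using that by (simp_all add: orb_in_image inj_dorb gorb_eq_complexify[symmetric] gorb_eq c)
  qed
qed

lemma complexify_G_local:
  obtains T where "open T" "w \<in> T" "local_metric (complexify G) T"
proof -
  obtain c where c: "c \<in> A" "w \<in> orb_dom p0 c" using ex_orb_chart by blast
  interpret metric_pullback "g c" "cmap c ` cdom c" "orb p0 c" "orb_dom p0 c" "complexify G"
    by (rule orb_pullback[OF c(1)])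
  show ?thesis using that open_orb_dom c source.local_metric_axioms by blast
qed

lemma smooth_G: "smooth_on (\<lambda>x. G x X Y) UNIV"
proof -
  have 1: "smooth_on (\<lambda>w. complexify G w (cvec X 0) (cvec Y 0)) UNIV"
    by (rule smooth_on_local) (metis complexify_G_local local_metric.smooth_h)
  have 2: "linear (\<lambda>x :: real ^ 'n. cvec x 0)"
    by (rule linearI) (simp_all add: cvec_add cvec_scaleR)
  have 3: "complexify G (cvec x 0) (cvec X 0) (cvec Y 0) = G x X Y" for x
    by (simp add: complexify_def) (simp add: G_def gorb_simps)
  show ?thesis
    using smooth_on_compose[OF open_UNIV open_UNIV 1 smooth_on_linear[OF 2]] unfolding 3 by simp
qed

sublocale hess: hessian_metric G
proof
  show "smooth_on (\<lambda>x. G x X Y) UNIV" for X Y by (rule smooth_G)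
  show "bilinear (G x)" for x
    unfolding bilinear_def
    by (auto intro!: linearI simp: G_def gorb_simps cvec_add[of _ 0 _ 0, simplified, symmetric]
        cvec_scaleR[of _ _ 0, simplified, symmetric] bilinear_lmul[OF bilinear_gorb] bilinear_rmul[OF bilinear_gorb])
  show "G x X Y = G x Y X" for x X Y unfolding G_def by (rule gorb_sym)
  show "G x X X > 0" if "X \<noteq> 0" for x X
  proof -
    obtain T where T: "cvec x 0 \<in> T" "local_metric (complexify G) T" using complexify_G_local by blast
    have "complexify G (cvec x 0) (cvec X 0) (cvec X 0) > 0"
      using that by (intro local_metric.pos_h[OF T(2,1)]) (simp add: re_im_zero_iff)
    then show ?thesis by (simp add: complexify_def) (simp add: G_def gorb_simps)
  qed
  show "dir_deriv (\<lambda>y. G y v w) x u = dir_deriv (\<lambda>y. G y u w) x v" for x u v w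
  proof -
    \<comment> \<open>The covector field \<open>G y v w\<close> in \<open>v\<close> is exact with
      this primitive, so the symmetry is that of second derivatives of \<open>f\<close>.\<close>
    define f where "f y = - (moment (flow p0 (cvec y 0)) \<bullet> w)" for y
    have f: "(f has_derivative (\<lambda>v. G y v w)) (at y)" for y
    proof -
      have 1: "((\<lambda>y. cvec y 0) has_derivative (\<lambda>v. cvec v 0)) (at y)"
        by (intro has_derivative_cvec has_derivative_ident has_derivative_const)
      show ?thesis
        using has_derivative_minus[OF diff_chain_at[OF 1 has_derivative_moment[of p0 w]]]
        by (simp add: f_def[abs_def] o_def G_def gorb_sym[of _ _ "cvec w 0"])
    qed
    have "smooth_on f UNIV"
      by (rule smooth_on_of_derivative[OF open_UNIV f smooth_G])
    from dir_deriv_symmetric[OF open_UNIV UNIV_I this, of v x u]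
    show ?thesis by (simp add: dir_deriv_eq[OF f])
  qed
qed simp

subsection \<open>Volume and Ricci curvature\<close>

lemma orbit_param_eq: "orbit_param act p0 x \<theta> = flow p0 (cvec x \<theta>)"
  by (simp add: orbit_param_def flow_def cexp_def cvec_def)

lemma cmap_orbit_param: "cmap c \<circ> orbit_param act p0 x = orb p0 c \<circ> cvec x"
  by (simp add: fun_eq_iff orbit_param_eq orb_def)

lemma has_derivative_cvec_right: "(cvec x has_derivative (\<lambda>t. cvec 0 t)) (at \<theta>)"
  using has_derivative_cvec[OF has_derivative_const has_derivative_ident, of x \<theta>] by simp

lemma smooth_on_cvec_right: "smooth_on (cvec x) S"
  by (rule smooth_on_subset[OF smooth_on_of_derivative[OF open_UNIV has_derivative_cvec_right smooth_on_const]]) simp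

lemma partial_d_cvec: "partial_d (cvec x) i \<theta> = cvec 0 (axis i 1)"
  unfolding partial_d_def by (rule dir_deriv_eq[OF has_derivative_cvec_right])

lemma gram_cvec: "gram (complexify G) (cvec x) \<theta> = hess.gmat x"
  by (simp add: gram_def partial_d_cvec hess.gmat_def complexify_def vec_eq_iff) (simp add: G_def gorb_simps)

lemma gram_orbit:
  assumes "c \<in> A" "orbit_param act p0 x \<theta> \<in> cdom c"
  shows "gram (g c) (cmap c \<circ> orbit_param act p0 x) \<theta> = hess.gmat x"
proof -
  interpret metric_pullback "g c" "cmap c ` cdom c" "orb p0 c" "orb_dom p0 c" "complexify G"
    by (rule orb_pullback[OF assms(1)])
  have "cvec x \<theta> \<in> orb_dom p0 c" using assms by (simp add: orb_dom_def orbit_param_eq)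
  from gram_pull[OF smooth_on_cvec_right UNIV_I this]
  show ?thesis by (simp add: cmap_orbit_param gram_cvec)
qed

definition cube_volume :: real where
  "cube_volume = measure lborel (cbox 0 (\<chi> i. 2 * pi) :: (real ^ 'n) set)"

lemma cube_volume_pos: "cube_volume > 0"
  unfolding cube_volume_def
  by (subst content_pos_lt_eq) (auto simp: Basis_vec_def inner_axis)

text \<open>The Gram matrix is the same at all angles and in all charts, so the integrand is
  constant and the integral contributes only the volume of the period cube.\<close>

lemma orbit_volume_eq: "orbit_volume A g act p0 x = cube_volume * sqrt (det (hess.gmat x))"
proof -
  have "(let c = chart_at A (orbit_param act p0 x \<theta>) in
      sqrt (det (gram (g c) (cmap c \<circ> orbit_param act p0 x) \<theta>))) = sqrt (det (hess.gmat x))" for \<theta>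
    using gram_orbit[OF chart_at] by (simp add: Let_def)
  then show ?thesis
    by (simp add: orbit_volume_def riem_volume_def cube_volume_def)
qed

lemma orbit_volume_pos: "orbit_volume A g act p0 x > 0"
  by (simp add: orbit_volume_eq cube_volume_pos hess.det_gmat_pos)

lemma has_derivative_ln_volume:
  "((\<lambda>x. ln (orbit_volume A g act p0 x)) has_derivative hess.trC x) (at x)"
proof -
  have "ln (orbit_volume A g act p0 x) = ln cube_volume + ln (sqrt (det (hess.gmat x)))" for x
    unfolding orbit_volume_eq using cube_volume_pos hess.det_gmat_pos[of x] by (intro ln_mult_pos) simp_all
  moreover have "((\<lambda>x. ln cube_volume + ln (sqrt (det (hess.gmat x)))) has_derivative (\<lambda>v. 0 + hess.trC x v)) (at x)"
    by (intro has_derivative_add has_derivative_const) (use hess.has_derivative_ln_density in simp)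
  ultimately show ?thesis by simp
qed

lemma ricci_orbit:
  assumes "c \<in> A" "w \<in> orb_dom p0 c"
  shows "ricci (g c) (orb p0 c w) (dorb p0 c w v) (dorb p0 c w v)
    = - hess.dtrC (re_vec w) (re_vec v) (re_vec v) - hess.dtrC (re_vec w) (im_vec v) (im_vec v)"
proof -
  interpret metric_pullback "g c" "cmap c ` cdom c" "orb p0 c" "orb_dom p0 c" "complexify G"
    by (rule orb_pullback[OF assms(1)])
  show ?thesis using ricci_pull[OF assms(2), of v v] hess.ricci_H[of w v] by simp
qed

lemma hess_dtrC_zero: "hess.dtrC x 0 0 = 0"
  by (simp add: hess.dtrC_def hess.dC_zero)

text \<open>The factor \<open>\<sigma>\<close> treats both signs of the curvature at once. Real
  tangent vectors give one direction; for the other, the real and imaginary parts contribute terms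
  of the same sign, at least one of them strict.\<close>

lemma ricci_sign_iff:
  assumes "\<sigma> = 1 \<or> \<sigma> = - 1"
  shows "(\<forall>p\<in>big_orbit act p0. \<forall>c\<in>A. p \<in> cdom c \<longrightarrow> (\<forall>v. v \<noteq> 0 \<longrightarrow> \<sigma> * ricci (g c) (cmap c p) v v < 0))
    \<longleftrightarrow> (\<forall>x v. v \<noteq> 0 \<longrightarrow> \<sigma> * hess.dtrC x v v > 0)" (is "?L \<longleftrightarrow> ?R")
proof
  assume L: ?L
  show ?R
  proof (intro allI impI)
    fix x v :: "real ^ 'n" assume v: "v \<noteq> 0"
    obtain c where c: "c \<in> A" "cvec x 0 \<in> orb_dom p0 c" using ex_orb_chart by blast
    have "cvec v 0 \<noteq> 0" using v by (simp add: re_im_zero_iff)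
    then have nz: "dorb p0 c (cvec x 0) (cvec v 0) \<noteq> 0"
      using inj_dorb[OF c] linear_injective_0[OF linear_dorb[OF c]] by blast
    have p: "flow p0 (cvec x 0) \<in> big_orbit act p0" "flow p0 (cvec x 0) \<in> cdom c"
      using c by (auto simp: big_orbit_eq orb_dom_def)
    have "\<sigma> * ricci (g c) (orb p0 c (cvec x 0)) (dorb p0 c (cvec x 0) (cvec v 0)) (dorb p0 c (cvec x 0) (cvec v 0)) < 0"
      using L[THEN bspec, OF p(1), THEN bspec, OF c(1)] p(2) nz unfolding orb_def[symmetric] by simp
    then show "\<sigma> * hess.dtrC x v v > 0"
      unfolding ricci_orbit[OF c] by (simp add: hess_dtrC_zero)
  qed
next
  assume R: ?R
  show ?L
  proof (intro ballI allI impI)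
    fix p c v assume p: "p \<in> big_orbit act p0" and c: "c \<in> A" "p \<in> cdom c" and v: "v \<noteq> (0 :: complex ^ 'n)"
    obtain w where w: "p = flow p0 w" using p by (auto simp: big_orbit_eq)
    with c have wc: "w \<in> orb_dom p0 c" by (simp add: orb_dom_def)
    obtain u where u: "v = dorb p0 c w u"
      using linear_inj_imp_surj[OF linear_dorb[OF c(1) wc] inj_dorb[OF c(1) wc]] by (metis surjD)
    have "u \<noteq> 0" using v u linear_0[OF linear_dorb[OF c(1) wc]] by metis
    have nn: "\<sigma> * hess.dtrC x y y \<ge> 0" for x y
      using R hess_dtrC_zero by (cases "y = 0") (auto intro: less_imp_le)
    have "\<sigma> * hess.dtrC (re_vec w) (re_vec u) (re_vec u) + \<sigma> * hess.dtrC (re_vec w) (im_vec u) (im_vec u) > 0"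
    proof (cases "re_vec u = 0")
      case True
      with \<open>u \<noteq> 0\<close> have "im_vec u \<noteq> 0" by (simp add: re_im_zero_iff)
      with R nn show ?thesis by (intro add_nonneg_pos) auto
    next
      case False
      with R nn show ?thesis by (intro add_pos_nonneg) auto
    qed
    then show "\<sigma> * ricci (g c) (cmap c p) v v < 0"
      unfolding w u orb_def[symmetric] ricci_orbit[OF c(1) wc] by (simp add: algebra_simps)
  qed
qed

lemma ric_negative_iff: "ric_negative_on A g (big_orbit act p0) \<longleftrightarrow> (\<forall>x v. v \<noteq> 0 \<longrightarrow> hess.dtrC x v v > 0)"
  using ricci_sign_iff[of 1] unfolding ric_negative_on_def by simp

lemma ric_positive_iff: "ric_positive_on A g (big_orbit act p0) \<longleftrightarrow> (\<forall>x v. v \<noteq> 0 \<longrightarrow> hess.dtrC x v v < 0)"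
  using ricci_sign_iff[of "- 1"] unfolding ric_positive_on_def by simp

end

section \<open>Strict convexity\<close>

lemma has_real_derivative_along_line:
  assumes "(f has_derivative f') (at (x + t *\<^sub>R v))"
  shows "((\<lambda>t. f (x + t *\<^sub>R v)) has_real_derivative f' v) (at t)"
proof -
  have "((\<lambda>t. x + t *\<^sub>R v) has_derivative (\<lambda>r. r *\<^sub>R v)) (at t)"
    by (auto intro!: derivative_eq_intros)
  from diff_chain_at[OF this assms]
  have "((\<lambda>t. f (x + t *\<^sub>R v)) has_derivative (\<lambda>r. f' (r *\<^sub>R v))) (at t)"
    by (simp add: o_def)
  then show ?thesis
    using linear_cmul[OF has_derivative_linear[OF assms]]
    by (simp add: has_field_derivative_def mult_commute_abs)
qed

text \<open>Uniqueness of derivatives identifies those granted by the definition with the given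
  ones; every point is the point at \<open>t = 0\<close> of its own lines.\<close>

lemma strictly_convex_iff:
  fixes f :: "'e::real_normed_vector \<Rightarrow> real"
  assumes f1: "\<And>x. (f has_derivative f1 x) (at x)"
    and f2: "\<And>x v. ((\<lambda>y. f1 y v) has_derivative (\<lambda>u. f2 x u v)) (at x)"
  shows "strictly_convex f \<longleftrightarrow> (\<forall>x v. v \<noteq> 0 \<longrightarrow> f2 x v v > 0)"
proof
  note l1 = has_real_derivative_along_line[OF f1] and l2 = has_real_derivative_along_line[OF f2]
  {
    assume s: "strictly_convex f"
    show "\<forall>x v. v \<noteq> 0 \<longrightarrow> f2 x v v > 0"
    proof (intro allI impI)
      fix x v :: 'e assume "v \<noteq> 0"
      then obtain f' f'' where
        d1: "\<And>t. ((\<lambda>t. f (x + t *\<^sub>R v)) has_real_derivative f' t) (at t)"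
        and d2: "\<And>t. (f' has_real_derivative f'' t) (at t)" and pos: "\<And>t. f'' t > 0"
        using s unfolding strictly_convex_def by blast
      have "f' = (\<lambda>t. f1 (x + t *\<^sub>R v) v)"
        using DERIV_unique[OF d1 l1] by blast
      then have "f'' 0 = f2 (x + 0 *\<^sub>R v) v v"
        using DERIV_unique[OF d2[of 0]] l2[where x = x and t = 0] by simp
      with pos[of 0] show "f2 x v v > 0" by simp
    qed
  next
    assume p: "\<forall>x v. v \<noteq> 0 \<longrightarrow> f2 x v v > 0"
    show "strictly_convex f"
      unfolding strictly_convex_def
    proof (intro allI impI)
      fix x v :: 'e assume v: "v \<noteq> 0"
      show "\<exists>f' f''. \<forall>t. ((\<lambda>t. f (x + t *\<^sub>R v)) has_real_derivative f' t) (at t) \<and>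
          (f' has_real_derivative f'' t) (at t) \<and> f'' t > 0"
        by (rule exI[of _ "\<lambda>t. f1 (x + t *\<^sub>R v) v"], rule exI[of _ "\<lambda>t. f2 (x + t *\<^sub>R v) v v"])
          (use l1 l2 p v in simp)
    qed
  }
qed

text \<open>The second derivative along a line is exp f times (f')^2 + f''. Applied to log Vol and
  to its negative, it yields the claims about Vol and 1/Vol.\<close>

lemma strictly_convex_exp:
  assumes "strictly_convex f"
  shows "strictly_convex (\<lambda>x. exp (f x))"
  unfolding strictly_convex_def
proof (intro allI impI)
  fix x v :: 'a assume "v \<noteq> 0"
  then obtain f' f'' where
    d1: "\<And>t. ((\<lambda>t. f (x + t *\<^sub>R v)) has_real_derivative f' t) (at t)"
    and d2: "\<And>t. (f' has_real_derivative f'' t) (at t)" and pos: "\<And>t. f'' t > 0"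
    using assms unfolding strictly_convex_def by blast
  let ?e = "\<lambda>t. exp (f (x + t *\<^sub>R v))"
  have e: "(?e has_real_derivative ?e t * f' t) (at t)" for t
    by (rule DERIV_chain2[OF DERIV_exp d1])
  have "((\<lambda>t. ?e t * f' t) has_real_derivative (?e t * f' t) * f' t + f'' t * ?e t) (at t)" for t
    by (rule DERIV_mult[OF e d2])
  moreover have "(?e t * f' t) * f' t + f'' t * ?e t > 0" for t
  proof -
    have "(?e t * f' t) * f' t + f'' t * ?e t = ?e t * ((f' t)\<^sup>2 + f'' t)"
      by (simp add: power2_eq_square algebra_simps)
    moreover have "(f' t)\<^sup>2 + f'' t > 0" using pos[of t] by (intro add_nonneg_pos) auto
    ultimately show ?thesis by simp
  qed
  ultimately show "\<exists>f' f''. \<forall>t. (?e has_real_derivative f' t) (at t) \<and> (f' has_real_derivative f'' t) (at t) \<and> f'' t > 0"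
    using e by (intro exI[of _ "\<lambda>t. ?e t * f' t"] exI[of _ "\<lambda>t. (?e t * f' t) * f' t + f'' t * ?e t"]) simp
qed

text \<open>At a maximum the derivative along a line is zero and then becomes positive, so the
  function still rises. This excludes compactness for negative curvature.\<close>

lemma strictly_convex_not_max:
  fixes f :: "'e::euclidean_space \<Rightarrow> real"
  assumes "strictly_convex f"
  shows "\<exists>y. f y > f x"
proof (rule ccontr)
  assume "\<not> ?thesis"
  then have max: "f y \<le> f x" for y by (simp add: not_less)
  obtain v :: 'e where "v \<noteq> 0" using nonzero_Basis SOME_Basis by blast
  then obtain f' f'' where
    d1: "\<And>t. ((\<lambda>t. f (x + t *\<^sub>R v)) has_real_derivative f' t) (at t)"
    and d2: "\<And>t. (f' has_real_derivative f'' t) (at t)" and pos: "\<And>t. f'' t > 0"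
    using assms unfolding strictly_convex_def by blast
  have "f' 0 = 0"
    by (rule DERIV_local_max[OF d1[of 0], of 1]) (simp_all add: max)
  obtain z where z: "0 < z" "f (x + 1 *\<^sub>R v) - f (x + 0 *\<^sub>R v) = (1 - 0) * f' z"
    using MVT2[of 0 1 "\<lambda>t. f (x + t *\<^sub>R v)" f'] d1 by auto
  have "f' 0 < f' z"
    using d2 pos by (intro DERIV_pos_imp_increasing[OF z(1)]) blast
  with z max[of "x + v"] \<open>f' 0 = 0\<close> show False by simp
qed

text \<open>Along the segment from \<open>x\<close> to \<open>y\<close> the derivative is strictly
  increasing and cannot vanish at both ends.\<close>

lemma strictly_convex_critical_unique:
  fixes f :: "'e::real_normed_vector \<Rightarrow> real"
  assumes "strictly_convex f" and x: "(f has_derivative (\<lambda>_. 0)) (at x)" and y: "(f has_derivative (\<lambda>_. 0)) (at y)"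
  shows "x = y"
proof (rule ccontr)
  assume "x \<noteq> y"
  then have "y - x \<noteq> 0" by simp
  then obtain f' f'' where
    d1: "\<And>t. ((\<lambda>t. f (x + t *\<^sub>R (y - x))) has_real_derivative f' t) (at t)"
    and d2: "\<And>t. (f' has_real_derivative f'' t) (at t)" and pos: "\<And>t. f'' t > 0"
    using assms(1) unfolding strictly_convex_def by blast
  have "f' 0 = 0" "f' 1 = 0"
    using DERIV_unique[OF d1[of 0]] has_real_derivative_along_line[of f "\<lambda>_. 0" x 0 "y - x"] x
      DERIV_unique[OF d1[of 1]] has_real_derivative_along_line[of f "\<lambda>_. 0" x 1 "y - x"] y by simp_all
  moreover have "f' 0 < f' 1"
    using d2 pos by (intro DERIV_pos_imp_increasing[OF zero_less_one]) blast
  ultimately show False by simp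
qed


section \<open>Compact toric manifolds\<close>

context toric_kaehler
begin

text \<open>The Gram determinant of the fundamental fields. It is defined on all of the manifold,
  degenerate orbits included, and on the big orbit it is a constant multiple of the squared orbit
  volume.\<close>

definition orbit_density :: "'a \<Rightarrow> real" where
  "orbit_density p = det (\<chi> i j. gorb p 0 (cvec 0 (axis i 1)) (cvec 0 (axis j 1)))"

lemma orbit_density_flow: "orbit_density (flow p0 w) = det (hess.gmat (re_vec w))"
proof -
  have "gorb (flow p0 w) 0 (cvec 0 X) (cvec 0 Y) = G (re_vec w) X Y" for X Y
    by (simp add: gorb_flow gorb_eq_complexify complexify_def bilinear_lzero[OF hess.bilinear_h])
  then show ?thesis by (simp add: orbit_density_def hess.gmat_def)
qed

lemma continuous_orbit_density: "continuous_on UNIV orbit_density"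
proof -
  have "continuous_on (cdom c) orbit_density" if c: "c \<in> A" for c
  proof -
    interpret local_metric "g c" "cmap c ` cdom c" by (rule chart_metric[OF c])
    \<comment> \<open>The base point now varies, so the generators are taken from the derivative of
      the action at the unit, which is smooth in the point \<open>x\<close>.\<close>
    define \<xi> where "\<xi> v x = dir_deriv (act_in c c) (1, x) (v, 0)" for v x
    have lin: "linear (\<lambda>x :: complex ^ 'n. (0 :: complex ^ 'n, x))" by (rule linearI) auto
    have "smooth_on (\<lambda>x. (1 :: complex ^ 'n, 0 :: complex ^ 'n) + (0, x)) (cmap c ` cdom c)"
      by (intro smooth_on_add[OF open_U smooth_on_const smooth_on_linear[OF lin]])
    then have "smooth_on (\<lambda>x. (1 :: complex ^ 'n, x)) (cmap c ` cdom c)" by simp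
    then have \<xi>: "smooth_on (\<xi> v) (cmap c ` cdom c)" for v
      unfolding \<xi>_def
      by (rule smooth_on_compose[OF open_U open_act_dom[OF c c] smooth_on_dir_deriv[OF smooth_act_in[OF c c]]])
        (auto simp: act_dom_def ctorus_def c)
    have "smooth_on (\<lambda>x. g c x (\<xi> v x) (\<xi> u x)) (cmap c ` cdom c)" for v u
      by (rule smooth_on_bilinear_family[OF open_U smooth_h bilinear_h \<xi> \<xi>])
    then have "continuous_on (cmap c ` cdom c) (\<lambda>x. g c x (\<xi> v x) (\<xi> u x))" for v u
      by (rule smooth_on_continuous_on)
    from continuous_on_compose2[OF this continuous_on_cmap[OF c] order_refl]
    have "continuous_on (cdom c) (\<lambda>p. g c (cmap c p) (\<xi> v (cmap c p)) (\<xi> u (cmap c p)))" for v u .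
    moreover have "gorb p 0 v u = g c (cmap c p) (\<xi> v (cmap c p)) (\<xi> u (cmap c p))" if "p \<in> cdom c" for p v u
      using gorb_eq[OF c orb_dom_zero[OF that]] dorb_act_in[OF c c that orb_dom_zero[OF that]]
      by (simp add: \<xi>_def orb_def)
    ultimately have "continuous_on (cdom c) (\<lambda>p. gorb p 0 v u)" for v u
      by (simp cong: continuous_on_cong)
    then show ?thesis
      unfolding orbit_density_def[abs_def] det_def
      by (intro continuous_intros) simp
  qed
  then have "continuous_on (\<Union>c\<in>A. cdom c) orbit_density"
    by (intro continuous_on_open_UN open_cdom)
  moreover have "(\<Union>c\<in>A. cdom c) = UNIV" using ex_chart by blast
  ultimately show ?thesis by simp
qed

text \<open>Independence over the reals of the compact directions suffices: pairing a kernel vector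
  with imaginary vectors kills its imaginary part by orthogonality, and \<open>Jmul\<close> carries
  the argument over to the real part.\<close>

lemma inj_dorb_of_density:
  assumes p: "orbit_density p \<noteq> 0" and c: "c \<in> A" "p \<in> cdom c"
  shows "inj (dorb p c 0)"
  unfolding linear_injective_0[OF linear_dorb[OF c(1) orb_dom_zero[OF c(2)]]]
proof (intro allI impI)
  fix v assume v: "dorb p c 0 v = 0"
  interpret local_metric "g c" "cmap c ` cdom c" by (rule chart_metric[OF c(1)])
  note dom = orb_dom_zero[OF c(2)]
  have zero: "gorb p 0 v u = 0" for u
    by (simp add: gorb_eq[OF c(1) dom] v linear_0[OF linear_h(2)[OF orb_in_image[OF dom]]])
  have split: "v = cvec (re_vec v) 0 + cvec 0 (im_vec v)" by (simp add: cvec_add)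
  have kernel: "X = 0" if "\<And>Y. gorb p 0 (cvec 0 X) (cvec 0 Y) = 0" for X
  proof -
    let ?M = "\<chi> i j. gorb p 0 (cvec 0 (axis i 1)) (cvec 0 (axis j 1))"
    have lin: "linear (\<lambda>X. gorb p 0 (cvec 0 Y) (cvec 0 X))" for Y
      using bilinear_gorb[of p 0] unfolding bilinear_def
      by (intro linear_compose[of "cvec 0" "gorb p 0 (cvec 0 Y)", unfolded o_def]
          has_derivative_linear[OF has_derivative_cvec_right]) simp
    have "gorb p 0 (cvec 0 Y) (cvec 0 X) = (\<Sum>j\<in>UNIV. gorb p 0 (cvec 0 Y) (cvec 0 (axis j 1)) * X $ j)" for Y
      by (subst hess.axis_expansion[of X]) (simp add: linear_sum[OF lin] linear_cmul[OF lin] mult.commute)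
    then have "?M *v X = 0"
      using that gorb_sym[of p 0 "cvec 0 X"] by (simp add: matrix_vector_mult_def vec_eq_iff)
    then show "X = 0"
      using p det_nz_iff_inj[of "(*v) ?M"] linear_injective_0[of "(*v) ?M"]
      by (simp add: orbit_density_def matrix_vector_mul_linear)
  qed
  have "gorb p 0 (cvec 0 (im_vec v)) (cvec 0 Y) = 0" for Y
    using zero[of "cvec 0 Y"] by (subst (asm) split) (simp add: gorb_simps gorb_orthogonal)
  then have im: "im_vec v = 0" by (rule kernel)
  have "gorb p 0 (cvec 0 (re_vec v)) (cvec 0 Y) = 0" for Y
  proof -
    have "gorb p 0 (cvec (re_vec v) 0) (cvec Y 0) = 0"
      using zero[of "cvec Y 0"] im by (subst (asm) split) simp
    then show ?thesis using gorb_Jmul[of p 0 "cvec (re_vec v) 0" "cvec Y 0"] by (simp add: Jmul_cvec)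
  qed
  then have "re_vec v = 0" by (rule kernel)
  with im show "v = 0" by (simp add: re_im_zero_iff)
qed

text \<open>A non-degenerate orbit of the compact torus generates an open orbit of the complex torus,
  which meets the dense big orbit.\<close>

lemma nonzero_density_in_big_orbit:
  assumes "orbit_density p \<noteq> 0"
  shows "p \<in> big_orbit act p0"
proof -
  obtain c where c: "c \<in> A" "p \<in> cdom c" using ex_chart by blast
  note dom = orb_dom_zero[OF c(2)]
  note lin = linear_dorb[OF c(1) dom] and inj = inj_dorb_of_density[OF assms c]
  obtain L where L: "linear L" "dorb p c 0 \<circ> L = id"
    using linear_surjective_right_inverse[OF lin linear_inj_imp_surj[OF lin inj]] by blast
  \<comment> \<open>The differential is known to be invertible at 0 only; this already makes the
    image a neighbourhood of the point, and the interior is what has to meet the dense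
    orbit.\<close>
  let ?O = "interior (orb p c ` orb_dom p c)"
  have "orb p c 0 \<in> ?O"
  proof (rule sussmann_open_mapping)
    show "open (orb_dom p c)" by (rule open_orb_dom[OF c(1)])
    show "continuous_on (orb_dom p c) (orb p c)" by (rule smooth_on_continuous_on[OF smooth_orb[OF c(1)]])
    show "(orb p c has_derivative dorb p c 0) (at 0)" by (rule has_derivative_orb[OF c(1) dom])
    show "bounded_linear L" using L(1) by (simp add: linear_conv_bounded_linear)
    show "0 \<in> interior (orb_dom p c)" using dom by (simp add: interior_open open_orb_dom c(1))
  qed (use dom L in auto)
  then have p: "p \<in> cinv c ` ?O" using c by (force simp: orb_def)
  have sub: "?O \<subseteq> orb p c ` orb_dom p c" by (rule interior_subset)
  then have "open (cinv c ` ?O)"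
    using orb_in_image by (intro open_cinv_image c(1) open_interior) blast
  moreover have "closure (big_orbit act p0) = UNIV" using toric unfolding toric_manifold_def by blast
  ultimately have "cinv c ` ?O \<inter> big_orbit act p0 \<noteq> {}"
    using p open_Int_closure_eq_empty[of "cinv c ` ?O" "big_orbit act p0"] by auto
  then obtain q where q: "q \<in> big_orbit act p0" "q \<in> cinv c ` ?O" by blast
  then obtain w z where w: "w \<in> orb_dom p c" "q = cinv c (orb p c w)" "q = flow p0 z"
    using sub by (auto simp: big_orbit_eq)
  then have "flow p w = flow p0 z" using cinv_orb[OF c(1)] by simp
  \<comment> \<open>Acting by the inverse of \<open>cexp w\<close> moves the common point back to
    \<open>p\<close> along the big orbit.\<close>
  then have "flow (flow p w) (- w) = flow (flow p0 z) (- w)" by simp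
  then have "p = flow p0 (z - w)" by (simp add: flow_flow)
  then show ?thesis by (simp add: big_orbit_eq)
qed

lemma compact_volume_max:
  assumes "compact (UNIV :: 'a set)"
  shows "\<exists>x. \<forall>y. orbit_volume A g act p0 y \<le> orbit_volume A g act p0 x"
proof -
  obtain p where p: "\<And>q. orbit_density q \<le> orbit_density p"
    using continuous_attains_sup[OF assms UNIV_not_empty continuous_orbit_density] by blast
  \<comment> \<open>The maximum is at least the value at \<open>p0\<close>, where the Gram matrix is
    positive definite.\<close>
  have "orbit_density p > 0"
    using p[of "flow p0 0"] hess.det_gmat_pos[of 0] unfolding orbit_density_flow by simp
  then have "p \<in> big_orbit act p0" by (intro nonzero_density_in_big_orbit) simp
  then obtain w where w: "p = flow p0 w" by (auto simp: big_orbit_eq)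
  have "det (hess.gmat y) \<le> det (hess.gmat (re_vec w))" for y
    using p[of "flow p0 (cvec y 0)"] unfolding w orbit_density_flow by simp
  then show ?thesis
    using cube_volume_pos by (intro exI[of _ "re_vec w"]) (simp add: orbit_volume_eq)
qed

section \<open>Critical orbits\<close>

lemma orbit_param_vimage:
  "orbit_param act p0 x -` cdom c = cvec x -` orb_dom p0 c"
  by (auto simp: orbit_param_eq orb_dom_def)

lemma open_orbit_param_vimage: "c \<in> A \<Longrightarrow> open (cvec x -` orb_dom p0 c)"
  using continuous_open_preimage[OF smooth_on_continuous_on[OF smooth_on_cvec_right] open_UNIV open_orb_dom]
  by simp

lemma has_derivative_orbit_param:
  assumes "c \<in> A" "cvec x \<theta> \<in> orb_dom p0 c"
  shows "((cmap c \<circ> orbit_param act p0 x) has_derivative (\<lambda>t. dorb p0 c (cvec x \<theta>) (cvec 0 t))) (at \<theta>)"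
  unfolding cmap_orbit_param
  using diff_chain_at[OF has_derivative_cvec_right has_derivative_orb[OF assms]] by (simp add: o_def)

lemma immersion_orbit_param: "immersion A (orbit_param act p0 x)"
  unfolding immersion_def orbit_param_vimage
proof (intro conjI ballI)
  show "continuous_on UNIV (orbit_param act p0 x)"
    unfolding orbit_param_eq[abs_def]
    by (rule continuous_on_compose2[OF continuous_flow smooth_on_continuous_on[OF smooth_on_cvec_right]]) simp
  fix c assume c: "c \<in> A"
  show "smooth_on (cmap c \<circ> orbit_param act p0 x) (cvec x -` orb_dom p0 c)"
    unfolding cmap_orbit_param unfolding o_def
    by (rule smooth_on_compose[OF open_orbit_param_vimage open_orb_dom smooth_orb smooth_on_cvec_right])
      (simp_all add: c)
  fix \<theta> assume "\<theta> \<in> cvec x -` orb_dom p0 c"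
  then have \<theta>: "cvec x \<theta> \<in> orb_dom p0 c" by simp
  show "inj (dir_deriv (cmap c \<circ> orbit_param act p0 x) \<theta>)"
    using inj_dorb[OF c \<theta>] unfolding inj_def dir_deriv_eq[OF has_derivative_orbit_param[OF c \<theta>]]
    by (metis cvec_eq_iff)
qed

lemma range_orbit_param: "range (orbit_param act p0 x) = torus_orbit act p0 x"
proof -
  have t: "torus = range (\<lambda>\<theta> :: real ^ 'n. cexp (cvec 0 \<theta>))"
  proof (intro equalityI subsetI)
    fix t :: "complex ^ 'n" assume t: "t \<in> torus"
    have "exp (Complex 0 (Arg (t $ i))) = t $ i" for i
    proof -
      have n: "norm (t $ i) = 1" using t by (simp add: torus_def)
      then have "t $ i \<noteq> 0" by auto
      with n show ?thesis by (simp add: exp_eq_polar cis_Arg sgn_div_norm)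
    qed
    then have "t = cexp (cvec 0 (\<chi> i. Arg (t $ i)))"
      by (simp add: cexp_def cvec_def vec_eq_iff)
    then show "t \<in> range (\<lambda>\<theta>. cexp (cvec 0 \<theta>))" by blast
  qed (auto simp: torus_def cexp_def cvec_def)
  have e: "(\<chi> i. exp (complex_of_real (x $ i))) = cexp (cvec x 0)"
    by (simp add: cexp_def cvec_def complex_of_real_def)
  have "act (cexp (cvec 0 \<theta>)) (act (cexp (cvec x 0)) p0) = orbit_param act p0 x \<theta>" for \<theta>
    using act_flow[of "cvec 0 \<theta>" p0 "cvec x 0"] by (simp add: orbit_param_eq cvec_add flow_def[symmetric])
  then show ?thesis
    unfolding torus_orbit_def e t by (auto simp: image_image)
qed

lemma orbit_param_periodic:
  "orbit_param act p0 x \<theta> = orbit_param act p0 x \<eta> \<longleftrightarrow> (\<forall>i. \<exists>k::int. \<theta> $ i - \<eta> $ i = 2 * pi * of_int k)"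
proof -
  have "exp (Complex a s) = exp (Complex a t) \<longleftrightarrow> (\<exists>k::int. s - t = 2 * pi * of_int k)" for a s t
    unfolding exp_eq by (auto simp: complex_eq_iff algebra_simps)
  then show ?thesis
    unfolding orbit_param_eq flow_p0_inj by (simp add: cexp_def cvec_def vec_eq_iff)
qed

text \<open>Tangent vectors of the orbit are imaginary and \<open>Jmul\<close> makes them real, so
  the Kaehler form reduces to a mixed term of the metric.\<close>

lemma lagrangian_orbit_param: "lagrangian A g (orbit_param act p0 x)"
  unfolding lagrangian_def orbit_param_vimage
proof (intro ballI allI)
  fix c \<theta> v w assume c: "c \<in> A" and "\<theta> \<in> cvec x -` orb_dom p0 c"
  then have \<theta>: "cvec x \<theta> \<in> orb_dom p0 c" by simp
  have x: "cmap c (orbit_param act p0 x \<theta>) = orb p0 c (cvec x \<theta>)" by (simp add: orb_def orbit_param_eq)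
  show "kaehler_form g c (cmap c (orbit_param act p0 x \<theta>))
      (dir_deriv (cmap c \<circ> orbit_param act p0 x) \<theta> v) (dir_deriv (cmap c \<circ> orbit_param act p0 x) \<theta> w) = 0"
    unfolding dir_deriv_eq[OF has_derivative_orbit_param[OF c \<theta>]] kaehler_form_def x
      dorb_Jmul[OF c \<theta>, symmetric] gorb_eq[OF c \<theta>, symmetric] Jmul_cvec
    by (rule gorb_orthogonal)
qed

lemma minimal_orbit_param:
  assumes crit: "\<And>v. hess.trC x v = 0"
  shows "minimal A g (orbit_param act p0 x)"
  unfolding minimal_def orbit_param_vimage
proof (intro ballI)
  fix c \<theta> assume c: "c \<in> A" and "\<theta> \<in> cvec x -` orb_dom p0 c"
  then have \<theta>: "cvec x \<theta> \<in> orb_dom p0 c" by simp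
  interpret metric_pullback "g c" "cmap c ` cdom c" "orb p0 c" "orb_dom p0 c" "complexify G"
    by (rule orb_pullback[OF c])
  note lin = linear_dorb[OF c \<theta>]
  let ?C = "\<lambda>i j. hess.C x (axis i 1) (axis j 1)"
  \<comment> \<open>The tangent vectors \<open>cvec 0 (axis i 1)\<close> are constant, so only the
    connection contributes; its complex bilinearity gives the minus sign and a real result, which is
    normal to the orbit.\<close>
  have acc: "partial_d (partial_d (cvec x) j) i \<theta>
      + christoffel (complexify G) (cvec x \<theta>) (partial_d (cvec x) i \<theta>) (partial_d (cvec x) j \<theta>)
    = cvec (- ?C i j) 0" for i j
  proof -
    have "partial_d (partial_d (cvec x) j) i \<theta> = 0"
      unfolding partial_d_cvec[abs_def] partial_d_def by (rule dir_deriv_eq) simp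
    then show ?thesis
      by (simp add: partial_d_cvec hess.christoffel_H hess.C_simps)
  qed
  have ff: "second_ff (g c) (orb p0 c \<circ> cvec x) \<theta> i j = dorb p0 c (cvec x \<theta>) (cvec (- ?C i j) 0)" for i j
    unfolding acc[symmetric]
  proof (rule second_ff_pull[OF open_orbit_param_vimage[OF c]])
    show "\<theta> \<in> cvec x -` orb_dom p0 c" using \<theta> by simp
    show "smooth_on (cvec x) (cvec x -` orb_dom p0 c)" by (rule smooth_on_cvec_right)
    show "complexify G (cvec x \<theta>) (partial_d (partial_d (cvec x) j) i \<theta>
        + christoffel (complexify G) (cvec x \<theta>) (partial_d (cvec x) i \<theta>) (partial_d (cvec x) j \<theta>))
        (partial_d (cvec x) k \<theta>) = 0" for k
      unfolding acc
      by (simp add: partial_d_cvec complexify_def bilinear_lzero[OF hess.bilinear_h] bilinear_rzero[OF hess.bilinear_h])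
  qed simp
  have gr: "gram (g c) (orb p0 c \<circ> cvec x) \<theta> = hess.gmat x"
    using gram_pull[OF smooth_on_cvec_right UNIV_I \<theta>] gram_cvec by simp
  have lin': "linear (\<lambda>X :: real ^ 'n. dorb p0 c (cvec x \<theta>) (cvec X 0))"
    using linear_compose[OF _ lin, of "\<lambda>X. cvec X 0"]
    by (simp add: o_def linear_iff cvec_add cvec_scaleR)
  have "mean_curvature (g c) (orb p0 c \<circ> cvec x) \<theta> = - dorb p0 c (cvec x \<theta>)
      (cvec (\<Sum>i\<in>UNIV. \<Sum>j\<in>UNIV. matrix_inv (hess.gmat x) $ i $ j *\<^sub>R ?C i j) 0)"
    unfolding mean_curvature_def ff gr cvec_neg
    by (simp add: linear_neg[OF lin] linear_sum[OF lin'] linear_cmul[OF lin'] sum_negf)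
  also have "\<dots> = 0"
    unfolding hess.trace_second_ff_zero[OF crit] using linear_0[OF lin] by simp
  finally show "mean_curvature (g c) (cmap c \<circ> orbit_param act p0 x) \<theta> = 0"
    by (simp add: cmap_orbit_param)
qed

lemma minimal_lagrangian_torus_orbit:
  "(\<And>v. hess.trC x v = 0) \<Longrightarrow> minimal_lagrangian_torus A g (torus_orbit act p0 x)"
  unfolding minimal_lagrangian_torus_def
  using immersion_orbit_param range_orbit_param orbit_param_periodic lagrangian_orbit_param minimal_orbit_param
  by (intro exI[of _ "orbit_param act p0 x"]) simp

section \<open>Convexity and critical points of the volume\<close>

abbreviation Vol :: "real ^ 'n \<Rightarrow> real" where "Vol \<equiv> orbit_volume A g act p0"

lemma ric_negative_iff_convex:
  "ric_negative_on A g (big_orbit act p0) \<longleftrightarrow> strictly_convex (\<lambda>x. ln (Vol x))"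
  unfolding ric_negative_iff
  by (rule strictly_convex_iff[OF has_derivative_ln_volume hess.has_derivative_trC, symmetric])

lemma has_derivative_neg_ln_volume: "((\<lambda>x. - ln (Vol x)) has_derivative (\<lambda>v. - hess.trC x v)) (at x)"
  by (rule has_derivative_minus[OF has_derivative_ln_volume])

lemma ric_positive_iff_convex:
  "ric_positive_on A g (big_orbit act p0) \<longleftrightarrow> strictly_convex (\<lambda>x. - ln (Vol x))"
  unfolding ric_positive_iff
  using strictly_convex_iff[OF has_derivative_neg_ln_volume has_derivative_minus[OF hess.has_derivative_trC]]
  by simp

lemma has_derivative_volume: "(Vol has_derivative (\<lambda>v. hess.trC x v * Vol x)) (at x)"
proof -
  have "(exp has_derivative (*) (exp (ln (Vol x)))) (at (ln (Vol x)))"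
    using DERIV_exp by (simp add: has_field_derivative_def)
  from diff_chain_at[OF has_derivative_ln_volume this]
  have "((\<lambda>x. exp (ln (Vol x))) has_derivative (\<lambda>v. exp (ln (Vol x)) * hess.trC x v)) (at x)"
    by (simp add: o_def)
  then show ?thesis by (simp add: orbit_volume_pos mult.commute)
qed

lemma critical_point_volume_iff: "critical_point Vol x \<longleftrightarrow> (\<forall>v. hess.trC x v = 0)"
proof
  assume "critical_point Vol x"
  then have "(\<lambda>v. hess.trC x v * Vol x) = (\<lambda>_. 0)"
    using has_derivative_unique[OF has_derivative_volume] unfolding critical_point_def by blast
  from fun_cong[OF this] orbit_volume_pos[of x] show "\<forall>v. hess.trC x v = 0" by simp
next
  assume "\<forall>v. hess.trC x v = 0"
  then show "critical_point Vol x"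
    using has_derivative_volume[of x] by (simp add: critical_point_def)
qed

lemma volume_max_critical:
  assumes "\<And>y. Vol y \<le> Vol x"
  shows "critical_point Vol x"
proof -
  have "(\<lambda>v. hess.trC x v * Vol x) = (\<lambda>v. 0)"
    by (rule differential_zero_maxmin[OF UNIV_I open_UNIV has_derivative_volume]) (use assms in blast)
  then show ?thesis using has_derivative_volume[of x] by (simp add: critical_point_def)
qed

text \<open>\<open>Vol\<close> is positive, so it has the same critical points as minus its
  logarithm, and strict convexity of the latter admits at most one.\<close>

lemma critical_point_unique:
  assumes "strictly_convex (\<lambda>x. - ln (Vol x))" "critical_point Vol x" "critical_point Vol y"
  shows "x = y"
  using strictly_convex_critical_unique[OF assms(1)] has_derivative_neg_ln_volume[of x] has_derivative_neg_ln_volume[of y] assms(2,3)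
  by (simp add: critical_point_volume_iff)

end

theorem mainTheorem1:
  fixes A :: "('a::{t2_space,second_countable_topology}, 'n::finite) chart set"
    and act :: "complex ^ 'n \<Rightarrow> 'a \<Rightarrow> 'a"
    and p0 :: 'a
    and g :: "('a, 'n) metric"
    and Vol :: "real ^ 'n \<Rightarrow> real"
  assumes "toric_manifold A act p0"
    and "kaehler_metric A g"
    and "hamiltonian_torus_action A g act"
  defines "Vol \<equiv> orbit_volume A g act p0"
  shows
    "(ric_negative_on A g (big_orbit act p0) \<longleftrightarrow> strictly_convex (\<lambda>x. ln (Vol x))) \<and>
     (ric_negative_on A g (big_orbit act p0) \<longrightarrow> strictly_convex Vol) \<and>
     (ric_negative_on A g (big_orbit act p0) \<longrightarrow> \<not> compact (UNIV :: 'a set)) \<and>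
     (ric_positive_on A g (big_orbit act p0) \<longleftrightarrow> strictly_convex (\<lambda>x. - ln (Vol x))) \<and>
     (ric_positive_on A g (big_orbit act p0) \<longrightarrow> strictly_convex (\<lambda>x. 1 / Vol x)) \<and>
     (ric_positive_on A g (big_orbit act p0) \<longrightarrow> compact (UNIV :: 'a set) \<longrightarrow>
        (\<exists>x. (\<forall>y. critical_point Vol y \<longleftrightarrow> y = x) \<and>
             (\<forall>y. Vol y \<le> Vol x) \<and>
             minimal_lagrangian_torus A g (torus_orbit act p0 x)))"
proof -
  interpret toric_kaehler A act p0 g
    using assms by unfold_locales
  \<comment> \<open>Positivity of the volume lets both \<open>Vol\<close> and its reciprocal be
    written as exponentials of strictly convex functions.\<close>
  have exp_ln: "exp (ln (Vol x)) = Vol x" "exp (- ln (Vol x)) = 1 / Vol x" for x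
    using orbit_volume_pos[of x] by (simp_all add: Vol_def exp_minus inverse_eq_divide)
  note neg = ric_negative_iff_convex[folded Vol_def] and pos = ric_positive_iff_convex[folded Vol_def]
  have 1: "strictly_convex Vol" if "strictly_convex (\<lambda>x. ln (Vol x))"
    using strictly_convex_exp[OF that] unfolding exp_ln .
  have 2: "strictly_convex (\<lambda>x. 1 / Vol x)" if "strictly_convex (\<lambda>x. - ln (Vol x))"
    using strictly_convex_exp[OF that] unfolding exp_ln .
  have 3: "\<not> compact (UNIV :: 'a set)" if "strictly_convex (\<lambda>x. ln (Vol x))"
    using strictly_convex_not_max[OF 1[OF that]] compact_volume_max unfolding Vol_def by (metis not_less)
  have 4: "\<exists>x. (\<forall>y. critical_point Vol y \<longleftrightarrow> y = x) \<and> (\<forall>y. Vol y \<le> Vol x) \<and>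
      minimal_lagrangian_torus A g (torus_orbit act p0 x)"
    if convex: "strictly_convex (\<lambda>x. - ln (Vol x))" and cpt: "compact (UNIV :: 'a set)"
  proof -
    \<comment> \<open>Existence of a critical point is due to compactness; convexity only
      contributes its uniqueness.\<close>
    obtain x where x: "\<And>y. Vol y \<le> Vol x" using compact_volume_max[OF cpt] unfolding Vol_def by blast
    have crit: "critical_point Vol x" using volume_max_critical x unfolding Vol_def by blast
    have "critical_point Vol y \<longleftrightarrow> y = x" for y
      using critical_point_unique convex crit unfolding Vol_def by blast
    moreover have "minimal_lagrangian_torus A g (torus_orbit act p0 x)"
      using crit minimal_lagrangian_torus_orbit unfolding Vol_def critical_point_volume_iff by blast
    ultimately show ?thesis using x by blast
  qed
  show ?thesis using neg pos 1 2 3 4 by blast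
qed

end
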